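(* Let $\mathbb{G}$ be a compact quantum group, let $\mathsf{B}$ be a unital $C^*$-algebra and let $\beta\colon C^u(\mathbb{G})\to\mathsf{B}$ be a unital ${}^*$-homomorphism. Let $\mathbb{H}$ be the Hopf image of $\beta$, with quotient map $\pi\colon C^u(\mathbb{G})\to C^u(\mathbb{H})$. Let $b\colon C(Gr(\widehat{\mathbb{G}}))\to C(\sigma(\mathsf{B}))$ be the ${}^*$-homomorphism determined by $b\circ q_{\mathbb{G}}=q_{\mathsf{B}}\circ\beta$, with Gelfand dual $\hat b\colon\sigma(\mathsf{B})\to Gr(\widehat{\mathbb{G}})$. Then the closed subgroup of $Gr(\widehat{\mathbb{G}})$ generated by the image of $\hat b$ (that is, the Hopf image of $b$) is contained in $Gr(\widehat{\mathbb{H}})$: $$\overline{\langle \hat b[\sigma(\mathsf{B})]\rangle}\subseteq Gr(\widehat{\mathbb{H}}),$$ where $Gr(\widehat{\mathbb{H}})$ is regarded as a closed subgroup of $Gr(\widehat{\mathbb{G}})$.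
   Context: Compact quantum groups are in the sense of Woronowicz; $C^u(\mathbb{G})$ is the universal $C^*$-completion of the Hopf ${}^*$-algebra $\mathcal{O}(\mathbb{G})$ of matrix coefficients of $\mathbb{G}$. Hopf image: given a ${}^*$-homomorphism $\beta\colon C^u(\mathbb{G})\to\mathsf{B}$, consider triples $(C^u(\mathbb{L}),\pi,\tilde\beta)$ where $\mathbb{L}$ is a compact quantum group, $\pi\colon C^u(\mathbb{G})\to C^u(\mathbb{L})$ is a surjective ${}^*$-homomorphism intertwining the coproducts, and $\tilde\beta\colon C^u(\mathbb{L})\to\mathsf{B}$ is a ${}^*$-homomorphism with $\tilde\beta\circ\pi=\beta$. The Hopf image of $\beta$ is the final object among these: the triple $(C^u(\mathbb{H}),\pi,\tilde\beta)$ such that for every other such triple $(C^u(\mathbb{L}),\pi',\tilde\beta')$ there is a (unique) coproduct-intertwining ${}^*$-homomorphism $r\colon C^u(\mathbb{L})\to C^u(\mathbb{H})$ with $r\circ\pi'=\pi$ and $\tilde\beta\circ r=\tilde\beta'$. One also calls $\mathbb{H}$ itself the Hopf image. Group of characters: $q_{\mathbb{G}}\colon C^u(\mathbb{G})\to C(Gr(\widehat{\mathbb{G}}))$ is the quotient by the closed ideal generated by all commutators; $Gr(\widehat{\mathbb{G}})$ is the spectrum of this commutative quotient, a compact group which is a closed (quantum) subgroup of $\mathbb{G}$ (its maximal classical subgroup). The same notation is used for $\mathbb{H}$. Since $q_{\mathbb{H}}\circ\pi$ has commutative target, it factors as $q_{\mathbb{H}}\circ\pi=p\circ q_{\mathbb{G}}$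 with $p\colon C(Gr(\widehat{\mathbb{G}}))\to C(Gr(\widehat{\mathbb{H}}))$ surjective; the Gelfand dual of $p$ is the embedding $Gr(\widehat{\mathbb{H}})\subseteq Gr(\widehat{\mathbb{G}})$. $q_{\mathsf{B}}\colon\mathsf{B}\to C(\sigma(\mathsf{B}))$ is the quotient of $\mathsf{B}$ by the closed ideal generated by commutators, and $\sigma(\mathsf{B})$ is the spectrum of that quotient, i.e. the set of characters of $\mathsf{B}$. The map $b$ exists because $q_{\mathsf{B}}\circ\beta$ has commutative target and hence factors through $q_{\mathbb{G}}$. *)

theory Defs
  imports
    "HOL-Analysis.Analysis"
    "HOL-Algebra.Module"
    "HOL-Algebra.QuotRing"
    "HOL-Algebra.Generated_Groups"
    "HOL-Algebra.Algebraic_Closure_Type"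
begin

section \<open>Unital $C^*$-algebras\<close>

record 'a cstar = "(complex, 'a) module" +
  adj :: "'a \<Rightarrow> 'a"
  nrm :: "'a \<Rightarrow> real"

text \<open>The distance is set to 0 off the carrier, because \<^locale>\<open>Metric_space\<close> wants a
  symmetric nonnegative function on the whole type.\<close>

definition cdist :: "('a, 'm) cstar_scheme \<Rightarrow> 'a \<Rightarrow> 'a \<Rightarrow> real" where
  "cdist A x y =
    (if x \<in> carrier A \<and> y \<in> carrier A then nrm A (x \<ominus>\<^bsub>A\<^esub> y) else 0)"

definition norm_topology :: "('a, 'm) cstar_scheme \<Rightarrow> 'a topology" where
  "norm_topology A = Metric_space.mtopology (carrier A) (cdist A)"

text \<open>The zero algebra is allowed, so that a spectrum may be empty.\<close>

locale cstar_algebra =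
  ring A + module "ring_of_type_algebra :: complex ring" A
  for A :: "('a, 'm) cstar_scheme" (structure) +
  assumes smult_mult_left:
      "\<lbrakk>x \<in> carrier A; y \<in> carrier A\<rbrakk> \<Longrightarrow> (c \<odot> x) \<otimes> y = c \<odot> (x \<otimes> y)"
    and smult_mult_right:
      "\<lbrakk>x \<in> carrier A; y \<in> carrier A\<rbrakk> \<Longrightarrow> x \<otimes> (c \<odot> y) = c \<odot> (x \<otimes> y)"
    and adj_closed: "x \<in> carrier A \<Longrightarrow> adj A x \<in> carrier A"
    and adj_adj: "x \<in> carrier A \<Longrightarrow> adj A (adj A x) = x"
    and adj_add:
      "\<lbrakk>x \<in> carrier A; y \<in> carrier A\<rbrakk> \<Longrightarrow> adj A (x \<oplus> y) = adj A x \<oplus> adj A y"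
    and adj_smult: "x \<in> carrier A \<Longrightarrow> adj A (c \<odot> x) = cnj c \<odot> adj A x"
    and adj_mult:
      "\<lbrakk>x \<in> carrier A; y \<in> carrier A\<rbrakk> \<Longrightarrow> adj A (x \<otimes> y) = adj A y \<otimes> adj A x"
    and nrm_nonneg: "x \<in> carrier A \<Longrightarrow> 0 \<le> nrm A x"
    and nrm_eq_zero: "x \<in> carrier A \<Longrightarrow> nrm A x = 0 \<longleftrightarrow> x = \<zero>"
    and nrm_triangle:
      "\<lbrakk>x \<in> carrier A; y \<in> carrier A\<rbrakk> \<Longrightarrow> nrm A (x \<oplus> y) \<le> nrm A x + nrm A y"
    and nrm_smult: "x \<in> carrier A \<Longrightarrow> nrm A (c \<odot> x) = cmod c * nrm A x"
    and nrm_mult: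
      "\<lbrakk>x \<in> carrier A; y \<in> carrier A\<rbrakk> \<Longrightarrow> nrm A (x \<otimes> y) \<le> nrm A x * nrm A y"
    and cstar_identity: "x \<in> carrier A \<Longrightarrow> nrm A (adj A x \<otimes> x) = (nrm A x)\<^sup>2"
    and complete: "Metric_space.mcomplete (carrier A) (cdist A)"

definition star_hom ::
    "('a, 'm) cstar_scheme \<Rightarrow> ('b, 'n) cstar_scheme \<Rightarrow> ('a \<Rightarrow> 'b) set" where
  "star_hom A B = {h \<in> ring_hom A B.
     (\<forall>c. \<forall>a\<in>carrier A. h (c \<odot>\<^bsub>A\<^esub> a) = c \<odot>\<^bsub>B\<^esub> h a) \<and>
     (\<forall>a\<in>carrier A. h (adj A a) = adj B (h a))}"

definition complex_cstar :: "complex cstar" where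
  "complex_cstar =
    \<lparr>carrier = UNIV, monoid.mult = (*), one = 1, zero = 0, add = (+),
     smult = (*), adj = cnj, nrm = cmod\<rparr>"

definition lin_span :: "('a, 'm) cstar_scheme \<Rightarrow> 'a set \<Rightarrow> 'a set" where
  "lin_span A S =
    \<Inter>{V. submodule V (ring_of_type_algebra :: complex ring) A \<and> S \<subseteq> V}"

definition states :: "('a, 'm) cstar_scheme \<Rightarrow> ('a \<Rightarrow> complex) set" where
  "states A = {\<phi>.
     (\<forall>a\<in>carrier A. \<forall>b\<in>carrier A. \<phi> (a \<oplus>\<^bsub>A\<^esub> b) = \<phi> a + \<phi> b) \<and>
     (\<forall>c. \<forall>a\<in>carrier A. \<phi> (c \<odot>\<^bsub>A\<^esub> a) = c * \<phi> a) \<and>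
     (\<forall>a\<in>carrier A. \<phi> (adj A a \<otimes>\<^bsub>A\<^esub> a) \<in> \<real>\<^sub>\<ge>\<^sub>0) \<and>
     (\<forall>a\<in>carrier A. cmod (\<phi> a) \<le> nrm A a) \<and>
     \<phi> \<one>\<^bsub>A\<^esub> = 1}"


section \<open>Hausdorff completion of a seminormed $*$-algebra\<close>

text \<open>Here \<open>P\<close> carries the operations of a $*$-algebra and a seminorm, but the algebra
  laws need only hold up to elements of seminorm 0; in particular, additive inverses are taken to be
  \<open>(-1) \<odot> x\<close>. An element of the completion is a class of Cauchy sequences modulo sequences
  converging to 0.\<close>

definition diff_nrm :: "('a, 'm) cstar_scheme \<Rightarrow> 'a \<Rightarrow> 'a \<Rightarrow> real" where
  "diff_nrm P x y = nrm P (x \<oplus>\<^bsub>P\<^esub> ((-1) \<odot>\<^bsub>P\<^esub> y))"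

definition cauchy_seqs :: "('a, 'm) cstar_scheme \<Rightarrow> (nat \<Rightarrow> 'a) set" where
  "cauchy_seqs P = {s. (\<forall>n. s n \<in> carrier P) \<and>
     (\<forall>e>0. \<exists>N. \<forall>m\<ge>N. \<forall>n\<ge>N. diff_nrm P (s m) (s n) < e)}"

definition seq_class :: "('a, 'm) cstar_scheme \<Rightarrow> (nat \<Rightarrow> 'a) \<Rightarrow> (nat \<Rightarrow> 'a) set" where
  "seq_class P s = {t \<in> cauchy_seqs P. (\<lambda>n. diff_nrm P (s n) (t n)) \<longlonglongrightarrow> 0}"

definition completion :: "('a, 'm) cstar_scheme \<Rightarrow> (nat \<Rightarrow> 'a) set cstar" where
  "completion P =
    \<lparr>carrier = seq_class P ` cauchy_seqs P,
     monoid.mult = (\<lambda>S T. \<Union>s\<in>S. \<Union>t\<in>T. seq_class P (\<lambda>n. s n \<otimes>\<^bsub>P\<^esub> t n)),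
     one = seq_class P (\<lambda>n. \<one>\<^bsub>P\<^esub>),
     zero = seq_class P (\<lambda>n. \<zero>\<^bsub>P\<^esub>),
     add = (\<lambda>S T. \<Union>s\<in>S. \<Union>t\<in>T. seq_class P (\<lambda>n. s n \<oplus>\<^bsub>P\<^esub> t n)),
     smult = (\<lambda>c S. \<Union>s\<in>S. seq_class P (\<lambda>n. c \<odot>\<^bsub>P\<^esub> s n)),
     adj = (\<lambda>S. \<Union>s\<in>S. seq_class P (\<lambda>n. adj P (s n))),
     nrm = (\<lambda>S. THE r. \<forall>s\<in>S. (\<lambda>n. nrm P (s n)) \<longlonglongrightarrow> r)\<rparr>"


section \<open>The minimal tensor product\<close>

text \<open>Elements of the algebraic tensor product are represented by formal sums: the list
  \<open>[(a\<^sub>1, b\<^sub>1), \<dots>, (a\<^sub>n, b\<^sub>n)]\<close> stands for \<open>a\<^sub>1 \<otimes> b\<^sub>1 + \<dots> + a\<^sub>n \<otimes> b\<^sub>n\<close>. Lists representing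
  the same tensor are identified only in the completion.\<close>

definition pairing :: "('a \<Rightarrow> complex) \<Rightarrow> ('b \<Rightarrow> complex) \<Rightarrow> ('a \<times> 'b) list \<Rightarrow> complex" where
  "pairing \<phi> \<psi> x = (\<Sum>(a, b)\<leftarrow>x. \<phi> a * \<psi> b)"

definition formal_mult ::
    "('a, 'm) cstar_scheme \<Rightarrow> ('b, 'n) cstar_scheme \<Rightarrow>
      ('a \<times> 'b) list \<Rightarrow> ('a \<times> 'b) list \<Rightarrow> ('a \<times> 'b) list" where
  "formal_mult A B x y = [(a \<otimes>\<^bsub>A\<^esub> a', b \<otimes>\<^bsub>B\<^esub> b'). (a, b) \<leftarrow> x, (a', b') \<leftarrow> y]"

definition formal_adj ::
    "('a, 'm) cstar_scheme \<Rightarrow> ('b, 'n) cstar_scheme \<Rightarrow>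
      ('a \<times> 'b) list \<Rightarrow> ('a \<times> 'b) list" where
  "formal_adj A B x = map (map_prod (adj A) (adj B)) x"

text \<open>The spatial norm: the norm of \<open>x\<close> in the direct sum, over all pairs of states
  \<open>\<phi>\<close>, \<open>\<psi>\<close>, of the representations \<open>\<pi>\<^sub>\<phi> \<otimes> \<pi>\<^sub>\<psi>\<close> built from the GNS representations. The vectors
  \<open>y \<cdot> (\<xi>\<^sub>\<phi> \<otimes> \<xi>\<^sub>\<psi>)\<close> with \<open>y\<close> in the algebraic tensor product are dense in the tensor product
  of the two GNS spaces, \<open>(\<phi> \<otimes> \<psi>)(y\<^sup>* y)\<close> is the squared length of such a vector, and
  \<open>(\<phi> \<otimes> \<psi>)(y\<^sup>* x\<^sup>* x y)\<close> is the squared length of its image under \<open>x\<close>.\<close>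

definition spatial_nrm ::
    "('a, 'm) cstar_scheme \<Rightarrow> ('b, 'n) cstar_scheme \<Rightarrow> ('a \<times> 'b) list \<Rightarrow> real" where
  "spatial_nrm A B x = Sup (insert 0
     {sqrt (Re (pairing \<phi> \<psi>
         (formal_mult A B (formal_adj A B (formal_mult A B x y)) (formal_mult A B x y)))) | \<phi> \<psi> y.
       \<phi> \<in> states A \<and> \<psi> \<in> states B \<and> y \<in> lists (carrier A \<times> carrier B) \<and>
       pairing \<phi> \<psi> (formal_mult A B (formal_adj A B y) y) = 1})"

definition formal_tensor ::
    "('a, 'm) cstar_scheme \<Rightarrow> ('b, 'n) cstar_scheme \<Rightarrow> ('a \<times> 'b) list cstar" where
  "formal_tensor A B =
    \<lparr>carrier = lists (carrier A \<times> carrier B),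
     monoid.mult = formal_mult A B,
     one = [(\<one>\<^bsub>A\<^esub>, \<one>\<^bsub>B\<^esub>)],
     zero = [],
     add = (@),
     smult = (\<lambda>c. map (\<lambda>(a, b). (c \<odot>\<^bsub>A\<^esub> a, b))),
     adj = formal_adj A B,
     nrm = spatial_nrm A B\<rparr>"

type_synonym ('a, 'b) tensor = "(nat \<Rightarrow> ('a \<times> 'b) list) set"

definition min_tensor ::
    "('a, 'm) cstar_scheme \<Rightarrow> ('b, 'n) cstar_scheme \<Rightarrow> ('a, 'b) tensor cstar" where
  "min_tensor A B = completion (formal_tensor A B)"

definition tensor_of ::
    "('a, 'm) cstar_scheme \<Rightarrow> ('b, 'n) cstar_scheme \<Rightarrow> ('a \<times> 'b) list \<Rightarrow> ('a, 'b) tensor" where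
  "tensor_of A B x = seq_class (formal_tensor A B) (\<lambda>n. x)"

text \<open>The map \<open>f \<otimes> g\<close> into the minimal tensor product of \<open>C\<close> and \<open>D\<close>, used for
  $*$-homomorphisms \<open>f\<close> and \<open>g\<close> between $C^*$-algebras, for which it is contractive.\<close>

definition tensor_map ::
    "('c, 'm) cstar_scheme \<Rightarrow> ('d, 'n) cstar_scheme \<Rightarrow> ('a \<Rightarrow> 'c) \<Rightarrow> ('b \<Rightarrow> 'd) \<Rightarrow>
      ('a, 'b) tensor \<Rightarrow> ('c, 'd) tensor" where
  "tensor_map C D f g S =
    (\<Union>s\<in>S. seq_class (formal_tensor C D) (\<lambda>n. map (map_prod f g) (s n)))"

text \<open>The extension to the minimal tensor product of \<open>\<phi> \<otimes> \<psi>\<close>, for bounded functionals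
  \<open>\<phi>\<close> and \<open>\<psi>\<close>.\<close>

definition tensor_functional ::
    "('a \<Rightarrow> complex) \<Rightarrow> ('b \<Rightarrow> complex) \<Rightarrow> ('a, 'b) tensor \<Rightarrow> complex" where
  "tensor_functional \<phi> \<psi> S = (THE c. \<forall>s\<in>S. (\<lambda>n. pairing \<phi> \<psi> (s n)) \<longlonglongrightarrow> c)"


section \<open>Compact quantum groups\<close>

record 'a cbialg = "'a cstar" +
  comult :: "'a \<Rightarrow> ('a, 'a) tensor"

text \<open>Woronowicz's axioms for the pair of \<open>A = C(\<bbbG>)\<close> and its coproduct. In \<open>coassoc\<close> the
  map \<open>\<alpha>\<close> is the canonical identification of \<open>(A \<otimes> A) \<otimes> A\<close> with \<open>A \<otimes> (A \<otimes> A)\<close>; it is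
  determined by its values on elementary tensors.\<close>

locale woronowicz_algebra = cstar_algebra A
  for A :: "('a, 'm) cbialg_scheme" (structure) +
  assumes comult_hom: "comult A \<in> star_hom A (min_tensor A A)"
    and coassoc:
      "\<exists>\<alpha> \<in> star_hom (min_tensor (min_tensor A A) A) (min_tensor A (min_tensor A A)).
         (\<forall>a\<in>carrier A. \<forall>b\<in>carrier A. \<forall>c\<in>carrier A.
            \<alpha> (tensor_of (min_tensor A A) A [(tensor_of A A [(a, b)], c)]) =
              tensor_of A (min_tensor A A) [(a, tensor_of A A [(b, c)])]) \<and>
         (\<forall>a\<in>carrier A.
            \<alpha> (tensor_map (min_tensor A A) A (comult A) (\<lambda>x. x) (comult A a)) =
              tensor_map A (min_tensor A A) (\<lambda>x. x) (comult A) (comult A a))"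
    and cancellation_left:
      "norm_topology (min_tensor A A) closure_of
         lin_span (min_tensor A A)
           {comult A a \<otimes>\<^bsub>min_tensor A A\<^esub> tensor_of A A [(b, \<one>)] | a b.
              a \<in> carrier A \<and> b \<in> carrier A}
       = carrier (min_tensor A A)"
    and cancellation_right:
      "norm_topology (min_tensor A A) closure_of
         lin_span (min_tensor A A)
           {comult A a \<otimes>\<^bsub>min_tensor A A\<^esub> tensor_of A A [(\<one>, b)] | a b.
              a \<in> carrier A \<and> b \<in> carrier A}
       = carrier (min_tensor A A)"

definition unitary_rep :: "('a, 'm) cbialg_scheme \<Rightarrow> nat \<Rightarrow> (nat \<Rightarrow> nat \<Rightarrow> 'a) \<Rightarrow> bool" where
  "unitary_rep A n u \<longleftrightarrow>
     (\<forall>i<n. \<forall>j<n. u i j \<in> carrier A \<and>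
        comult A (u i j) = tensor_of A A (map (\<lambda>k. (u i k, u k j)) [0..<n]) \<and>
        (\<Oplus>\<^bsub>A\<^esub>k\<in>{..<n}. adj A (u k i) \<otimes>\<^bsub>A\<^esub> u k j) = (if i = j then \<one>\<^bsub>A\<^esub> else \<zero>\<^bsub>A\<^esub>) \<and>
        (\<Oplus>\<^bsub>A\<^esub>k\<in>{..<n}. u i k \<otimes>\<^bsub>A\<^esub> adj A (u j k)) = (if i = j then \<one>\<^bsub>A\<^esub> else \<zero>\<^bsub>A\<^esub>))"

definition coeffs :: "('a, 'm) cbialg_scheme \<Rightarrow> 'a set" where
  "coeffs A = lin_span A {u i j | u i j n. unitary_rep A n u \<and> i < n \<and> j < n}"

text \<open>\<open>\<O>(\<bbbG>)\<close> as an algebra; its norm is the one inherited from \<open>A\<close>.\<close>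

definition pol :: "('a, 'm) cbialg_scheme \<Rightarrow> ('a, 'm) cbialg_scheme" where
  "pol A = A\<lparr>carrier := coeffs A\<rparr>"

definition list_sum :: "('a, 'm) ring_scheme \<Rightarrow> ('b \<Rightarrow> 'a) \<Rightarrow> 'b list \<Rightarrow> 'a" where
  "list_sum A f xs = foldr (\<lambda>x t. f x \<oplus>\<^bsub>A\<^esub> t) xs \<zero>\<^bsub>A\<^esub>"

text \<open>A compact quantum group is recorded together with the Hopf $*$-algebra \<open>\<O>(\<bbbG>)\<close>
  of its matrix coefficients. The counit and the antipode are uniquely determined by the underlying
  $C^*$-algebra and coproduct, and by Woronowicz's theorem they always exist; so carrying them
  as data adds no structure and excludes no compact quantum group. They are meaningful only
  on \<open>\<O>(\<bbbG>)\<close>. A Sweedler sum is taken over any formal sum over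
  \<open>\<O>(\<bbbG>)\<close> representing the coproduct of \<open>a\<close>.\<close>

record 'a cqg = "'a cbialg" +
  counit :: "'a \<Rightarrow> complex"
  antipode :: "'a \<Rightarrow> 'a"

locale compact_quantum_group = woronowicz_algebra G
  for G :: "('a, 'm) cqg_scheme" (structure) +
  assumes pol_one: "\<one> \<in> coeffs G"
    and pol_mult: "\<lbrakk>a \<in> coeffs G; b \<in> coeffs G\<rbrakk> \<Longrightarrow> a \<otimes> b \<in> coeffs G"
    and pol_adj: "a \<in> coeffs G \<Longrightarrow> adj G a \<in> coeffs G"
    and pol_comult:
      "a \<in> coeffs G \<Longrightarrow> \<exists>x \<in> lists (coeffs G \<times> coeffs G). comult G a = tensor_of G G x"
    and counit_hom: "counit G \<in> star_hom (pol G) complex_cstar"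
    and counit_left:
      "\<lbrakk>a \<in> coeffs G; x \<in> lists (coeffs G \<times> coeffs G); comult G a = tensor_of G G x\<rbrakk>
        \<Longrightarrow> list_sum G (\<lambda>(b, c). counit G b \<odot> c) x = a"
    and counit_right:
      "\<lbrakk>a \<in> coeffs G; x \<in> lists (coeffs G \<times> coeffs G); comult G a = tensor_of G G x\<rbrakk>
        \<Longrightarrow> list_sum G (\<lambda>(b, c). counit G c \<odot> b) x = a"
    and antipode_closed: "a \<in> coeffs G \<Longrightarrow> antipode G a \<in> coeffs G"
    and antipode_add:
      "\<lbrakk>a \<in> coeffs G; b \<in> coeffs G\<rbrakk>
        \<Longrightarrow> antipode G (a \<oplus> b) = antipode G a \<oplus> antipode G b"
    and antipode_smult: "a \<in> coeffs G \<Longrightarrow> antipode G (c \<odot> a) = c \<odot> antipode G a"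
    and antipode_left:
      "\<lbrakk>a \<in> coeffs G; x \<in> lists (coeffs G \<times> coeffs G); comult G a = tensor_of G G x\<rbrakk>
        \<Longrightarrow> list_sum G (\<lambda>(b, c). antipode G b \<otimes> c) x = counit G a \<odot> \<one>"
    and antipode_right:
      "\<lbrakk>a \<in> coeffs G; x \<in> lists (coeffs G \<times> coeffs G); comult G a = tensor_of G G x\<rbrakk>
        \<Longrightarrow> list_sum G (\<lambda>(b, c). b \<otimes> antipode G c) x = counit G a \<odot> \<one>"

definition cstar_seminorm :: "('a, 'm) cstar_scheme \<Rightarrow> ('a \<Rightarrow> real) \<Rightarrow> bool" where
  "cstar_seminorm P s \<longleftrightarrow>
     (\<forall>x\<in>carrier P. 0 \<le> s x) \<and>
     (\<forall>x\<in>carrier P. \<forall>y\<in>carrier P. s (x \<oplus>\<^bsub>P\<^esub> y) \<le> s x + s y) \<and>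
     (\<forall>c. \<forall>x\<in>carrier P. s (c \<odot>\<^bsub>P\<^esub> x) = cmod c * s x) \<and>
     (\<forall>x\<in>carrier P. \<forall>y\<in>carrier P. s (x \<otimes>\<^bsub>P\<^esub> y) \<le> s x * s y) \<and>
     (\<forall>x\<in>carrier P. s (adj P x \<otimes>\<^bsub>P\<^esub> x) = (s x)\<^sup>2)"

text \<open>\<open>universal_completion G U \<iota>\<close>: \<open>U\<close>, with its coproduct, is \<open>C\<^sup>u(\<bbbG>)\<close>, the completion of
  \<open>\<O>(\<bbbG>)\<close> in its largest $C^*$-seminorm, and \<open>\<iota>\<close> is the canonical map of \<open>\<O>(\<bbbG>)\<close>
  into it. The seminorm \<open>\<lambda>a. nrm U (\<iota> a)\<close> is itself a $C^*$-seminorm, so the bound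
  below says that it is the largest one.\<close>

definition universal_completion ::
    "('g, 'm) cbialg_scheme \<Rightarrow> ('a, 'n) cbialg_scheme \<Rightarrow> ('g \<Rightarrow> 'a) \<Rightarrow> bool" where
  "universal_completion G U \<iota> \<longleftrightarrow>
     cstar_algebra U \<and>
     \<iota> \<in> star_hom (pol G) U \<and>
     norm_topology U closure_of (\<iota> ` coeffs G) = carrier U \<and>
     (\<forall>s. cstar_seminorm (pol G) s \<longrightarrow> (\<forall>a\<in>coeffs G. s a \<le> nrm U (\<iota> a))) \<and>
     comult U \<in> star_hom U (min_tensor U U) \<and>
     (\<forall>a\<in>coeffs G. \<forall>x\<in>lists (coeffs G \<times> coeffs G). comult G a = tensor_of G G x \<longrightarrow>
        comult U (\<iota> a) = tensor_of U U (map (map_prod \<iota> \<iota>) x))"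

definition cqg_hom ::
    "('a, 'm) cbialg_scheme \<Rightarrow> ('b, 'n) cbialg_scheme \<Rightarrow> ('a \<Rightarrow> 'b) set" where
  "cqg_hom U V = {f \<in> star_hom U V.
     \<forall>a\<in>carrier U. comult V (f a) = tensor_map V V f f (comult U a)}"


section \<open>Hopf images\<close>

definition factorization ::
    "('a, 'm) cbialg_scheme \<Rightarrow> ('b, 'n) cstar_scheme \<Rightarrow> ('a \<Rightarrow> 'b) \<Rightarrow>
      ('l, 'r) cqg_scheme \<Rightarrow> ('c, 's) cbialg_scheme \<Rightarrow> ('l \<Rightarrow> 'c) \<Rightarrow>
      ('a \<Rightarrow> 'c) \<Rightarrow> ('c \<Rightarrow> 'b) \<Rightarrow> bool" where
  "factorization U B \<beta> L V \<iota> \<pi> \<beta>t \<longleftrightarrow>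
     compact_quantum_group L \<and> universal_completion L V \<iota> \<and>
     \<pi> \<in> cqg_hom U V \<and> \<pi> ` carrier U = carrier V \<and>
     \<beta>t \<in> star_hom V B \<and> (\<forall>a\<in>carrier U. \<beta>t (\<pi> a) = \<beta> a)"

text \<open>The competing triples are carried by the type \<open>'a\<close> of \<open>U\<close>. This is no restriction:
  \<open>C\<^sup>u(\<bbbL>)\<close> is an image of \<open>U\<close>, hence has an isomorphic copy carried by a subset of \<open>'a\<close>, and
  \<open>C\<^sup>u(\<bbbL>)\<close> with its coproduct is itself a Woronowicz algebra with the same \<open>\<O>(\<bbbL>)\<close>, so it
  can serve as \<open>C(\<bbbL>)\<close>.\<close>

definition hopf_image ::
    "'a cbialg \<Rightarrow> ('b, 'n) cstar_scheme \<Rightarrow> ('a \<Rightarrow> 'b) \<Rightarrow>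
      ('h, 'r) cqg_scheme \<Rightarrow> ('c, 's) cbialg_scheme \<Rightarrow> ('h \<Rightarrow> 'c) \<Rightarrow>
      ('a \<Rightarrow> 'c) \<Rightarrow> ('c \<Rightarrow> 'b) \<Rightarrow> bool" where
  "hopf_image U B \<beta> H W \<iota> \<pi> \<beta>t \<longleftrightarrow>
     factorization U B \<beta> H W \<iota> \<pi> \<beta>t \<and>
     (\<forall>(L :: 'a cqg) (V :: 'a cbialg) \<iota>' \<pi>' \<beta>t'. factorization U B \<beta> L V \<iota>' \<pi>' \<beta>t' \<longrightarrow>
        (\<exists>!r. r \<in> cqg_hom V W \<and> r \<in> extensional (carrier V) \<and>
           (\<forall>a\<in>carrier U. r (\<pi>' a) = \<pi> a) \<and>
           (\<forall>v\<in>carrier V. \<beta>t (r v) = \<beta>t' v)))"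


section \<open>Abelianization and Gelfand duality\<close>

definition commutator_ideal :: "('a, 'm) cstar_scheme \<Rightarrow> 'a set" where
  "commutator_ideal A = \<Inter>{I. ideal I A \<and> closedin (norm_topology A) I \<and>
     (\<forall>x\<in>carrier A. \<forall>y\<in>carrier A. (x \<otimes>\<^bsub>A\<^esub> y) \<ominus>\<^bsub>A\<^esub> (y \<otimes>\<^bsub>A\<^esub> x) \<in> I)}"

definition ab_class :: "('a, 'm) cstar_scheme \<Rightarrow> 'a \<Rightarrow> 'a set" where
  "ab_class A a = commutator_ideal A +>\<^bsub>A\<^esub> a"

definition abelianization :: "('a, 'm) cstar_scheme \<Rightarrow> 'a set cstar" where
  "abelianization A =
    ring.extend (A Quot commutator_ideal A)
      \<lparr>smult = (\<lambda>c S. \<Union>x\<in>S. ab_class A (c \<odot>\<^bsub>A\<^esub> x)),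
       adj = (\<lambda>S. \<Union>x\<in>S. ab_class A (adj A x)),
       nrm = (\<lambda>S. Inf (nrm A ` S))\<rparr>"

text \<open>Characters, extended by \<^const>\<open>undefined\<close> off the carrier, in the topology of
  pointwise convergence.\<close>

definition spectrum :: "('a, 'm) cstar_scheme \<Rightarrow> ('a \<Rightarrow> complex) topology" where
  "spectrum A =
     subtopology (product_topology (\<lambda>_. euclidean) (carrier A)) (star_hom A complex_cstar)"

text \<open>\<open>char_space A\<close> is \<open>\<sigma>(A)\<close>; for \<open>A = C\<^sup>u(\<bbbG>)\<close> it is the space underlying \<open>Gr\<close> of the
  dual of \<open>\<bbbG>\<close>.\<close>

definition char_space :: "('a, 'm) cstar_scheme \<Rightarrow> ('a set \<Rightarrow> complex) topology" where
  "char_space A = spectrum (abelianization A)"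

definition cont_algebra :: "'x topology \<Rightarrow> ('x \<Rightarrow> complex) cstar" where
  "cont_algebra S =
    \<lparr>carrier = {f \<in> extensional (topspace S). continuous_map S euclidean f},
     monoid.mult = (\<lambda>f g. \<lambda>x\<in>topspace S. f x * g x),
     one = (\<lambda>x\<in>topspace S. 1),
     zero = (\<lambda>x\<in>topspace S. 0),
     add = (\<lambda>f g. \<lambda>x\<in>topspace S. f x + g x),
     smult = (\<lambda>c f. \<lambda>x\<in>topspace S. c * f x),
     adj = (\<lambda>f. \<lambda>x\<in>topspace S. cnj (f x)),
     nrm = (\<lambda>f. Sup (insert 0 ((\<lambda>x. cmod (f x)) ` topspace S)))\<rparr>"

text \<open>The quotient map \<open>q\<^sub>A\<close> from \<open>A\<close> to \<open>C(\<sigma>(A))\<close>: the quotient by the commutator ideal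
  followed by the Gelfand transform.\<close>

definition ab_map :: "('a, 'm) cstar_scheme \<Rightarrow> 'a \<Rightarrow> ('a set \<Rightarrow> complex) \<Rightarrow> complex" where
  "ab_map A a = (\<lambda>\<omega>\<in>topspace (char_space A). \<omega> (ab_class A a))"

definition gelfand_dual ::
    "'x topology \<Rightarrow> 'y topology \<Rightarrow> (('x \<Rightarrow> complex) \<Rightarrow> ('y \<Rightarrow> complex)) \<Rightarrow> ('y \<Rightarrow> 'x) \<Rightarrow> bool"
  where
  "gelfand_dual S T h f \<longleftrightarrow> continuous_map T S f \<and>
     (\<forall>k\<in>carrier (cont_algebra S). \<forall>y\<in>topspace T. h k y = k (f y))"

text \<open>The group \<open>Gr\<close> of the dual of \<open>\<bbbG>\<close>, where \<open>U = C\<^sup>u(\<bbbG>)\<close>. The product is the one for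
  which \<open>q\<^sub>U\<close> intertwines the coproducts, \<open>(\<omega>\<^sub>1 \<omega>\<^sub>2) \<circ> q = (\<omega>\<^sub>1 \<circ> q \<otimes> \<omega>\<^sub>2 \<circ> q) \<circ> \<Delta>\<close>, and the
  neutral element is the character extending the counit of \<open>\<O>(\<bbbG>)\<close>.\<close>

definition char_group ::
    "('g, 'm) cqg_scheme \<Rightarrow> ('a, 'n) cbialg_scheme \<Rightarrow> ('g \<Rightarrow> 'a) \<Rightarrow> ('a set \<Rightarrow> complex) monoid"
  where
  "char_group G U \<iota> =
    \<lparr>carrier = topspace (char_space U),
     monoid.mult = (\<lambda>\<omega>\<^sub>1 \<omega>\<^sub>2. THE \<omega>. \<omega> \<in> topspace (char_space U) \<and>
       (\<forall>a\<in>carrier U. \<omega> (ab_class U a) =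
          tensor_functional (\<lambda>x. \<omega>\<^sub>1 (ab_class U x)) (\<lambda>x. \<omega>\<^sub>2 (ab_class U x)) (comult U a))),
     one = (THE \<omega>. \<omega> \<in> topspace (char_space U) \<and>
       (\<forall>a\<in>coeffs G. \<omega> (ab_class U (\<iota> a)) = counit G a))\<rparr>"

end

theory Submission
  imports Defs
begin

text \<open>Let \<open>P\<close> be the set of characters of \<open>C\<^sup>u(\<bbbG>)\<close> that vanish on the kernel of \<open>\<pi>\<close>. As \<open>\<pi>\<close>
  is surjective, \<open>P\<close> is closed and consists of the characters \<open>\<omega> \<circ> \<pi>\<close>, so it is \<open>Gr\<close> of the dual
  of \<open>\<bbbH>\<close>; as \<open>\<beta>\<close> factors through \<open>\<pi>\<close>, it contains the image of \<open>\<sigma>(B)\<close>. It is closed under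
  products because \<open>\<pi>\<close> intertwines the coproducts. Evaluating a character at the coefficients of a
  unitary representation gives a unitary matrix, and products of characters become products of
  matrices. Hence idempotent characters are neutral, so \<open>\<omega> \<mapsto> \<omega> \<circ> \<pi>\<close> preserves the neutral element
  and thereby inverses, and \<open>P\<close> is a closed subgroup.

  For the products to exist, product functionals must be continuous for the spatial norm, whose
  supremum must therefore be shown to be finite.\<close>

section \<open>Characters of $C^*$-algebras\<close>

text \<open>The set whose supremum is the spatial norm is bounded by a number that depends on x
  alone. Positivity of a product of two states comes from the Schur product theorem for their Gram
  matrices; the element x* x is then symmetric for the resulting form, and a crude norm on lists
  controls the growth of its powers. A second obstacle is that products, the neutral element and
  inverses in a group of characters are definite descriptions, so each needs existence and
  uniqueness. Uniqueness is tested on matrix coefficients, whose span has dense image in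
  \<open>U\<close>. Existence of the neutral element and of inverses amounts to extending the counit
  and composites with the antipode from \<open>pol G\<close> to \<open>U\<close>, which the
  maximality of the universal norm allows. The notion \<open>cqg_hom\<close> speaks of coproducts on
  the completions and says nothing of counits. The neutral element must therefore be recognised from
  products alone, which is where idempotents come in.\<close>

lemma ring_of_type_algebra_simps [simp]:
  "carrier (ring_of_type_algebra :: complex ring) = UNIV"
  "\<zero>\<^bsub>ring_of_type_algebra :: complex ring\<^esub> = 0"
  "\<one>\<^bsub>ring_of_type_algebra :: complex ring\<^esub> = 1"
  "x \<oplus>\<^bsub>ring_of_type_algebra\<^esub> y = (x + y :: complex)"
  "x \<otimes>\<^bsub>ring_of_type_algebra\<^esub> y = (x * y :: complex)"
  by (simp_all add: ring_of_type_algebra_def)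

lemma complex_cstar_simps [simp]:
  "carrier complex_cstar = UNIV"
  "\<zero>\<^bsub>complex_cstar\<^esub> = 0"
  "\<one>\<^bsub>complex_cstar\<^esub> = 1"
  "x \<oplus>\<^bsub>complex_cstar\<^esub> y = x + y"
  "x \<otimes>\<^bsub>complex_cstar\<^esub> y = x * y"
  "c \<odot>\<^bsub>complex_cstar\<^esub> x = c * x"
  "adj complex_cstar x = cnj x"
  by (simp_all add: complex_cstar_def)

lemma star_hom_complex_iff:
  "\<theta> \<in> star_hom A complex_cstar \<longleftrightarrow>
     (\<forall>a\<in>carrier A. \<forall>b\<in>carrier A. \<theta> (a \<oplus>\<^bsub>A\<^esub> b) = \<theta> a + \<theta> b) \<and>
     (\<forall>a\<in>carrier A. \<forall>b\<in>carrier A. \<theta> (a \<otimes>\<^bsub>A\<^esub> b) = \<theta> a * \<theta> b) \<and>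
     (\<forall>c. \<forall>a\<in>carrier A. \<theta> (c \<odot>\<^bsub>A\<^esub> a) = c * \<theta> a) \<and>
     (\<forall>a\<in>carrier A. \<theta> (adj A a) = cnj (\<theta> a)) \<and> \<theta> \<one>\<^bsub>A\<^esub> = 1"
  by (auto simp: star_hom_def ring_hom_def)

lemma star_homD:
  assumes "h \<in> star_hom A B"
  shows star_hom_closed: "a \<in> carrier A \<Longrightarrow> h a \<in> carrier B"
    and star_hom_add: "\<lbrakk>a \<in> carrier A; b \<in> carrier A\<rbrakk> \<Longrightarrow> h (a \<oplus>\<^bsub>A\<^esub> b) = h a \<oplus>\<^bsub>B\<^esub> h b"
    and star_hom_mult: "\<lbrakk>a \<in> carrier A; b \<in> carrier A\<rbrakk> \<Longrightarrow> h (a \<otimes>\<^bsub>A\<^esub> b) = h a \<otimes>\<^bsub>B\<^esub> h b"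
    and star_hom_one: "h \<one>\<^bsub>A\<^esub> = \<one>\<^bsub>B\<^esub>"
    and star_hom_smult: "a \<in> carrier A \<Longrightarrow> h (c \<odot>\<^bsub>A\<^esub> a) = c \<odot>\<^bsub>B\<^esub> h a"
    and star_hom_adj: "a \<in> carrier A \<Longrightarrow> h (adj A a) = adj B (h a)"
  using assms by (auto simp: star_hom_def ring_hom_def)

lemma star_hom_comp:
  assumes "f \<in> star_hom A B" "g \<in> star_hom B C"
  shows "(\<lambda>a. g (f a)) \<in> star_hom A C"
  using assms by (auto simp: star_hom_def ring_hom_def Pi_iff)

context cstar_algebra
begin

lemma is_ring: "ring A"
  by (rule cstar_algebra.axioms(1)[OF cstar_algebra_axioms])

lemma is_abelian_monoid: "abelian_monoid A"
  by (rule abelian_group.axioms(1)[OF ring.axioms(1)[OF is_ring]])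

lemma unit_closed: "\<one> \<in> carrier A"
  by (rule ring.ring_simprules(6)[OF is_ring])

lemma mult_add_left:
    "\<lbrakk>x \<in> carrier A; y \<in> carrier A; z \<in> carrier A\<rbrakk> \<Longrightarrow> (x \<oplus> y) \<otimes> z = x \<otimes> z \<oplus> y \<otimes> z"
  and mult_add_right:
    "\<lbrakk>x \<in> carrier A; y \<in> carrier A; z \<in> carrier A\<rbrakk> \<Longrightarrow> z \<otimes> (x \<oplus> y) = z \<otimes> x \<oplus> z \<otimes> y"
  and mult_assoc:
    "\<lbrakk>x \<in> carrier A; y \<in> carrier A; z \<in> carrier A\<rbrakk> \<Longrightarrow> (x \<otimes> y) \<otimes> z = x \<otimes> (y \<otimes> z)"
  using ring.ring_simprules[OF is_ring] by simp_all

lemma scale_closed [simp, intro]: "x \<in> carrier A \<Longrightarrow> c \<odot> x \<in> carrier A"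
  using smult_closed by simp

lemma scale_left_distrib: "x \<in> carrier A \<Longrightarrow> (c + d) \<odot> x = c \<odot> x \<oplus> d \<odot> x"
  using smult_l_distr[of c d x] by simp

lemma scale_right_distrib:
  "\<lbrakk>x \<in> carrier A; y \<in> carrier A\<rbrakk> \<Longrightarrow> c \<odot> (x \<oplus> y) = c \<odot> x \<oplus> c \<odot> y"
  using smult_r_distr[of c x y] by simp

lemma scale_scale: "x \<in> carrier A \<Longrightarrow> c \<odot> (d \<odot> x) = (c * d) \<odot> x"
  using smult_assoc1[of c d x] by simp

lemma scale_one [simp]: "x \<in> carrier A \<Longrightarrow> 1 \<odot> x = x"
  using smult_one by simp

lemma scale_zero_left [simp]: "x \<in> carrier A \<Longrightarrow> 0 \<odot> x = \<zero>"
  using smult_l_null[of x] by simp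

lemma scale_minus_one: "x \<in> carrier A \<Longrightarrow> (-1) \<odot> x = \<ominus> x"
proof -
  assume x: "x \<in> carrier A"
  have "x \<oplus> (-1) \<odot> x = (1 + (-1)) \<odot> x"
    using scale_left_distrib[OF x, of 1 "-1"] x by simp
  then have "x \<oplus> (-1) \<odot> x = \<zero>" using x by simp
  moreover have "y = (x \<oplus> y) \<oplus> \<ominus> x" if "y \<in> carrier A" for y using x that by algebra
  from this[OF scale_closed[OF x, of "-1"]] calculation show ?thesis using x by simp
qed

lemma diff_eq_scale: "\<lbrakk>x \<in> carrier A; y \<in> carrier A\<rbrakk> \<Longrightarrow> x \<ominus> y = x \<oplus> (-1) \<odot> y"
  by (simp add: scale_minus_one a_minus_def)

lemma nrm_minus: "x \<in> carrier A \<Longrightarrow> nrm A (\<ominus> x) = nrm A x"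
  using nrm_smult[of x "-1"] by (simp add: scale_minus_one)

lemma nrm_diff_commute:
  "\<lbrakk>x \<in> carrier A; y \<in> carrier A\<rbrakk> \<Longrightarrow> nrm A (x \<ominus> y) = nrm A (y \<ominus> x)"
proof -
  assume xy: "x \<in> carrier A" "y \<in> carrier A"
  then have "y \<ominus> x = \<ominus> (x \<ominus> y)" by algebra
  then show ?thesis using nrm_minus[of "x \<ominus> y"] xy by simp
qed

lemma diff_add_diff:
  "\<lbrakk>x \<in> carrier A; y \<in> carrier A; z \<in> carrier A\<rbrakk> \<Longrightarrow> (x \<ominus> y) \<oplus> (y \<ominus> z) = x \<ominus> z"
  by algebra

lemma add_diff_add:
  "\<lbrakk>x \<in> carrier A; y \<in> carrier A; s \<in> carrier A; t \<in> carrier A\<rbrakk>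
    \<Longrightarrow> (x \<oplus> y) \<ominus> (s \<oplus> t) = (x \<ominus> s) \<oplus> (y \<ominus> t)"
  by algebra

lemma mult_diff_mult:
  "\<lbrakk>x \<in> carrier A; y \<in> carrier A; s \<in> carrier A; t \<in> carrier A\<rbrakk>
    \<Longrightarrow> (x \<otimes> y) \<ominus> (s \<otimes> t) = x \<otimes> (y \<ominus> t) \<oplus> (x \<ominus> s) \<otimes> t"
  by algebra

lemma nrm_le_add_diff:
  assumes "x \<in> carrier A" "y \<in> carrier A" shows "nrm A y \<le> nrm A x + nrm A (x \<ominus> y)"
proof -
  have "y = x \<oplus> (y \<ominus> x)" using assms by algebra
  then show ?thesis using nrm_triangle[of x "y \<ominus> x"] nrm_diff_commute[OF assms] assms by simp
qed

lemma Metric_space: "Metric_space (carrier A) (cdist A)"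
proof
  fix x y z
  show "0 \<le> cdist A x y" by (simp add: cdist_def nrm_nonneg)
  show "cdist A x y = cdist A y x" by (simp add: cdist_def nrm_diff_commute)
  assume xy: "x \<in> carrier A" "y \<in> carrier A"
  show "cdist A x y = 0 \<longleftrightarrow> x = y" using xy by (simp add: cdist_def nrm_eq_zero)
  assume z: "z \<in> carrier A"
  show "cdist A x z \<le> cdist A x y + cdist A y z"
    using nrm_triangle[of "x \<ominus> y" "y \<ominus> z"] xy z by (simp add: cdist_def diff_add_diff)
qed

sublocale Metric_space "carrier A" "cdist A" by (rule Metric_space)

text \<open>The C*-identity and submultiplicativity give
  \<open>nrm A y \<le> nrm A (adj A y)\<close>; the reverse is the same bound at
  \<open>adj A y\<close>.\<close>

lemma nrm_adj: assumes x: "x \<in> carrier A" shows "nrm A (adj A x) = nrm A x"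
proof -
  have *: "nrm A y \<le> nrm A (adj A y)" if y: "y \<in> carrier A" for y
  proof (cases "nrm A y = 0")
    case True then show ?thesis using adj_closed[OF y] nrm_nonneg by simp
  next
    case False
    have "nrm A y * nrm A y \<le> nrm A (adj A y) * nrm A y"
      using cstar_identity[OF y] nrm_mult[OF adj_closed[OF y] y] by (simp add: power2_eq_square)
    then show ?thesis using False nrm_nonneg[OF y] by simp
  qed
  show ?thesis using *[OF x] *[OF adj_closed[OF x]] adj_adj[OF x] by simp
qed

lemma star_hom_zero: "\<theta> \<in> star_hom A complex_cstar \<Longrightarrow> \<theta> \<zero> = 0"
  using star_hom_smult[of \<theta> A complex_cstar \<zero> 0] by simp

lemma star_hom_diff:
  assumes "\<theta> \<in> star_hom A complex_cstar" "x \<in> carrier A" "y \<in> carrier A"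
  shows "\<theta> (x \<ominus> y) = \<theta> x - \<theta> y"
  using assms by (simp add: diff_eq_scale star_hom_add[OF assms(1)] star_hom_smult[OF assms(1)])

text \<open>If \<open>\<theta> x\<close> exceeded the norm of \<open>x\<close>, then after rescaling to \<open>\<theta> x = 1\<close> the contraction
  \<open>y \<mapsto> 1 + x y\<close> would have a fixed point, at which \<open>\<theta>\<close> takes no value.\<close>

lemma character_contractive:
  assumes \<theta>: "\<theta> \<in> star_hom A complex_cstar" and x: "x \<in> carrier A"
  shows "cmod (\<theta> x) \<le> nrm A x"
proof (rule ccontr)
  assume "\<not> ?thesis"
  then have lt: "nrm A x < cmod (\<theta> x)" by simp
  then have nz: "\<theta> x \<noteq> 0" using nrm_nonneg[OF x] by auto
  define z where "z = (1 / \<theta> x) \<odot> x"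
  have z: "z \<in> carrier A" using x by (simp add: z_def)
  have \<theta>z: "\<theta> z = 1" using nz by (simp add: z_def star_hom_smult[OF \<theta> x])
  have nz1: "nrm A z < 1" using nz lt by (simp add: z_def nrm_smult[OF x] norm_divide field_simps)
  obtain y where y: "y \<in> carrier A" "\<one> \<oplus> z \<otimes> y = y"
  proof (rule Banach_fixedpoint_thm[where k="nrm A z" and f="\<lambda>y. \<one> \<oplus> z \<otimes> y"])
    show "mcomplete" by (rule complete)
    show "carrier A \<noteq> {}" using one_closed by blast
    show "(\<lambda>y. \<one> \<oplus> z \<otimes> y) \<in> carrier A \<rightarrow> carrier A" using z by simp
    show "nrm A z < 1" by (rule nz1)
    fix u v assume uv: "u \<in> carrier A" "v \<in> carrier A"
    have "(\<one> \<oplus> z \<otimes> u) \<ominus> (\<one> \<oplus> z \<otimes> v) = z \<otimes> (u \<ominus> v)" using z uv by algebra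
    then show "cdist A (\<one> \<oplus> z \<otimes> u) (\<one> \<oplus> z \<otimes> v) \<le> nrm A z * cdist A u v"
      using nrm_mult[of z "u \<ominus> v"] z uv by (simp add: cdist_def)
  qed
  have "\<theta> y = \<theta> (\<one> \<oplus> z \<otimes> y)" using y by simp
  also have "\<dots> = 1 + \<theta> y"
    using y(1) z \<theta>z star_hom_one[OF \<theta>] by (simp add: star_hom_add[OF \<theta>] star_hom_mult[OF \<theta>])
  finally show False by simp
qed

lemma character_diff_le:
  assumes "\<theta> \<in> star_hom A complex_cstar" "x \<in> carrier A" "y \<in> carrier A"
  shows "cmod (\<theta> x - \<theta> y) \<le> cdist A x y"
  using character_contractive[OF assms(1), of "x \<ominus> y"] assms
  by (simp add: star_hom_diff cdist_def)

lemma character_in_states: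
  assumes \<theta>: "\<theta> \<in> star_hom A complex_cstar"
  shows "\<theta> \<in> states A"
proof -
  have "\<theta> (adj A a \<otimes> a) \<in> \<real>\<^sub>\<ge>\<^sub>0" if a: "a \<in> carrier A" for a
  proof -
    have "\<theta> (adj A a \<otimes> a) = of_real ((cmod (\<theta> a))\<^sup>2)"
      using star_hom_mult[OF \<theta> adj_closed[OF a] a] star_hom_adj[OF \<theta> a]
      by (simp add: complex_norm_square mult.commute del: of_real_power)
    then show ?thesis by simp
  qed
  then show ?thesis
    using \<theta> character_contractive[OF \<theta>] by (auto simp: states_def star_hom_complex_iff)
qed

lemma dense_approx:
  assumes "norm_topology A closure_of S = carrier A" "S \<subseteq> carrier A" "x \<in> carrier A" "e > 0"
  shows "\<exists>y\<in>S. cdist A x y < e"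
  using assms by (fastforce simp: norm_topology_def metric_closure_of)

text \<open>Contractivity makes characters continuous, so density of \<open>S\<close> suffices; the
  approximation error is taken below half of the supposed gap.\<close>

lemma character_eqI:
  assumes S: "norm_topology A closure_of S = carrier A" "S \<subseteq> carrier A"
    and \<theta>: "\<theta> \<in> star_hom A complex_cstar" "\<theta>' \<in> star_hom A complex_cstar"
    and eq: "\<And>y. y \<in> S \<Longrightarrow> \<theta> y = \<theta>' y" and x: "x \<in> carrier A"
  shows "\<theta> x = \<theta>' x"
proof (rule ccontr)
  assume "\<theta> x \<noteq> \<theta>' x"
  then have "cmod (\<theta> x - \<theta>' x) / 2 > 0" by simp
  from dense_approx[OF S x this] obtain y
    where y: "y \<in> S" "cdist A x y < cmod (\<theta> x - \<theta>' x) / 2" by blast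
  have yc: "y \<in> carrier A" using y S by blast
  have "cmod (\<theta> x - \<theta>' x) = cmod ((\<theta> x - \<theta> y) - (\<theta>' x - \<theta>' y))" using eq[OF y(1)] by simp
  also have "\<dots> \<le> cdist A x y + cdist A x y"
    by (rule order_trans[OF norm_triangle_ineq4 add_mono])
       (use character_diff_le[OF \<theta>(1) x yc] character_diff_le[OF \<theta>(2) x yc] in auto)
  finally show False using y(2) by simp
qed

end

section \<open>Positive semidefinite forms\<close>

text \<open>The expression is the expansion of F(x + c y, x + c y) for a sesquilinear form,
  conjugate-linear in the first variable, with p = F(x, x), r = F(x, y), s = F(y, x) and q = F(y,
  y). Reality at c = 1 and c = i gives hermitian symmetry; varying c over real multiples of the
  conjugate of r gives Cauchy-Schwarz.\<close>

lemma quadratic_nonneg_Reals: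
  fixes p q r s :: complex
  assumes q: "q \<in> \<real>\<^sub>\<ge>\<^sub>0" and nn: "\<And>c. p + c * r + cnj c * s + cnj c * c * q \<in> \<real>\<^sub>\<ge>\<^sub>0"
  shows "s = cnj r" and "(cmod r)\<^sup>2 \<le> Re p * Re q"
proof -
  have p: "Im p = 0" "0 \<le> Re p" using nn[of 0] by (auto simp: complex_nonneg_Reals_iff)
  have q: "Im q = 0" "0 \<le> Re q" using q by (auto simp: complex_nonneg_Reals_iff)
  show s: "s = cnj r"
    using nn[of 1] nn[of \<i>] p q by (auto simp: complex_nonneg_Reals_iff complex_eq_iff)
  have ge: "0 \<le> Re p + 2 * Re (c * r) + (cmod c)\<^sup>2 * Re q" for c
  proof -
    have "Re (p + c * r + cnj c * s + cnj c * c * q) = Re p + 2 * Re (c * r) + (cmod c)\<^sup>2 * Re q"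
      using q(1) unfolding s cmod_power2 by (simp add: algebra_simps power2_eq_square)
    then show ?thesis using nn[of c] by (auto simp: complex_nonneg_Reals_iff)
  qed
  have c: "Re (of_real t * cnj r * r) = t * (cmod r)\<^sup>2" "cmod (of_real t * cnj r) = \<bar>t\<bar> * cmod r" for t
    by (simp_all add: cmod_power2 norm_mult) (simp add: power2_eq_square algebra_simps)
  have t: "0 \<le> Re p + 2 * (t * (cmod r)\<^sup>2) + t\<^sup>2 * (cmod r)\<^sup>2 * Re q" for t
    using ge[of "of_real t * cnj r"] unfolding c by (simp add: power_mult_distrib)
  show "(cmod r)\<^sup>2 \<le> Re p * Re q"
  proof (cases "Re q = 0")
    case True
    have "r = 0"
    proof (rule ccontr)
      assume "r \<noteq> 0"
      then have r: "(cmod r)\<^sup>2 > 0" by simp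
      \<comment> \<open>With q = 0 the bound is affine in t with nonzero slope, so some t makes it
        negative; this one gives - Re p - 2.\<close>
      have "0 \<le> Re p + 2 * (- (Re p + 1) / (cmod r)\<^sup>2 * (cmod r)\<^sup>2)"
        using t[of "- (Re p + 1) / (cmod r)\<^sup>2"] True by simp
      also have "\<dots> = - Re p - 2" using r by simp
      finally show False using p by simp
    qed
    then show ?thesis using True by simp
  next
    case False
    then have qp: "Re q > 0" using q by simp
    \<comment> \<open>t = - 1 / Re q minimises the quadratic in t.\<close>
    have "0 \<le> Re p + 2 * (- (1 / Re q) * (cmod r)\<^sup>2) + (1 / Re q)\<^sup>2 * (cmod r)\<^sup>2 * Re q"
      using t[of "- (1 / Re q)"] by simp
    also have "\<dots> = Re p - (cmod r)\<^sup>2 / Re q" using qp by (simp add: field_simps power2_eq_square)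
    finally show ?thesis using qp by (simp add: field_simps)
  qed
qed

text \<open>The operations on \<open>V\<close> are constrained only through \<open>F\<close>. This
  lets formal sums serve as vectors with list append as addition, although append is neither
  commutative nor invertible.\<close>

locale psd_form =
  fixes V :: "'v set" and vadd :: "'v \<Rightarrow> 'v \<Rightarrow> 'v" and vscale :: "complex \<Rightarrow> 'v \<Rightarrow> 'v"
    and F :: "'v \<Rightarrow> 'v \<Rightarrow> complex"
  assumes add_closed: "\<lbrakk>x \<in> V; y \<in> V\<rbrakk> \<Longrightarrow> vadd x y \<in> V"
    and scale_closed: "x \<in> V \<Longrightarrow> vscale c x \<in> V"
    and add_left: "\<lbrakk>x \<in> V; y \<in> V; z \<in> V\<rbrakk> \<Longrightarrow> F (vadd x y) z = F x z + F y z"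
    and add_right: "\<lbrakk>x \<in> V; y \<in> V; z \<in> V\<rbrakk> \<Longrightarrow> F z (vadd x y) = F z x + F z y"
    and scale_left: "\<lbrakk>x \<in> V; z \<in> V\<rbrakk> \<Longrightarrow> F (vscale c x) z = cnj c * F x z"
    and scale_right: "\<lbrakk>x \<in> V; z \<in> V\<rbrakk> \<Longrightarrow> F z (vscale c x) = c * F z x"
    and nonneg: "x \<in> V \<Longrightarrow> F x x \<in> \<real>\<^sub>\<ge>\<^sub>0"
begin

lemma
  assumes x: "x \<in> V" and y: "y \<in> V"
  shows hermitian: "F y x = cnj (F x y)"
    and Cauchy_Schwarz: "(cmod (F x y))\<^sup>2 \<le> Re (F x x) * Re (F y y)"
proof -
  have "F x x + c * F x y + cnj c * F y x + cnj c * c * F y y \<in> \<real>\<^sub>\<ge>\<^sub>0" for c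
  proof -
    have "F (vadd x (vscale c y)) (vadd x (vscale c y)) =
        F x x + c * F x y + cnj c * F y x + cnj c * c * F y y"
      using x y by (simp add: add_left add_right scale_left scale_right add_closed scale_closed
          algebra_simps)
    then show ?thesis using nonneg[of "vadd x (vscale c y)"] x y
      by (simp add: add_closed scale_closed)
  qed
  from quadratic_nonneg_Reals[OF nonneg[OF y] this]
  show "F y x = cnj (F x y)" "(cmod (F x y))\<^sup>2 \<le> Re (F x x) * Re (F y y)" by auto
qed

lemma Re_nonneg: "x \<in> V \<Longrightarrow> 0 \<le> Re (F x x)"
  using nonneg by (simp add: complex_nonneg_Reals_iff)

lemma Minkowski:
  assumes x: "x \<in> V" and y: "y \<in> V"
  shows "sqrt (Re (F (vadd x y) (vadd x y))) \<le> sqrt (Re (F x x)) + sqrt (Re (F y y))"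
proof -
  let ?a = "sqrt (Re (F x x))" and ?b = "sqrt (Re (F y y))"
  have ab: "?a\<^sup>2 = Re (F x x)" "?b\<^sup>2 = Re (F y y)" "0 \<le> ?a" "0 \<le> ?b"
    using Re_nonneg x y by auto
  have "(cmod (F x y))\<^sup>2 \<le> (?a * ?b)\<^sup>2"
    using Cauchy_Schwarz[OF x y] ab by (simp add: power_mult_distrib)
  then have "cmod (F x y) \<le> ?a * ?b" using ab
    by (metis abs_le_square_iff abs_norm_cancel abs_of_nonneg mult_nonneg_nonneg)
  then have re: "Re (F x y) \<le> ?a * ?b" using complex_Re_le_cmod order_trans by blast
  have "Re (F (vadd x y) (vadd x y)) = Re (F x x) + 2 * Re (F x y) + Re (F y y)"
    using x y hermitian[OF x y] by (simp add: add_left add_right add_closed)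
  also have "\<dots> \<le> (?a + ?b)\<^sup>2" using re ab by (simp add: power2_sum)
  finally show ?thesis using ab real_le_lsqrt[of "?a + ?b"] by simp
qed

text \<open>Iterating Cauchy--Schwarz along \<open>T, T\<^sup>2, T\<^sup>4, \<dots>\<close> replaces the spectral radius formula.\<close>

lemma self_adjoint_bound:
  assumes T: "\<And>x. x \<in> V \<Longrightarrow> T x \<in> V"
    and adj: "\<And>x z. \<lbrakk>x \<in> V; z \<in> V\<rbrakk> \<Longrightarrow> F (T x) z = F x (T z)"
    and y: "y \<in> V" "F y y = 1"
    and bd: "\<And>m. cmod (F y ((T ^^ m) y)) \<le> C * K ^ m" and K: "0 \<le> K"
  shows "Re (F y (T y)) \<le> K"
proof -
  have pow: "(T ^^ m) x \<in> V" if "x \<in> V" for m x using that T by (induction m) auto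
  have shift: "F ((T ^^ m) x) z = F x ((T ^^ m) z)" if "x \<in> V" "z \<in> V" for m x z
    using that
  proof (induction m arbitrary: z)
    case (Suc m)
    then have "F ((T ^^ Suc m) x) z = F ((T ^^ m) x) (T z)" by (simp add: adj pow)
    also have "\<dots> = F x ((T ^^ Suc m) z)" using Suc T by (simp add: funpow_swap1)
    finally show ?case .
  qed simp
  define s where "s n = cmod (F y ((T ^^ (2 ^ n)) y))" for n
  \<comment> \<open>Cauchy-Schwarz for \<open>y\<close> against the iterate, with
    \<open>F y y = 1\<close>; self-adjointness then gathers both iterates on one side, which doubles
    the exponent.\<close>
  have step: "(s n)\<^sup>2 \<le> s (Suc n)" for n
  proof -
    have "(s n)\<^sup>2 \<le> Re (F y y) * Re (F ((T ^^ (2 ^ n)) y) ((T ^^ (2 ^ n)) y))"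
      unfolding s_def by (rule Cauchy_Schwarz) (use y pow in auto)
    also have "\<dots> = Re (F y ((T ^^ (2 ^ n + 2 ^ n)) y))"
      using shift[of y "(T ^^ (2 ^ n)) y" "2 ^ n"] y pow by (simp add: funpow_add)
    also have "\<dots> \<le> s (Suc n)"
      unfolding s_def by (simp add: complex_Re_le_cmod flip: mult_2)
    finally show ?thesis .
  qed
  have iter: "s 0 ^ (2 ^ n) \<le> s n" for n
  proof (induction n)
    case (Suc n)
    have "s 0 ^ (2 ^ Suc n) = (s 0 ^ (2 ^ n))\<^sup>2" by (simp flip: power_mult add: mult.commute)
    also have "\<dots> \<le> (s n)\<^sup>2" by (rule power_mono[OF Suc.IH]) (simp add: s_def)
    also have "\<dots> \<le> s (Suc n)" by (rule step)
    finally show ?case .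
  qed simp
  \<comment> \<open>Otherwise the ratio of \<open>s 0\<close> to \<open>K\<close> exceeds 1 while
    its powers with exponents 2 ^ n all stay below \<open>C\<close>. The constant \<open>C\<close>
    does no harm because it does not grow with the exponent; \<open>K = 0\<close> is settled by the
    exponent 1.\<close>
  have "s 0 \<le> K"
  proof (rule ccontr)
    assume "\<not> s 0 \<le> K"
    then have lt: "K < s 0" by simp
    have le: "s 0 ^ (2 ^ n) \<le> C * K ^ (2 ^ n)" for n
      using iter[of n] bd[of "2 ^ n"] by (simp add: s_def)
    show False
    proof (cases "K = 0")
      case True
      then have "s 0 \<le> 0" using le[of 0] by simp
      then show False using lt True by simp
    next
      case False
      then have Kp: "K > 0" using K by simp
      define r where "r = s 0 / K"
      have r: "r > 1" using lt Kp by (simp add: r_def)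
      have rle: "r ^ (2 ^ n) \<le> C" for n
        using le[of n] Kp by (simp add: r_def field_simps)
      obtain m where m: "C < r ^ m" using real_arch_pow[OF r] by blast
      have "r ^ m \<le> r ^ (2 ^ m)" by (rule power_increasing) (use r in auto)
      with m rle[of m] show False by simp
    qed
  qed
  then show ?thesis using complex_Re_le_cmod[of "F y (T y)"] by (simp add: s_def)
qed

end

definition psd_kernel :: "'i set \<Rightarrow> ('i \<Rightarrow> 'i \<Rightarrow> complex) \<Rightarrow> bool" where
  "psd_kernel S K \<longleftrightarrow> (\<forall>f. (\<Sum>i\<in>S. \<Sum>j\<in>S. cnj (f i) * f j * K i j) \<in> \<real>\<^sub>\<ge>\<^sub>0)"

text \<open>Presents a positive semidefinite matrix as a form on coordinate vectors, so that the
  results of \<open>psd_form\<close> apply to its entries.\<close>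

lemma psd_kernel_form:
  assumes "psd_kernel S K"
  shows "psd_form UNIV (\<lambda>f g i. f i + g i) (\<lambda>c f i. c * f i)
    (\<lambda>f g. \<Sum>i\<in>S. \<Sum>j\<in>S. cnj (f i) * g j * K i j)"
  using assms
  by unfold_locales
     (auto simp: psd_kernel_def sum.distrib sum_distrib_left algebra_simps)

text \<open>The entries of \<open>K\<close> are the values of its form at coordinate vectors, so
  hermitian symmetry and Cauchy-Schwarz transfer. The last claim is Cauchy-Schwarz against a vector
  of length 0.\<close>

lemma psd_kernel_entries:
  assumes K: "psd_kernel S K" and fin: "finite S" and i: "i \<in> S" and j: "j \<in> S"
  shows "K i i \<in> \<real>\<^sub>\<ge>\<^sub>0" and "K j i = cnj (K i j)" and "K i i = 0 \<Longrightarrow> K i j = 0"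
proof -
  interpret psd_form UNIV "\<lambda>f g i. f i + g i" "\<lambda>c f i. c * f i"
    "\<lambda>f g. \<Sum>i\<in>S. \<Sum>j\<in>S. cnj (f i) * g j * K i j"
    by (rule psd_kernel_form[OF K])
  let ?F = "\<lambda>f g. \<Sum>i\<in>S. \<Sum>j\<in>S. cnj (f i) * g j * K i j"
  let ?d = "\<lambda>k i. if i = k then 1 else 0 :: complex"
  have entry: "?F (?d k) (?d l) = K k l" if "k \<in> S" "l \<in> S" for k l
  proof -
    have "?F (?d k) (?d l) = (\<Sum>i\<in>S. if i = k then K i l else 0)"
      using that fin by (intro sum.cong refl)
      (simp add: if_distrib[of cnj] if_distrib[of "\<lambda>x. x * _"] cong: if_cong)
    then show ?thesis using that fin by simp
  qed
  show "K i i \<in> \<real>\<^sub>\<ge>\<^sub>0" using nonneg[of "?d i"] entry[OF i i] by simp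
  show "K j i = cnj (K i j)" using hermitian[of "?d i" "?d j"] entry i j by simp
  show "K i j = 0" if "K i i = 0"
    using Cauchy_Schwarz[of "?d i" "?d j"] entry i j that by simp
qed

lemma (in psd_form) linear_combination:
  assumes "V \<noteq> {}" and "finite S" and "\<And>i. i \<in> S \<Longrightarrow> a i \<in> V"
  shows "\<exists>x\<in>V. (\<forall>z\<in>V. F x z = (\<Sum>i\<in>S. cnj (f i) * F (a i) z)) \<and>
    (\<forall>z\<in>V. F z x = (\<Sum>i\<in>S. f i * F z (a i)))"
  using assms(2,3)
proof (induction S rule: finite_induct)
  case empty
  from \<open>V \<noteq> {}\<close> obtain x where "x \<in> V" by blast
  \<comment> \<open>\<open>psd_form\<close> names no zero vector; any vector scaled by 0 is one that
    \<open>F\<close> sees as zero.\<close>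
  then show ?case using scale_closed
    by (intro bexI[of _ "vscale 0 x"]) (auto simp: scale_left scale_right)
next
  case (insert k S)
  then obtain x where x: "x \<in> V" "\<forall>z\<in>V. F x z = (\<Sum>i\<in>S. cnj (f i) * F (a i) z)"
    "\<forall>z\<in>V. F z x = (\<Sum>i\<in>S. f i * F z (a i))" by auto
  have a: "a k \<in> V" using insert by simp
  show ?case
    by (rule bexI[of _ "vadd (vscale (f k) (a k)) x"])
       (use x a insert in \<open>auto simp: add_left add_right scale_left scale_right add_closed scale_closed\<close>)
qed

text \<open>A Gram matrix: its quadratic form at \<open>f\<close> is \<open>F x x\<close> for the
  combination \<open>x\<close> with coefficients \<open>f\<close>.\<close>

lemma (in psd_form) kernel:
  assumes "V \<noteq> {}" and "finite S" and a: "\<And>i. i \<in> S \<Longrightarrow> a i \<in> V"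
  shows "psd_kernel S (\<lambda>i j. F (a i) (a j))"
  unfolding psd_kernel_def
proof
  fix f
  obtain x where x: "x \<in> V" "\<And>z. z \<in> V \<Longrightarrow> F x z = (\<Sum>i\<in>S. cnj (f i) * F (a i) z)"
    "\<And>z. z \<in> V \<Longrightarrow> F z x = (\<Sum>i\<in>S. f i * F z (a i))"
    using linear_combination[of S a f, OF assms] by auto
  have "F x x = (\<Sum>i\<in>S. \<Sum>j\<in>S. cnj (f i) * f j * F (a i) (a j))"
    unfolding x(2)[OF x(1)] using a by (simp add: x(3) sum_distrib_left mult.assoc)
  then show "(\<Sum>i\<in>S. \<Sum>j\<in>S. cnj (f i) * f j * F (a i) (a j)) \<in> \<real>\<^sub>\<ge>\<^sub>0"
    using nonneg[OF x(1)] by simp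
qed

lemma sum_sum_insert:
  fixes R :: "'i \<Rightarrow> 'i \<Rightarrow> 'a :: comm_monoid_add"
  assumes "finite S" "k \<notin> S"
  shows "(\<Sum>i\<in>insert k S. \<Sum>j\<in>insert k S. R i j) =
    R k k + (\<Sum>j\<in>S. R k j) + (\<Sum>i\<in>S. R i k) + (\<Sum>i\<in>S. \<Sum>j\<in>S. R i j)"
  using assms by (simp add: sum.distrib ac_simps)

text \<open>By induction on \<open>S\<close>, replacing \<open>Q\<close> by the Schur complement of a diagonal entry.\<close>

lemma psd_kernel_Schur_product:
  assumes "finite S" "psd_kernel S P" "psd_kernel S Q"
  shows "(\<Sum>i\<in>S. \<Sum>j\<in>S. P i j * Q i j) \<in> \<real>\<^sub>\<ge>\<^sub>0"
  using assms
proof (induction S arbitrary: Q rule: finite_induct)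
  case (insert k S Q)
  note fin = insert.hyps(1) and k = insert.hyps(2)
  note P = insert.prems(1) and Q = insert.prems(2)
  \<comment> \<open>A principal submatrix is tested by extending vectors by 0 at
    \<open>k\<close>.\<close>
  have restrict: "psd_kernel S K" if K: "psd_kernel (insert k S) K" for K
    unfolding psd_kernel_def
  proof
    fix f :: "'a \<Rightarrow> complex"
    let ?g = "f(k := 0)"
    have g: "?g i = f i" if "i \<in> S" for i using that k by auto
    have "(\<Sum>i\<in>insert k S. \<Sum>j\<in>insert k S. cnj (?g i) * ?g j * K i j) \<in> \<real>\<^sub>\<ge>\<^sub>0"
      using K unfolding psd_kernel_def by (rule spec)
    also have "(\<Sum>i\<in>insert k S. \<Sum>j\<in>insert k S. cnj (?g i) * ?g j * K i j) =
        (\<Sum>i\<in>S. \<Sum>j\<in>S. cnj (f i) * f j * K i j)"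
      unfolding sum_sum_insert[OF fin k] using g by simp
    finally show "(\<Sum>i\<in>S. \<Sum>j\<in>S. cnj (f i) * f j * K i j) \<in> \<real>\<^sub>\<ge>\<^sub>0" .
  qed
  define q where "q = Q k k"
  have fin': "finite (insert k S)" using fin by simp
  have q: "q \<in> \<real>\<^sub>\<ge>\<^sub>0" using psd_kernel_entries(1)[OF Q fin', of k k] by (simp add: q_def)
  have qr: "cnj q = q" using q by (auto simp: complex_nonneg_Reals_iff complex_eq_iff)
  have herm: "Q i k = cnj (Q k i)" if "i \<in> S" for i
    using psd_kernel_entries(2)[OF Q fin', of k i] that by simp
  show ?case
  proof (cases "q = 0")
    case True
    \<comment> \<open>A vanishing diagonal entry kills its row and column, so only the sum over
      \<open>S\<close> survives.\<close>
    have z: "Q k i = 0" "Q i k = 0" if "i \<in> S" for i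
      using psd_kernel_entries(3)[OF Q fin', of k i] True that herm[OF that] by (auto simp: q_def)
    show ?thesis
      unfolding sum_sum_insert[OF fin k]
      using insert.IH[OF restrict[OF P] restrict[OF Q]] z True by (simp add: q_def)
  next
    case False
    define c where "c i = Q k i / q" for i
    have Qk: "Q k i = c i * q" "Q i k = cnj (c i) * q" if "i \<in> S" for i
      using False herm[OF that] qr by (auto simp: c_def)
    \<comment> \<open>The Schur complement of the pivot \<open>q\<close>: the rank-one part of
      \<open>Q\<close> determined by row \<open>k\<close> is subtracted.\<close>
    define Q' where "Q' i j = Q i j - cnj (c i) * c j * q" for i j
    have Q': "psd_kernel S Q'"
      unfolding psd_kernel_def
    proof
      fix f
      define w where "w = (\<Sum>i\<in>S. f i * c i)"
      have cw: "cnj w = (\<Sum>i\<in>S. cnj (f i) * cnj (c i))" by (simp add: w_def)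
      \<comment> \<open>For given \<open>f\<close>, the value \<open>- w\<close> at \<open>k\<close>
        minimises the form of \<open>Q\<close>, and the minimum is the form of \<open>Q'\<close> at
        \<open>f\<close>.\<close>
      let ?g = "f(k := - w)"
      have g: "?g i = f i" if "i \<in> S" for i using that k by auto
      have 1: "(\<Sum>j\<in>S. cnj (?g k) * ?g j * Q k j) = - cnj w * w * q"
      proof -
        have "(\<Sum>j\<in>S. cnj (?g k) * ?g j * Q k j) = (\<Sum>j\<in>S. (- cnj w * q) * (f j * c j))"
          using g Qk by (intro sum.cong) auto
        also have "\<dots> = (- cnj w * q) * w" by (simp only: sum_distrib_left[symmetric] w_def[symmetric])
        finally show ?thesis by (simp add: mult_ac)
      qed
      have 2: "(\<Sum>i\<in>S. cnj (?g i) * ?g k * Q i k) = - w * cnj w * q"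
      proof -
        have "(\<Sum>i\<in>S. cnj (?g i) * ?g k * Q i k) = (\<Sum>i\<in>S. (- w * q) * (cnj (f i) * cnj (c i)))"
          using g Qk by (intro sum.cong) auto
        also have "\<dots> = (- w * q) * cnj w" by (simp only: sum_distrib_left[symmetric] cw[symmetric])
        finally show ?thesis by (simp add: mult_ac)
      qed
      have 3: "(\<Sum>i\<in>S. \<Sum>j\<in>S. cnj (f i) * f j * (cnj (c i) * c j * q)) = cnj w * w * q"
        unfolding cw unfolding w_def sum_product by (simp add: sum_distrib_left sum_distrib_right mult_ac)
      have "(\<Sum>i\<in>insert k S. \<Sum>j\<in>insert k S. cnj (?g i) * ?g j * Q i j) \<in> \<real>\<^sub>\<ge>\<^sub>0"
        using Q unfolding psd_kernel_def by (rule spec)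
      also have "(\<Sum>i\<in>insert k S. \<Sum>j\<in>insert k S. cnj (?g i) * ?g j * Q i j) =
          cnj w * w * q + (- cnj w * w * q) + (- w * cnj w * q) +
            (\<Sum>i\<in>S. \<Sum>j\<in>S. cnj (f i) * f j * Q i j)"
        unfolding sum_sum_insert[OF fin k] 1 2 using g by (simp add: q_def)
      also have "\<dots> = (\<Sum>i\<in>S. \<Sum>j\<in>S. cnj (f i) * f j * Q' i j)"
        unfolding Q'_def right_diff_distrib sum_subtractf 3 by (simp add: mult_ac)
      finally show "(\<Sum>i\<in>S. \<Sum>j\<in>S. cnj (f i) * f j * Q' i j) \<in> \<real>\<^sub>\<ge>\<^sub>0" .
    qed
    \<comment> \<open>The subtracted rank-one part, multiplied entrywise by \<open>P\<close>, sums
      to \<open>q\<close> times the quadratic form of \<open>P\<close> at \<open>?d\<close>; the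
      entry 1 at \<open>k\<close> accounts for the pivot row and column.\<close>
    let ?d = "c(k := 1)"
    have d: "?d i = c i" if "i \<in> S" for i using that k by auto
    have "(\<Sum>i\<in>insert k S. \<Sum>j\<in>insert k S. P i j * Q i j) =
        (\<Sum>i\<in>S. \<Sum>j\<in>S. P i j * Q' i j) +
        q * (\<Sum>i\<in>insert k S. \<Sum>j\<in>insert k S. cnj (?d i) * ?d j * P i j)"
    proof -
      have "(\<Sum>i\<in>S. \<Sum>j\<in>S. P i j * Q i j) =
          (\<Sum>i\<in>S. \<Sum>j\<in>S. P i j * Q' i j) + q * (\<Sum>i\<in>S. \<Sum>j\<in>S. cnj (c i) * c j * P i j)"
        by (simp add: Q'_def sum_distrib_left sum.distrib[symmetric] algebra_simps)
      then show ?thesis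
        unfolding sum_sum_insert[OF fin k] using d Qk
        by (simp add: q_def sum_distrib_left algebra_simps)
    qed
    moreover have "(\<Sum>i\<in>S. \<Sum>j\<in>S. P i j * Q' i j) \<in> \<real>\<^sub>\<ge>\<^sub>0"
      by (rule insert.IH[OF restrict[OF P] Q'])
    moreover have "(\<Sum>i\<in>insert k S. \<Sum>j\<in>insert k S. cnj (?d i) * ?d j * P i j) \<in> \<real>\<^sub>\<ge>\<^sub>0"
      using P unfolding psd_kernel_def by (rule spec)
    ultimately show ?thesis using q by simp
  qed
qed simp

section \<open>The spatial norm\<close>

lemma sum_list_swap:
  fixes f :: "'a \<Rightarrow> 'b \<Rightarrow> 'c :: comm_monoid_add"
  shows "(\<Sum>x\<leftarrow>xs. \<Sum>y\<leftarrow>ys. f x y) = (\<Sum>y\<leftarrow>ys. \<Sum>x\<leftarrow>xs. f x y)"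
  by (induction xs) (simp_all add: sum_list_addf)

lemma pairing_Nil [simp]: "pairing \<phi> \<psi> [] = 0"
  and pairing_Cons [simp]: "pairing \<phi> \<psi> ((a, b) # x) = \<phi> a * \<psi> b + pairing \<phi> \<psi> x"
  and pairing_append [simp]: "pairing \<phi> \<psi> (x @ y) = pairing \<phi> \<psi> x + pairing \<phi> \<psi> y"
  by (simp_all add: pairing_def)

lemma pairing_map_map_prod:
  "pairing \<phi> \<psi> (map (map_prod f g) x) = pairing (\<lambda>a. \<phi> (f a)) (\<lambda>b. \<psi> (g b)) x"
  by (induction x) auto

lemma pairing_cong:
  assumes "x \<in> lists (S \<times> T)" "\<And>a. a \<in> S \<Longrightarrow> \<phi> a = \<phi>' a" "\<And>b. b \<in> T \<Longrightarrow> \<psi> b = \<psi>' b"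
  shows "pairing \<phi> \<psi> x = pairing \<phi>' \<psi>' x"
  using assms(1) by (induction x) (auto simp: assms(2,3))

lemma formal_mult_Nil [simp]: "formal_mult A B [] y = []"
  and formal_mult_Cons:
    "formal_mult A B ((a, b) # x) y =
      map (\<lambda>(a', b'). (a \<otimes>\<^bsub>A\<^esub> a', b \<otimes>\<^bsub>B\<^esub> b')) y @ formal_mult A B x y"
  and formal_mult_append: "formal_mult A B (x @ x') y = formal_mult A B x y @ formal_mult A B x' y"
  by (simp_all add: formal_mult_def)

lemma pairing_formal_mult:
  "pairing \<phi> \<psi> (formal_mult A B x y) =
    (\<Sum>(a, b)\<leftarrow>x. \<Sum>(a', b')\<leftarrow>y. \<phi> (a \<otimes>\<^bsub>A\<^esub> a') * \<psi> (b \<otimes>\<^bsub>B\<^esub> b'))"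
proof (induction x)
  case (Cons ab x)
  obtain a b where ab: "ab = (a, b)" by force
  have "pairing \<phi> \<psi> (map (\<lambda>(a', b'). (a \<otimes>\<^bsub>A\<^esub> a', b \<otimes>\<^bsub>B\<^esub> b')) y) =
      (\<Sum>(a', b')\<leftarrow>y. \<phi> (a \<otimes>\<^bsub>A\<^esub> a') * \<psi> (b \<otimes>\<^bsub>B\<^esub> b'))"
    by (induction y) auto
  then show ?case using Cons by (simp add: ab formal_mult_Cons)
qed simp

text \<open>Appending in the second factor only permutes the list of products, so distributivity on
  this side holds after pairing, not for the lists themselves.\<close>

lemma pairing_formal_mult_append_right:
  "pairing \<phi> \<psi> (formal_mult A B x (y @ z)) =
    pairing \<phi> \<psi> (formal_mult A B x y) + pairing \<phi> \<psi> (formal_mult A B x z)"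
  by (simp add: pairing_formal_mult sum_list_addf split_def)

lemma formal_adj_append [simp]: "formal_adj A B (x @ y) = formal_adj A B x @ formal_adj A B y"
  by (simp add: formal_adj_def)

lemma formal_tensor_simps [simp]:
  "carrier (formal_tensor A B) = lists (carrier A \<times> carrier B)"
  "x \<oplus>\<^bsub>formal_tensor A B\<^esub> y = x @ y"
  "x \<otimes>\<^bsub>formal_tensor A B\<^esub> y = formal_mult A B x y"
  "c \<odot>\<^bsub>formal_tensor A B\<^esub> x = map (\<lambda>(a, b). (c \<odot>\<^bsub>A\<^esub> a, b)) x"
  "\<one>\<^bsub>formal_tensor A B\<^esub> = [(\<one>\<^bsub>A\<^esub>, \<one>\<^bsub>B\<^esub>)]"
  "\<zero>\<^bsub>formal_tensor A B\<^esub> = []"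
  "adj (formal_tensor A B) = formal_adj A B"
  "nrm (formal_tensor A B) = spatial_nrm A B"
  by (simp_all add: formal_tensor_def)

text \<open>The sum over one representing list, without the infimum over lists that would give the
  projective norm. It is submultiplicative on lists, which is what controls powers.\<close>

definition cross_nrm ::
    "('a, 'm) cstar_scheme \<Rightarrow> ('b, 'n) cstar_scheme \<Rightarrow> ('a \<times> 'b) list \<Rightarrow> real" where
  "cross_nrm A B x = (\<Sum>(a, b)\<leftarrow>x. nrm A a * nrm B b)"

text \<open>The pre-inner product of the GNS construction.\<close>

lemma (in cstar_algebra) state_form:
  assumes "\<phi> \<in> states A"
  shows "psd_form (carrier A) (add A) (smult A) (\<lambda>x z. \<phi> (adj A x \<otimes> z))"
  using assms
  by unfold_locales
     (auto simp: states_def adj_closed adj_add adj_smult mult_add_left mult_add_right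
        smult_mult_left smult_mult_right)

lemma lists_Times_memD: "x \<in> lists (S \<times> T) \<Longrightarrow> (a, b) \<in> set x \<Longrightarrow> a \<in> S \<and> b \<in> T"
  by auto

locale cstar_pair = A: cstar_algebra A + B: cstar_algebra B
  for A :: "('a, 'm) cstar_scheme" and B :: "('b, 'n) cstar_scheme"
begin

abbreviation "fmult \<equiv> formal_mult A B"
abbreviation "fadj \<equiv> formal_adj A B"
abbreviation "formal \<equiv> lists (carrier A \<times> carrier B)"
abbreviation "fscale c x \<equiv> c \<odot>\<^bsub>formal_tensor A B\<^esub> x"

lemma fmult_closed: "\<lbrakk>x \<in> formal; y \<in> formal\<rbrakk> \<Longrightarrow> fmult x y \<in> formal"
proof -
  assume "x \<in> formal" "y \<in> formal"
  note mem = this[THEN lists_Times_memD]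
  show ?thesis by (auto simp: formal_mult_def dest!: mem)
qed

lemma fadj_closed: "x \<in> formal \<Longrightarrow> fadj x \<in> formal"
  by (induction x rule: lists.induct) (auto simp: formal_adj_def A.adj_closed B.adj_closed)

lemma fscale_closed: "x \<in> formal \<Longrightarrow> fscale c x \<in> formal"
  by (induction x rule: lists.induct) (auto)

text \<open>An equality of lists, not only of tensors: both sides run through the triples in
  lexicographic order.\<close>

lemma fmult_assoc:
  assumes "x \<in> formal" "y \<in> formal" "z \<in> formal"
  shows "fmult (fmult x y) z = fmult x (fmult y z)"
  using assms(1)
proof (induction x rule: lists.induct)
  case (Cons ab x)
  obtain a b where ab: "ab = (a, b)" "a \<in> carrier A" "b \<in> carrier B" using Cons by auto
  have "fmult (map (\<lambda>(a', b'). (a \<otimes>\<^bsub>A\<^esub> a', b \<otimes>\<^bsub>B\<^esub> b')) y) z =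
      map (\<lambda>(a', b'). (a \<otimes>\<^bsub>A\<^esub> a', b \<otimes>\<^bsub>B\<^esub> b')) (fmult y z)"
    using assms(2)
  proof (induction y rule: lists.induct)
    case (Cons cd y)
    obtain c d where cd: "cd = (c, d)" "c \<in> carrier A" "d \<in> carrier B" using Cons by auto
    show ?case using Cons.IH assms(3) ab cd
      by (auto simp: formal_mult_Cons A.mult_assoc B.mult_assoc dest!: lists_Times_memD[OF assms(3)])
  qed simp
  then show ?case using Cons ab by (simp add: formal_mult_Cons formal_mult_append)
qed simp

lemma cross_nrm_nonneg: "x \<in> formal \<Longrightarrow> 0 \<le> cross_nrm A B x"
  by (induction x rule: lists.induct) (auto simp: cross_nrm_def A.nrm_nonneg B.nrm_nonneg)

lemma cross_nrm_fmult:
  assumes "x \<in> formal" "y \<in> formal"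
  shows "cross_nrm A B (fmult x y) \<le> cross_nrm A B x * cross_nrm A B y"
  using assms(1)
proof (induction x rule: lists.induct)
  case (Cons ab x)
  obtain a b where ab: "ab = (a, b)" "a \<in> carrier A" "b \<in> carrier B" using Cons by auto
  have "cross_nrm A B (map (\<lambda>(a', b'). (a \<otimes>\<^bsub>A\<^esub> a', b \<otimes>\<^bsub>B\<^esub> b')) y) \<le>
      (nrm A a * nrm B b) * cross_nrm A B y"
    using assms(2)
  proof (induction y rule: lists.induct)
    case (Cons cd y)
    obtain c d where cd: "cd = (c, d)" "c \<in> carrier A" "d \<in> carrier B" using Cons by auto
    have "nrm A (a \<otimes>\<^bsub>A\<^esub> c) * nrm B (b \<otimes>\<^bsub>B\<^esub> d) \<le> (nrm A a * nrm A c) * (nrm B b * nrm B d)"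
      by (intro mult_mono A.nrm_mult B.nrm_mult mult_nonneg_nonneg A.nrm_nonneg B.nrm_nonneg)
         (use ab cd in auto)
    then show ?case using Cons.IH by (simp add: cross_nrm_def cd algebra_simps)
  qed (simp add: cross_nrm_def)
  then show ?case using Cons.IH by (simp add: ab formal_mult_Cons cross_nrm_def algebra_simps)
qed (simp add: cross_nrm_def)

lemma pairing_le_cross_nrm:
  assumes "\<phi> \<in> states A" "\<psi> \<in> states B" "x \<in> formal"
  shows "cmod (pairing \<phi> \<psi> x) \<le> cross_nrm A B x"
  using assms(3)
proof (induction x rule: lists.induct)
  case (Cons ab x)
  obtain a b where ab: "ab = (a, b)" "a \<in> carrier A" "b \<in> carrier B" using Cons by auto
  have "cmod (\<phi> a * \<psi> b) \<le> nrm A a * nrm B b"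
    unfolding norm_mult
    by (intro mult_mono) (use ab assms(1,2) A.nrm_nonneg in \<open>auto simp: states_def\<close>)
  then show ?case using Cons.IH norm_triangle_ineq[of "\<phi> a * \<psi> b" "pairing \<phi> \<psi> x"]
    by (simp add: ab cross_nrm_def)
qed (simp add: cross_nrm_def)

text \<open>The substance is positivity: for a sum of elementary tensors, the value is the sum of
  all entries of the entrywise product of two Gram matrices, one for each state, and the Schur
  product theorem applies.\<close>

lemma product_form:
  assumes \<phi>: "\<phi> \<in> states A" and \<psi>: "\<psi> \<in> states B"
  shows "psd_form formal (@) (smult (formal_tensor A B)) (\<lambda>x z. pairing \<phi> \<psi> (fmult (fadj x) z))"
proof -
  interpret P: psd_form "carrier A" "add A" "smult A" "\<lambda>x z. \<phi> (adj A x \<otimes>\<^bsub>A\<^esub> z)"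
    by (rule A.state_form[OF \<phi>])
  interpret Q: psd_form "carrier B" "add B" "smult B" "\<lambda>x z. \<psi> (adj B x \<otimes>\<^bsub>B\<^esub> z)"
    by (rule B.state_form[OF \<psi>])
  have \<phi>s: "\<phi> (c \<odot>\<^bsub>A\<^esub> a) = c * \<phi> a" if "a \<in> carrier A" for c a using \<phi> that by (auto simp: states_def)
  have expand: "pairing \<phi> \<psi> (fmult (fadj x) z) =
      (\<Sum>(a, b)\<leftarrow>x. \<Sum>(a', b')\<leftarrow>z. \<phi> (adj A a \<otimes>\<^bsub>A\<^esub> a') * \<psi> (adj B b \<otimes>\<^bsub>B\<^esub> b'))" for x z
    unfolding pairing_formal_mult formal_adj_def by (simp add: split_def comp_def)
  show ?thesis
  proof
    fix x y z :: "('a \<times> 'b) list" and c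
    assume x: "x \<in> formal"
    show "fscale c x \<in> formal" by (rule fscale_closed[OF x])
    show "pairing \<phi> \<psi> (fmult (fadj x) x) \<in> \<real>\<^sub>\<ge>\<^sub>0"
    proof -
      let ?S = "{0..<length x}"
      have mem: "fst (x ! i) \<in> carrier A" "snd (x ! i) \<in> carrier B" if "i \<in> ?S" for i
        using x that by (metis atLeastLessThan_iff in_listsD mem_Times_iff nth_mem)+
      have "pairing \<phi> \<psi> (fmult (fadj x) x) =
          (\<Sum>i\<in>?S. \<Sum>j\<in>?S. \<phi> (adj A (fst (x ! i)) \<otimes>\<^bsub>A\<^esub> fst (x ! j)) *
            \<psi> (adj B (snd (x ! i)) \<otimes>\<^bsub>B\<^esub> snd (x ! j)))"
        unfolding expand by (simp add: sum_list_sum_nth split_def)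
      also have "\<dots> \<in> \<real>\<^sub>\<ge>\<^sub>0"
        by (rule psd_kernel_Schur_product[OF _ P.kernel Q.kernel])
           (use mem A.one_closed B.one_closed in \<open>auto simp del: A.one_closed B.one_closed\<close>)
      finally show ?thesis .
    qed
    assume z: "z \<in> formal"
    show "pairing \<phi> \<psi> (fmult (fadj (fscale c x)) z) = cnj c * pairing \<phi> \<psi> (fmult (fadj x) z)"
    proof -
      have "pairing \<phi> \<psi> (fmult (fadj (fscale c x)) z) = (\<Sum>(a, b)\<leftarrow>x. \<Sum>(a', b')\<leftarrow>z.
          \<phi> (adj A (c \<odot>\<^bsub>A\<^esub> a) \<otimes>\<^bsub>A\<^esub> a') * \<psi> (adj B b \<otimes>\<^bsub>B\<^esub> b'))"
        unfolding expand by (simp add: split_def comp_def)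
      also have "\<dots> = (\<Sum>(a, b)\<leftarrow>x. \<Sum>(a', b')\<leftarrow>z.
          cnj c * (\<phi> (adj A a \<otimes>\<^bsub>A\<^esub> a') * \<psi> (adj B b \<otimes>\<^bsub>B\<^esub> b')))"
        by (intro arg_cong[of _ _ sum_list] map_cong refl)
          (auto simp: P.scale_left dest!: lists_Times_memD[OF x] lists_Times_memD[OF z]
            intro!: arg_cong[of _ _ sum_list])
      finally show ?thesis
        unfolding expand by (simp add: split_def sum_list_const_mult)
    qed
    show "pairing \<phi> \<psi> (fmult (fadj z) (fscale c x)) = c * pairing \<phi> \<psi> (fmult (fadj z) x)"
    proof -
      have "pairing \<phi> \<psi> (fmult (fadj z) (fscale c x)) = (\<Sum>(a, b)\<leftarrow>z. \<Sum>(a', b')\<leftarrow>x.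
          \<phi> (adj A a \<otimes>\<^bsub>A\<^esub> (c \<odot>\<^bsub>A\<^esub> a')) * \<psi> (adj B b \<otimes>\<^bsub>B\<^esub> b'))"
        unfolding expand by (simp add: split_def comp_def)
      also have "\<dots> = (\<Sum>(a, b)\<leftarrow>z. \<Sum>(a', b')\<leftarrow>x.
          c * (\<phi> (adj A a \<otimes>\<^bsub>A\<^esub> a') * \<psi> (adj B b \<otimes>\<^bsub>B\<^esub> b')))"
        by (intro arg_cong[of _ _ sum_list] map_cong refl)
          (auto simp: P.scale_right dest!: lists_Times_memD[OF x] lists_Times_memD[OF z]
            intro!: arg_cong[of _ _ sum_list])
      finally show ?thesis
        unfolding expand by (simp add: split_def sum_list_const_mult)
    qed
    assume "y \<in> formal"
    show "x @ y \<in> formal" using x \<open>y \<in> formal\<close> by simp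
    show "pairing \<phi> \<psi> (fmult (fadj (x @ y)) z) =
        pairing \<phi> \<psi> (fmult (fadj x) z) + pairing \<phi> \<psi> (fmult (fadj y) z)"
      by (simp add: formal_mult_append)
    show "pairing \<phi> \<psi> (fmult (fadj z) (x @ y)) =
        pairing \<phi> \<psi> (fmult (fadj z) x) + pairing \<phi> \<psi> (fmult (fadj z) y)"
      by (rule pairing_formal_mult_append_right)
  qed
qed

text \<open>Adjoints reverse the products inside each leg, but the two lists come out in different
  orders. The identity is therefore stated after pairing, where the sums over \<open>x\<close> and
  \<open>y\<close> can be exchanged.\<close>

lemma product_form_adjoint:
  assumes x: "x \<in> formal" and y: "y \<in> formal" and z: "z \<in> formal"
  shows "pairing \<phi> \<psi> (fmult (fadj (fmult x y)) z) = pairing \<phi> \<psi> (fmult (fadj y) (fmult (fadj x) z))"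
proof -
  have "pairing \<phi> \<psi> (fmult (fadj (fmult x y)) z) =
      (\<Sum>(a, b)\<leftarrow>x. \<Sum>(a', b')\<leftarrow>y. \<Sum>(a'', b'')\<leftarrow>z.
        \<phi> (adj A (a \<otimes>\<^bsub>A\<^esub> a') \<otimes>\<^bsub>A\<^esub> a'') * \<psi> (adj B (b \<otimes>\<^bsub>B\<^esub> b') \<otimes>\<^bsub>B\<^esub> b''))"
  proof (induction x)
    case (Cons ab x)
    have "pairing \<phi> \<psi> (fmult (fadj (map (\<lambda>(a', b'). (a \<otimes>\<^bsub>A\<^esub> a', b \<otimes>\<^bsub>B\<^esub> b')) y)) z) =
      (\<Sum>(a', b')\<leftarrow>y. \<Sum>(a'', b'')\<leftarrow>z.
        \<phi> (adj A (a \<otimes>\<^bsub>A\<^esub> a') \<otimes>\<^bsub>A\<^esub> a'') * \<psi> (adj B (b \<otimes>\<^bsub>B\<^esub> b') \<otimes>\<^bsub>B\<^esub> b''))" for a b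
      unfolding pairing_formal_mult formal_adj_def by (simp add: split_def comp_def)
    then show ?case using Cons by (cases ab) (simp add: formal_mult_Cons formal_mult_append)
  qed (simp add: formal_adj_def)
  also have "\<dots> = (\<Sum>(a, b)\<leftarrow>x. \<Sum>(a', b')\<leftarrow>y. \<Sum>(a'', b'')\<leftarrow>z.
        \<phi> (adj A a' \<otimes>\<^bsub>A\<^esub> (adj A a \<otimes>\<^bsub>A\<^esub> a'')) * \<psi> (adj B b' \<otimes>\<^bsub>B\<^esub> (adj B b \<otimes>\<^bsub>B\<^esub> b'')))"
    by (intro arg_cong[of _ _ sum_list] map_cong refl)
       (auto intro!: arg_cong[of _ _ sum_list]
        dest!: lists_Times_memD[OF x] lists_Times_memD[OF y] lists_Times_memD[OF z]
        simp: A.adj_mult B.adj_mult A.mult_assoc B.mult_assoc A.adj_closed B.adj_closed)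
  also have "\<dots> = (\<Sum>(a', b')\<leftarrow>y. \<Sum>(a, b)\<leftarrow>x. \<Sum>(a'', b'')\<leftarrow>z.
        \<phi> (adj A a' \<otimes>\<^bsub>A\<^esub> (adj A a \<otimes>\<^bsub>A\<^esub> a'')) * \<psi> (adj B b' \<otimes>\<^bsub>B\<^esub> (adj B b \<otimes>\<^bsub>B\<^esub> b'')))"
    unfolding split_def by (rule sum_list_swap)
  also have "\<dots> = pairing \<phi> \<psi> (fmult (fadj y) (fmult (fadj x) z))"
  proof -
    have inner: "(\<Sum>(a, b)\<leftarrow>x. \<Sum>(a'', b'')\<leftarrow>z.
        \<phi> (c \<otimes>\<^bsub>A\<^esub> (adj A a \<otimes>\<^bsub>A\<^esub> a'')) * \<psi> (d \<otimes>\<^bsub>B\<^esub> (adj B b \<otimes>\<^bsub>B\<^esub> b''))) =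
        (\<Sum>(a'', b'')\<leftarrow>fmult (fadj x) z. \<phi> (c \<otimes>\<^bsub>A\<^esub> a'') * \<psi> (d \<otimes>\<^bsub>B\<^esub> b''))" for c d
      by (induction x) (auto simp: formal_adj_def formal_mult_Cons split_def comp_def)
    show ?thesis unfolding inner pairing_formal_mult[of _ _ _ _ "fadj y"]
      by (simp add: formal_adj_def[of A B y] split_def comp_def)
  qed
  finally show ?thesis .
qed

end

section \<open>Finiteness of the spatial norm, and its pseudometric on formal sums\<close>

context cstar_pair
begin

lemma fadj_fadj: "x \<in> formal \<Longrightarrow> fadj (fadj x) = x"
  by (induction x rule: lists.induct) (auto simp: formal_adj_def A.adj_adj B.adj_adj)

lemma fmult_fscale:
  assumes "x \<in> formal" "y \<in> formal"
  shows "fmult (fscale c x) y = fscale c (fmult x y)"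
  using assms(1)
proof (induction x rule: lists.induct)
  case (Cons ab x)
  then show ?case
    by (auto simp: formal_mult_Cons A.smult_mult_left dest!: lists_Times_memD[OF assms(2)])
qed simp

text \<open>The length of the image under \<open>x\<close> of one vector of the GNS tensor product.
  It is kept apart from the supremum so that the seminorm laws can be proved one vector at a
  time.\<close>

definition spatial_seminorm ::
    "('a \<Rightarrow> complex) \<Rightarrow> ('b \<Rightarrow> complex) \<Rightarrow> ('a \<times> 'b) list \<Rightarrow> ('a \<times> 'b) list \<Rightarrow> real" where
  "spatial_seminorm \<phi> \<psi> y x = sqrt (Re (pairing \<phi> \<psi> (fmult (fadj (fmult x y)) (fmult x y))))"

definition unit_vectors ::
    "(('a \<Rightarrow> complex) \<times> ('b \<Rightarrow> complex) \<times> ('a \<times> 'b) list) set" where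
  "unit_vectors = {(\<phi>, \<psi>, y). \<phi> \<in> states A \<and> \<psi> \<in> states B \<and> y \<in> formal \<and>
     pairing \<phi> \<psi> (fmult (fadj y) y) = 1}"

lemma spatial_nrm_eq:
  "spatial_nrm A B x = Sup (insert 0 ((\<lambda>(\<phi>, \<psi>, y). spatial_seminorm \<phi> \<psi> y x) ` unit_vectors))"
  unfolding spatial_nrm_def spatial_seminorm_def unit_vectors_def
  by (rule arg_cong[of _ _ "\<lambda>S. Sup (insert 0 S)"]) (auto simp: image_def)

text \<open>The squared seminorm is the value at the unit vector \<open>y\<close> of h = x* x, which
  is symmetric for the product form. As states are contractive, the moments of h grow at most like a
  constant times powers of \<open>cross_nrm A B h\<close>, and \<open>self_adjoint_bound\<close>
  removes the constant. The resulting bound depends on \<open>x\<close> alone.\<close>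

lemma spatial_seminorm_le:
  assumes v: "(\<phi>, \<psi>, y) \<in> unit_vectors" and x: "x \<in> formal"
  shows "spatial_seminorm \<phi> \<psi> y x \<le> sqrt (cross_nrm A B (fmult (fadj x) x))"
proof -
  have \<phi>: "\<phi> \<in> states A" and \<psi>: "\<psi> \<in> states B" and y: "y \<in> formal"
    and one: "pairing \<phi> \<psi> (fmult (fadj y) y) = 1"
    using v by (auto simp: unit_vectors_def)
  interpret F: psd_form formal "(@)" "smult (formal_tensor A B)"
    "\<lambda>x z. pairing \<phi> \<psi> (fmult (fadj x) z)" by (rule product_form[OF \<phi> \<psi>])
  define h where "h = fmult (fadj x) x"
  have h: "h \<in> formal" using x by (simp add: h_def fmult_closed fadj_closed)
  have hu: "fmult h u = fmult (fadj x) (fmult x u)" if "u \<in> formal" for u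
    using that x by (simp add: h_def fmult_assoc fadj_closed)
  have pow: "(fmult h ^^ m) y \<in> formal" for m
    by (induction m) (simp_all add: y fmult_closed[OF h])
  have cross_pow: "cross_nrm A B ((fmult h ^^ m) y) \<le> cross_nrm A B h ^ m * cross_nrm A B y" for m
  proof (induction m)
    case (Suc m)
    have "cross_nrm A B ((fmult h ^^ Suc m) y) \<le> cross_nrm A B h * cross_nrm A B ((fmult h ^^ m) y)"
      using cross_nrm_fmult[OF h pow] by simp
    also have "\<dots> \<le> cross_nrm A B h * (cross_nrm A B h ^ m * cross_nrm A B y)"
      by (rule mult_left_mono[OF Suc cross_nrm_nonneg[OF h]])
    finally show ?case by (simp add: mult.assoc)
  qed simp
  have "Re (pairing \<phi> \<psi> (fmult (fadj y) (fmult h y))) \<le> cross_nrm A B h"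
  proof (rule F.self_adjoint_bound)
    show "fmult h u \<in> formal" if "u \<in> formal" for u by (rule fmult_closed[OF h that])
    show "pairing \<phi> \<psi> (fmult (fadj (fmult h u)) z) = pairing \<phi> \<psi> (fmult (fadj u) (fmult h z))"
      if u: "u \<in> formal" and z: "z \<in> formal" for u z
      unfolding hu[OF u] hu[OF z]
      using x u z by (simp add: product_form_adjoint fadj_closed fmult_closed fadj_fadj)
    show "cmod (pairing \<phi> \<psi> (fmult (fadj y) ((fmult h ^^ m) y)))
        \<le> (cross_nrm A B (fadj y) * cross_nrm A B y) * cross_nrm A B h ^ m" for m
    proof -
      have "cmod (pairing \<phi> \<psi> (fmult (fadj y) ((fmult h ^^ m) y)))
          \<le> cross_nrm A B (fmult (fadj y) ((fmult h ^^ m) y))"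
        by (rule pairing_le_cross_nrm[OF \<phi> \<psi>]) (simp add: fmult_closed fadj_closed y pow)
      also have "\<dots> \<le> cross_nrm A B (fadj y) * cross_nrm A B ((fmult h ^^ m) y)"
        by (rule cross_nrm_fmult) (simp_all add: fadj_closed y pow)
      also have "\<dots> \<le> cross_nrm A B (fadj y) * (cross_nrm A B h ^ m * cross_nrm A B y)"
        by (rule mult_left_mono[OF cross_pow cross_nrm_nonneg]) (simp add: fadj_closed y)
      finally show ?thesis by (simp add: mult_ac)
    qed
  qed (use y one h cross_nrm_nonneg in auto)
  moreover have "pairing \<phi> \<psi> (fmult (fadj (fmult x y)) (fmult x y)) =
      pairing \<phi> \<psi> (fmult (fadj y) (fmult h y))"
    using x y by (simp add: product_form_adjoint hu fmult_closed)
  ultimately show ?thesis by (simp add: spatial_seminorm_def h_def)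
qed

lemma spatial_bdd_above:
  assumes "x \<in> formal"
  shows "bdd_above (insert 0 ((\<lambda>(\<phi>, \<psi>, y). spatial_seminorm \<phi> \<psi> y x) ` unit_vectors))"
  using spatial_seminorm_le[OF _ assms] unfolding bdd_above_insert
  by (intro bdd_aboveI[of _ "sqrt (cross_nrm A B (fmult (fadj x) x))"]) auto

lemma spatial_seminorm_le_nrm:
  assumes "(\<phi>, \<psi>, y) \<in> unit_vectors" "x \<in> formal"
  shows "spatial_seminorm \<phi> \<psi> y x \<le> spatial_nrm A B x"
  unfolding spatial_nrm_eq by (rule cSup_upper[OF _ spatial_bdd_above]) (use assms in force)+

lemma spatial_nrm_nonneg: "x \<in> formal \<Longrightarrow> 0 \<le> spatial_nrm A B x"
  unfolding spatial_nrm_eq by (rule cSup_upper[OF _ spatial_bdd_above]) auto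

lemma spatial_nrm_leI:
  assumes "0 \<le> c" "\<And>\<phi> \<psi> y. (\<phi>, \<psi>, y) \<in> unit_vectors \<Longrightarrow> spatial_seminorm \<phi> \<psi> y x \<le> c"
  shows "spatial_nrm A B x \<le> c"
  unfolding spatial_nrm_eq by (rule cSup_least) (use assms in auto)

text \<open>The product form pulled back along right multiplication by \<open>y\<close>. Each
  spatial seminorm thus comes from a \<open>psd_form\<close> and obeys the Minkowski
  inequality.\<close>

lemma spatial_form:
  assumes v: "(\<phi>, \<psi>, y) \<in> unit_vectors"
  shows "psd_form formal (@) (smult (formal_tensor A B))
    (\<lambda>x z. pairing \<phi> \<psi> (fmult (fadj (fmult x y)) (fmult z y)))"
proof -
  have \<phi>: "\<phi> \<in> states A" and \<psi>: "\<psi> \<in> states B" and y: "y \<in> formal"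
    using v by (auto simp: unit_vectors_def)
  interpret F: psd_form formal "(@)" "smult (formal_tensor A B)"
    "\<lambda>x z. pairing \<phi> \<psi> (fmult (fadj x) z)" by (rule product_form[OF \<phi> \<psi>])
  note F = F.add_left F.add_right F.scale_left F.scale_right
  show ?thesis
    using F.add_closed F.scale_closed F.nonneg
    by unfold_locales
      (simp_all add: fmult_fscale formal_mult_append F fmult_closed y
        del: formal_tensor_simps pairing_append append_in_lists_conv
        formal_adj_append)
qed

abbreviation "fdiff x z \<equiv> x @ fscale (-1) z"

lemma fdiff_closed: "\<lbrakk>x \<in> formal; z \<in> formal\<rbrakk> \<Longrightarrow> fdiff x z \<in> formal"
  using fscale_closed[of z "-1"] by simp

lemma diff_nrm_formal: "diff_nrm (formal_tensor A B) x z = spatial_nrm A B (fdiff x z)"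
  by (simp add: diff_nrm_def)

text \<open>A formal difference such as \<open>fdiff x x\<close> is in general a nonempty list, so
  the laws of a pseudometric come from expanding the form rather than from cancelling in
  lists.\<close>

lemma
  assumes v: "(\<phi>, \<psi>, y) \<in> unit_vectors" and x: "x \<in> formal" and z: "z \<in> formal"
  shows spatial_seminorm_self: "spatial_seminorm \<phi> \<psi> y (fdiff x x) = 0"
    and spatial_seminorm_commute:
      "spatial_seminorm \<phi> \<psi> y (fdiff x z) = spatial_seminorm \<phi> \<psi> y (fdiff z x)"
    and spatial_seminorm_triangle: "w \<in> formal \<Longrightarrow> spatial_seminorm \<phi> \<psi> y (fdiff x z)
      \<le> spatial_seminorm \<phi> \<psi> y (fdiff x w) + spatial_seminorm \<phi> \<psi> y (fdiff w z)"
proof -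
  let ?F = "\<lambda>x z. pairing \<phi> \<psi> (fmult (fadj (fmult x y)) (fmult z y))"
  interpret F: psd_form formal "(@)" "smult (formal_tensor A B)" ?F by (rule spatial_form[OF v])
  note expand = F.add_left F.add_right F.scale_left F.scale_right F.scale_closed F.add_closed
  have "?F (fdiff x x) (fdiff x x) = 0"
    using x by (simp add: expand del: formal_tensor_simps pairing_append append_in_lists_conv
        formal_adj_append)
  then show "spatial_seminorm \<phi> \<psi> y (fdiff x x) = 0" by (simp add: spatial_seminorm_def)
  have "?F (fdiff x z) (fdiff x z) = ?F (fdiff z x) (fdiff z x)"
    using x z by (simp add: expand del: formal_tensor_simps pairing_append append_in_lists_conv
        formal_adj_append)
  then show "spatial_seminorm \<phi> \<psi> y (fdiff x z) = spatial_seminorm \<phi> \<psi> y (fdiff z x)"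
    by (simp add: spatial_seminorm_def)
  show "spatial_seminorm \<phi> \<psi> y (fdiff x z)
      \<le> spatial_seminorm \<phi> \<psi> y (fdiff x w) + spatial_seminorm \<phi> \<psi> y (fdiff w z)" if w: "w \<in> formal"
  proof -
    \<comment> \<open>As lists the arguments differ by \<open>w\<close> and its negative, whose
      contributions to the form cancel.\<close>
    have "?F (fdiff x z) (fdiff x z) = ?F (fdiff x w @ fdiff w z) (fdiff x w @ fdiff w z)"
      using x z w by (simp add: expand del: append_assoc formal_tensor_simps
        pairing_append append_in_lists_conv formal_adj_append)
    then show ?thesis
      using F.Minkowski[OF fdiff_closed[OF x w] fdiff_closed[OF w z]]
      by (simp add: spatial_seminorm_def del: append_assoc formal_tensor_simps pairing_append formal_adj_append)
  qed
qed

abbreviation "tdist \<equiv> diff_nrm (formal_tensor A B)"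

lemma tdist_nonneg: "\<lbrakk>x \<in> formal; z \<in> formal\<rbrakk> \<Longrightarrow> 0 \<le> tdist x z"
  unfolding diff_nrm_formal by (intro spatial_nrm_nonneg fdiff_closed)

lemma tdist_self: "x \<in> formal \<Longrightarrow> tdist x x = 0"
  unfolding diff_nrm_formal
  by (rule antisym[OF spatial_nrm_leI spatial_nrm_nonneg[OF fdiff_closed]])
     (simp_all only: spatial_seminorm_self order_refl)

lemma tdist_commute:
  assumes "x \<in> formal" "z \<in> formal" shows "tdist x z = tdist z x"
proof -
  have "(\<lambda>(\<phi>, \<psi>, y). spatial_seminorm \<phi> \<psi> y (fdiff x z)) ` unit_vectors =
      (\<lambda>(\<phi>, \<psi>, y). spatial_seminorm \<phi> \<psi> y (fdiff z x)) ` unit_vectors"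
    by (rule image_cong[OF refl]) (simp only: split_paired_all prod.case spatial_seminorm_commute[OF _ assms])
  then show ?thesis by (simp only: diff_nrm_formal spatial_nrm_eq)
qed

lemma tdist_triangle:
  assumes "x \<in> formal" "z \<in> formal" "w \<in> formal"
  shows "tdist x z \<le> tdist x w + tdist w z"
  unfolding diff_nrm_formal
proof (rule spatial_nrm_leI)
  show "0 \<le> spatial_nrm A B (fdiff x w) + spatial_nrm A B (fdiff w z)"
    by (intro add_nonneg_nonneg spatial_nrm_nonneg fdiff_closed assms)
  fix \<phi> \<psi> y assume v: "(\<phi>, \<psi>, y) \<in> unit_vectors"
  have "spatial_seminorm \<phi> \<psi> y (fdiff x z) \<le>
      spatial_seminorm \<phi> \<psi> y (fdiff x w) + spatial_seminorm \<phi> \<psi> y (fdiff w z)"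
    by (rule spatial_seminorm_triangle[OF v assms])
  also have "\<dots> \<le> spatial_nrm A B (fdiff x w) + spatial_nrm A B (fdiff w z)"
    by (intro add_mono spatial_seminorm_le_nrm v fdiff_closed assms)
  finally show "spatial_seminorm \<phi> \<psi> y (fdiff x z) \<le>
      spatial_nrm A B (fdiff x w) + spatial_nrm A B (fdiff w z)" .
qed

lemma pairing_fscale:
  assumes "\<And>a. a \<in> carrier A \<Longrightarrow> \<theta> (c \<odot>\<^bsub>A\<^esub> a) = c * \<theta> a" "x \<in> formal"
  shows "pairing \<theta> \<theta>' (fscale c x) = c * pairing \<theta> \<theta>' x"
  using assms(2) by (induction x rule: lists.induct) (auto simp: assms(1) algebra_simps)

text \<open>On formal sums \<open>pairing \<theta> \<theta>'\<close> respects products and adjoints.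
  Hence at the vector given by the unit tensor its modulus is one of the seminorms in the supremum,
  and it is bounded by the spatial norm.\<close>

lemma
  assumes \<theta>: "\<theta> \<in> star_hom A complex_cstar" and \<theta>': "\<theta>' \<in> star_hom B complex_cstar"
    and x: "x \<in> formal"
  shows pairing_mult: "y \<in> formal \<Longrightarrow> pairing \<theta> \<theta>' (fmult x y) = pairing \<theta> \<theta>' x * pairing \<theta> \<theta>' y"
    and pairing_adj: "pairing \<theta> \<theta>' (fadj x) = cnj (pairing \<theta> \<theta>' x)"
    and pairing_diff_le: "y \<in> formal \<Longrightarrow> cmod (pairing \<theta> \<theta>' x - pairing \<theta> \<theta>' y) \<le> tdist x y"
proof -
  note h = star_hom_mult[OF \<theta>] star_hom_mult[OF \<theta>'] star_hom_adj[OF \<theta>] star_hom_adj[OF \<theta>']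
  have mult: "pairing \<theta> \<theta>' (fmult x y) = pairing \<theta> \<theta>' x * pairing \<theta> \<theta>' y"
    if "x \<in> formal" "y \<in> formal" for x y
  proof -
    have "pairing \<theta> \<theta>' (fmult x y) = (\<Sum>(a, b)\<leftarrow>x. \<Sum>(a', b')\<leftarrow>y. \<theta> a * \<theta>' b * (\<theta> a' * \<theta>' b'))"
      unfolding pairing_formal_mult
      by (intro arg_cong[of _ _ sum_list] map_cong refl)
         (auto simp: h intro!: arg_cong[of _ _ sum_list]
            dest!: lists_Times_memD[OF that(1)] lists_Times_memD[OF that(2)])
    also have "\<dots> = pairing \<theta> \<theta>' x * pairing \<theta> \<theta>' y"
      by (simp add: pairing_def split_def sum_list_const_mult sum_list_mult_const)
    finally show ?thesis .
  qed
  have adj: "pairing \<theta> \<theta>' (fadj x) = cnj (pairing \<theta> \<theta>' x)" if "x \<in> formal" for x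
    using that by (induction x rule: lists.induct) (auto simp: formal_adj_def h)
  show "y \<in> formal \<Longrightarrow> pairing \<theta> \<theta>' (fmult x y) = pairing \<theta> \<theta>' x * pairing \<theta> \<theta>' y"
    "pairing \<theta> \<theta>' (fadj x) = cnj (pairing \<theta> \<theta>' x)"
    using mult adj x by auto
  let ?e = "[(\<one>\<^bsub>A\<^esub>, \<one>\<^bsub>B\<^esub>)]"
  have e: "?e \<in> formal" "pairing \<theta> \<theta>' ?e = 1"
    by (simp_all add: star_hom_one[OF \<theta>] star_hom_one[OF \<theta>'])
  have unit: "(\<theta>, \<theta>', ?e) \<in> unit_vectors"
    using A.character_in_states[OF \<theta>] B.character_in_states[OF \<theta>'] e
      mult[OF fadj_closed[OF e(1)] e(1)] adj[OF e(1)] by (simp add: unit_vectors_def)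
  have le: "cmod (pairing \<theta> \<theta>' x) \<le> spatial_nrm A B x" if x: "x \<in> formal" for x
  proof -
    have "spatial_seminorm \<theta> \<theta>' ?e x = cmod (pairing \<theta> \<theta>' x)"
      using mult[OF fadj_closed[OF fmult_closed[OF x e(1)]] fmult_closed[OF x e(1)]]
        adj[OF fmult_closed[OF x e(1)]] mult[OF x e(1)] e(2)
        star_hom_one[OF \<theta>] star_hom_one[OF \<theta>']
      by (simp add: spatial_seminorm_def cmod_def power2_eq_square)
    then show ?thesis using spatial_seminorm_le_nrm[OF unit x] by simp
  qed
  show "cmod (pairing \<theta> \<theta>' x - pairing \<theta> \<theta>' y) \<le> tdist x y" if y: "y \<in> formal"
    using le[OF fdiff_closed[OF x y]] pairing_fscale[of \<theta> "-1" y \<theta>'] y star_hom_smult[OF \<theta>]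
    by (simp add: diff_nrm_formal del: formal_tensor_simps)
qed

end

section \<open>Functionals on the minimal tensor product\<close>

lemma min_tensor_simps:
  "carrier (min_tensor A B) = seq_class (formal_tensor A B) ` cauchy_seqs (formal_tensor A B)"
  "S \<otimes>\<^bsub>min_tensor A B\<^esub> T =
    (\<Union>s\<in>S. \<Union>t\<in>T. seq_class (formal_tensor A B) (\<lambda>n. formal_mult A B (s n) (t n)))"
  "S \<oplus>\<^bsub>min_tensor A B\<^esub> T =
    (\<Union>s\<in>S. \<Union>t\<in>T. seq_class (formal_tensor A B) (\<lambda>n. s n @ t n))"
  "c \<odot>\<^bsub>min_tensor A B\<^esub> S =
    (\<Union>s\<in>S. seq_class (formal_tensor A B) (\<lambda>n. c \<odot>\<^bsub>formal_tensor A B\<^esub> s n))"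
  "adj (min_tensor A B) S =
    (\<Union>s\<in>S. seq_class (formal_tensor A B) (\<lambda>n. formal_adj A B (s n)))"
  "\<one>\<^bsub>min_tensor A B\<^esub> = tensor_of A B [(\<one>\<^bsub>A\<^esub>, \<one>\<^bsub>B\<^esub>)]"
  by (simp_all add: min_tensor_def completion_def tensor_of_def)

context cstar_pair
begin

abbreviation "fclass \<equiv> seq_class (formal_tensor A B)"

lemma cauchy_formal: "s \<in> cauchy_seqs (formal_tensor A B) \<Longrightarrow> s n \<in> formal"
  unfolding cauchy_seqs_def by (simp only: formal_tensor_simps mem_Collect_eq)

lemma class_formal: "t \<in> fclass s \<Longrightarrow> t n \<in> formal"
  unfolding seq_class_def using cauchy_formal by blast

lemma carrier_formal: "\<lbrakk>S \<in> carrier (min_tensor A B); s \<in> S\<rbrakk> \<Longrightarrow> s n \<in> formal"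
  unfolding min_tensor_simps using class_formal by blast

lemma class_self: "s \<in> cauchy_seqs (formal_tensor A B) \<Longrightarrow> s \<in> fclass s"
  using cauchy_formal[of s] by (simp add: seq_class_def tdist_self)

lemma const_cauchy: "x \<in> formal \<Longrightarrow> (\<lambda>n. x) \<in> cauchy_seqs (formal_tensor A B)"
  unfolding cauchy_seqs_def by (simp add: tdist_self)

lemma tensor_of_closed: "x \<in> formal \<Longrightarrow> tensor_of A B x \<in> carrier (min_tensor A B)"
  unfolding tensor_of_def min_tensor_simps by (intro imageI const_cauchy)

text \<open>Any member represents its class. Operations and functionals on the completion, which
  range over all members, can thus be computed along one sequence.\<close>

lemma class_eq:
  assumes Z: "Z \<in> carrier (min_tensor A B)" and s: "s \<in> Z"
  shows "Z = fclass s"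
proof -
  obtain z where z: "z \<in> cauchy_seqs (formal_tensor A B)" "Z = fclass z"
    using Z by (auto simp: min_tensor_simps)
  have sc: "s \<in> cauchy_seqs (formal_tensor A B)" and zs: "(\<lambda>n. tdist (z n) (s n)) \<longlonglongrightarrow> 0"
    using s z by (auto simp: seq_class_def)
  note formal = cauchy_formal[OF z(1)] cauchy_formal[OF sc]
  have lim: "(\<lambda>n. tdist (u n) (t n)) \<longlonglongrightarrow> 0"
    if "(\<lambda>n. tdist (u n) (v n)) \<longlonglongrightarrow> 0" "(\<lambda>n. tdist (v n) (t n)) \<longlonglongrightarrow> 0"
      "\<And>n. u n \<in> formal" "\<And>n. v n \<in> formal" "\<And>n. t n \<in> formal" for u v t
  proof (rule real_tendsto_sandwich[OF _ _ tendsto_const])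
    show "(\<lambda>n. tdist (u n) (v n) + tdist (v n) (t n)) \<longlonglongrightarrow> 0"
      using tendsto_add[OF that(1,2)] by simp
  qed (use that(3-5) tdist_nonneg tdist_triangle in auto)
  have sz: "(\<lambda>n. tdist (s n) (z n)) \<longlonglongrightarrow> 0"
    using zs tdist_commute[OF formal(1) formal(2)] by simp
  have "t \<in> fclass z \<longleftrightarrow> t \<in> fclass s" for t
  proof (cases "t \<in> cauchy_seqs (formal_tensor A B)")
    case True
    show ?thesis
      using True lim[of s z t, OF sz _ formal(2) formal(1) cauchy_formal[OF True]]
        lim[of z s t, OF zs _ formal(1) formal(2) cauchy_formal[OF True]]
      unfolding seq_class_def by auto
  qed (simp add: seq_class_def)
  then show ?thesis unfolding z(2) by blast
qed

lemma tensor_of_eqI: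
  assumes "Z \<in> carrier (min_tensor A B)" "(\<lambda>n. x) \<in> Z"
  shows "Z = tensor_of A B x"
  using class_eq[OF assms] by (simp add: tensor_of_def)

lemma const_in_tensor_of: "x \<in> formal \<Longrightarrow> (\<lambda>n. x) \<in> tensor_of A B x"
  unfolding tensor_of_def by (intro class_self const_cauchy)

lemma carrier_nonempty:
  assumes "Z \<in> carrier (min_tensor A B)" obtains s where "s \<in> Z" "\<And>n. s n \<in> formal"
proof -
  obtain z where z: "z \<in> cauchy_seqs (formal_tensor A B)" "Z = fclass z"
    using assms by (auto simp: min_tensor_simps)
  show thesis using that[of z] class_self[OF z(1)] cauchy_formal[OF z(1)] z(2) by blast
qed

section \<open>Product functionals of two characters on completed tensors\<close>

context
  fixes \<theta> \<theta>'
  assumes \<theta>: "\<theta> \<in> star_hom A complex_cstar" and \<theta>': "\<theta>' \<in> star_hom B complex_cstar"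
begin

lemma class_pairing_tendsto:
  assumes t: "t \<in> fclass s" and s: "\<And>n. s n \<in> formal"
    and lim: "(\<lambda>n. pairing \<theta> \<theta>' (s n)) \<longlonglongrightarrow> c"
  shows "(\<lambda>n. pairing \<theta> \<theta>' (t n)) \<longlonglongrightarrow> c"
proof -
  have "(\<lambda>n. tdist (s n) (t n)) \<longlonglongrightarrow> 0" using t by (simp add: seq_class_def)
  then have "(\<lambda>n. pairing \<theta> \<theta>' (s n) - pairing \<theta> \<theta>' (t n)) \<longlonglongrightarrow> 0"
    by (rule Lim_null_comparison[rotated])
       (use pairing_diff_le[OF \<theta> \<theta>' s class_formal[OF t]] in auto)
  from tendsto_diff[OF lim this] show ?thesis by simp
qed

lemma tensor_functional_eqI:
  assumes S: "S \<in> carrier (min_tensor A B)" and s: "s \<in> S"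
    and lim: "(\<lambda>n. pairing \<theta> \<theta>' (s n)) \<longlonglongrightarrow> c"
  shows "tensor_functional \<theta> \<theta>' S = c"
  unfolding tensor_functional_def
proof (rule the_equality)
  have sf: "s n \<in> formal" for n by (rule carrier_formal[OF S s])
  show all: "\<forall>s\<in>S. (\<lambda>n. pairing \<theta> \<theta>' (s n)) \<longlonglongrightarrow> c"
    using class_pairing_tendsto[OF _ sf lim] class_eq[OF S s] by blast
  show "d = c" if "\<forall>s\<in>S. (\<lambda>n. pairing \<theta> \<theta>' (s n)) \<longlonglongrightarrow> d" for d
    using that s lim LIMSEQ_unique by blast
qed

lemma tensor_functional_tendsto:
  assumes S: "S \<in> carrier (min_tensor A B)" and s: "s \<in> S"
  shows "(\<lambda>n. pairing \<theta> \<theta>' (s n)) \<longlonglongrightarrow> tensor_functional \<theta> \<theta>' S"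
proof -
  have sc: "s \<in> cauchy_seqs (formal_tensor A B)" using S s by (auto simp: min_tensor_simps seq_class_def)
  note sf = cauchy_formal[OF sc]
  have "Cauchy (\<lambda>n. pairing \<theta> \<theta>' (s n))"
    unfolding Cauchy_def dist_norm
  proof (intro allI impI)
    fix e :: real assume "e > 0"
    then obtain N where N: "\<And>m n. \<lbrakk>m \<ge> N; n \<ge> N\<rbrakk> \<Longrightarrow> tdist (s m) (s n) < e"
      using sc unfolding cauchy_seqs_def by blast
    show "\<exists>M. \<forall>m\<ge>M. \<forall>n\<ge>M. cmod (pairing \<theta> \<theta>' (s m) - pairing \<theta> \<theta>' (s n)) < e"
      by (intro exI[of _ N] allI impI order_le_less_trans[OF pairing_diff_le[OF \<theta> \<theta>' sf sf] N])
  qed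
  then obtain c where c: "(\<lambda>n. pairing \<theta> \<theta>' (s n)) \<longlonglongrightarrow> c"
    using Cauchy_convergent convergent_def by blast
  with tensor_functional_eqI[OF S s c] show ?thesis by simp
qed

lemma tensor_functional_tensor_of:
  "x \<in> formal \<Longrightarrow> tensor_functional \<theta> \<theta>' (tensor_of A B x) = pairing \<theta> \<theta>' x"
  by (rule tensor_functional_eqI[OF tensor_of_closed const_in_tensor_of]) simp_all

text \<open>Closure of the carrier under the operations is not needed: where a result lies in the
  carrier, it is a nonempty class.\<close>

lemma tensor_functional_mult:
  assumes S: "S \<in> carrier (min_tensor A B)" and T: "T \<in> carrier (min_tensor A B)"
    and ST: "S \<otimes>\<^bsub>min_tensor A B\<^esub> T \<in> carrier (min_tensor A B)"
  shows "tensor_functional \<theta> \<theta>' (S \<otimes>\<^bsub>min_tensor A B\<^esub> T) =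
    tensor_functional \<theta> \<theta>' S * tensor_functional \<theta> \<theta>' T"
proof -
  obtain u where u: "u \<in> S \<otimes>\<^bsub>min_tensor A B\<^esub> T" by (rule carrier_nonempty[OF ST])
  then obtain s t where st: "s \<in> S" "t \<in> T" "u \<in> fclass (\<lambda>n. fmult (s n) (t n))"
    by (auto simp: min_tensor_simps)
  have f: "s n \<in> formal" "t n \<in> formal" for n
    by (rule carrier_formal[OF S st(1)], rule carrier_formal[OF T st(2)])
  have "(\<lambda>n. pairing \<theta> \<theta>' (fmult (s n) (t n))) \<longlonglongrightarrow>
      tensor_functional \<theta> \<theta>' S * tensor_functional \<theta> \<theta>' T"
    unfolding pairing_mult[OF \<theta> \<theta>' f]
    by (intro tendsto_mult tensor_functional_tendsto S T st)
  from class_pairing_tendsto[OF st(3) fmult_closed[OF f] this]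
  show ?thesis by (rule tensor_functional_eqI[OF ST u])
qed

lemma tensor_functional_add:
  assumes S: "S \<in> carrier (min_tensor A B)" and T: "T \<in> carrier (min_tensor A B)"
    and ST: "S \<oplus>\<^bsub>min_tensor A B\<^esub> T \<in> carrier (min_tensor A B)"
  shows "tensor_functional \<theta> \<theta>' (S \<oplus>\<^bsub>min_tensor A B\<^esub> T) =
    tensor_functional \<theta> \<theta>' S + tensor_functional \<theta> \<theta>' T"
proof -
  obtain u where u: "u \<in> S \<oplus>\<^bsub>min_tensor A B\<^esub> T" by (rule carrier_nonempty[OF ST])
  then obtain s t where st: "s \<in> S" "t \<in> T" "u \<in> fclass (\<lambda>n. s n @ t n)"
    by (auto simp: min_tensor_simps)
  have f: "s n \<in> formal" "t n \<in> formal" for n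
    by (rule carrier_formal[OF S st(1)], rule carrier_formal[OF T st(2)])
  have "(\<lambda>n. pairing \<theta> \<theta>' (s n @ t n)) \<longlonglongrightarrow>
      tensor_functional \<theta> \<theta>' S + tensor_functional \<theta> \<theta>' T"
    unfolding pairing_append
    by (intro tendsto_add tensor_functional_tendsto S T st)
  from class_pairing_tendsto[OF st(3) _ this] f
  show ?thesis by (intro tensor_functional_eqI[OF ST u]) simp
qed

lemma tensor_functional_smult:
  assumes S: "S \<in> carrier (min_tensor A B)"
    and cS: "c \<odot>\<^bsub>min_tensor A B\<^esub> S \<in> carrier (min_tensor A B)"
  shows "tensor_functional \<theta> \<theta>' (c \<odot>\<^bsub>min_tensor A B\<^esub> S) = c * tensor_functional \<theta> \<theta>' S"
proof -
  obtain u where u: "u \<in> c \<odot>\<^bsub>min_tensor A B\<^esub> S" by (rule carrier_nonempty[OF cS])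
  then obtain s where s: "s \<in> S" "u \<in> fclass (\<lambda>n. fscale c (s n))"
    by (auto simp: min_tensor_simps)
  have f: "s n \<in> formal" for n by (rule carrier_formal[OF S s(1)])
  have scale: "pairing \<theta> \<theta>' (fscale c (s n)) = c * pairing \<theta> \<theta>' (s n)" for n
    by (rule pairing_fscale[OF _ f]) (use star_hom_smult[OF \<theta>] in simp)
  have "(\<lambda>n. pairing \<theta> \<theta>' (fscale c (s n))) \<longlonglongrightarrow> c * tensor_functional \<theta> \<theta>' S"
    unfolding scale
    by (intro tendsto_mult tendsto_const tensor_functional_tendsto S s)
  from class_pairing_tendsto[OF s(2) fscale_closed[OF f] this]
  show ?thesis by (rule tensor_functional_eqI[OF cS u])
qed

lemma tensor_functional_adj:
  assumes S: "S \<in> carrier (min_tensor A B)"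
    and aS: "adj (min_tensor A B) S \<in> carrier (min_tensor A B)"
  shows "tensor_functional \<theta> \<theta>' (adj (min_tensor A B) S) = cnj (tensor_functional \<theta> \<theta>' S)"
proof -
  obtain u where u: "u \<in> adj (min_tensor A B) S" by (rule carrier_nonempty[OF aS])
  then obtain s where s: "s \<in> S" "u \<in> fclass (\<lambda>n. fadj (s n))"
    by (auto simp: min_tensor_simps)
  have f: "s n \<in> formal" for n by (rule carrier_formal[OF S s(1)])
  have "(\<lambda>n. pairing \<theta> \<theta>' (fadj (s n))) \<longlonglongrightarrow> cnj (tensor_functional \<theta> \<theta>' S)"
    unfolding pairing_adj[OF \<theta> \<theta>' f]
    by (intro tendsto_cnj tensor_functional_tendsto S s)
  from class_pairing_tendsto[OF s(2) fadj_closed[OF f] this]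
  show ?thesis by (rule tensor_functional_eqI[OF aS u])
qed

text \<open>As \<open>f\<close> preserves the operations and maps into the carrier, every sum,
  product, multiple or adjoint of values of \<open>f\<close> is again in the carrier; this is the
  side condition of the rules above.\<close>

lemma tensor_functional_star_hom:
  assumes f: "f \<in> star_hom C (min_tensor A B)" and C: "cstar_algebra C"
  shows "(\<lambda>a. tensor_functional \<theta> \<theta>' (f a)) \<in> star_hom C complex_cstar"
proof -
  interpret C: cstar_algebra C by (rule C)
  note fc = star_hom_closed[OF f]
  have one: "tensor_functional \<theta> \<theta>' (f \<one>\<^bsub>C\<^esub>) = 1"
    unfolding star_hom_one[OF f] min_tensor_simps
    using star_hom_one[OF \<theta>] star_hom_one[OF \<theta>'] by (subst tensor_functional_tensor_of) auto
  have add: "tensor_functional \<theta> \<theta>' (f (a \<oplus>\<^bsub>C\<^esub> b)) =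
      tensor_functional \<theta> \<theta>' (f a) + tensor_functional \<theta> \<theta>' (f b)"
    if "a \<in> carrier C" "b \<in> carrier C" for a b
    using tensor_functional_add[OF fc fc, OF that] fc[OF C.a_closed[OF that]]
    by (simp add: star_hom_add[OF f that])
  have mult: "tensor_functional \<theta> \<theta>' (f (a \<otimes>\<^bsub>C\<^esub> b)) =
      tensor_functional \<theta> \<theta>' (f a) * tensor_functional \<theta> \<theta>' (f b)"
    if "a \<in> carrier C" "b \<in> carrier C" for a b
    using tensor_functional_mult[OF fc fc, OF that] fc[OF C.m_closed[OF that]]
    by (simp add: star_hom_mult[OF f that])
  have smult: "tensor_functional \<theta> \<theta>' (f (c \<odot>\<^bsub>C\<^esub> a)) = c * tensor_functional \<theta> \<theta>' (f a)"
    if "a \<in> carrier C" for a c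
    using tensor_functional_smult[OF fc, OF that] fc[OF C.scale_closed[OF that]]
    by (simp add: star_hom_smult[OF f that])
  have adj: "tensor_functional \<theta> \<theta>' (f (adj C a)) = cnj (tensor_functional \<theta> \<theta>' (f a))"
    if "a \<in> carrier C" for a
    using tensor_functional_adj[OF fc, OF that] fc[OF C.adj_closed[OF that]]
    by (simp add: star_hom_adj[OF f that])
  show ?thesis unfolding star_hom_complex_iff using one add mult smult adj by blast
qed

end

end

text \<open>Membership of the image in the carrier makes it a nonempty class, so it contains a
  sequence equivalent to the termwise image of one in \<open>S\<close>; along that termwise image
  the two pairings coincide.\<close>

lemma tensor_functional_tensor_map:
  assumes AB: "cstar_pair A B" and CD: "cstar_pair C D"
    and f: "f \<in> star_hom A C" and g: "g \<in> star_hom B D"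
    and \<theta>: "\<theta> \<in> star_hom C complex_cstar" and \<theta>': "\<theta>' \<in> star_hom D complex_cstar"
    and S: "S \<in> carrier (min_tensor A B)"
    and TS: "tensor_map C D f g S \<in> carrier (min_tensor C D)"
  shows "tensor_functional \<theta> \<theta>' (tensor_map C D f g S) =
    tensor_functional (\<lambda>a. \<theta> (f a)) (\<lambda>b. \<theta>' (g b)) S"
proof -
  interpret AB: cstar_pair A B by (rule AB)
  interpret CD: cstar_pair C D by (rule CD)
  obtain u where u: "u \<in> tensor_map C D f g S" by (rule CD.carrier_nonempty[OF TS])
  then obtain s where s: "s \<in> S" "u \<in> seq_class (formal_tensor C D) (\<lambda>n. map (map_prod f g) (s n))"
    by (auto simp: tensor_map_def)
  have sf: "s n \<in> lists (carrier A \<times> carrier B)" for n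
    by (rule AB.carrier_formal[OF S s(1)])
  have "(\<lambda>n. pairing \<theta> \<theta>' (map (map_prod f g) (s n))) \<longlonglongrightarrow>
      tensor_functional (\<lambda>a. \<theta> (f a)) (\<lambda>b. \<theta>' (g b)) S"
    unfolding pairing_map_map_prod
    by (intro AB.tensor_functional_tendsto star_hom_comp[OF f \<theta>] star_hom_comp[OF g \<theta>'] S s)
  moreover have "map (map_prod f g) (s n) \<in> lists (carrier C \<times> carrier D)" for n
    by (auto intro!: star_hom_closed[OF f] star_hom_closed[OF g] dest!: lists_Times_memD[OF sf])
  ultimately show ?thesis
    by (intro CD.tensor_functional_eqI[OF \<theta> \<theta>' TS u] CD.class_pairing_tendsto[OF \<theta> \<theta>' s(2)])
qed

section \<open>Abelianization\<close>

context cstar_algebra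
begin

definition character_kernel :: "('a \<Rightarrow> complex) \<Rightarrow> 'a set" where
  "character_kernel \<theta> = {x \<in> carrier A. \<theta> x = 0}"

lemma closedin_normI:
  assumes "C \<subseteq> carrier A"
    and "\<And>x. \<lbrakk>x \<in> carrier A; \<And>e. e > 0 \<Longrightarrow> \<exists>y\<in>C. cdist A x y < e\<rbrakk> \<Longrightarrow> x \<in> C"
  shows "closedin (norm_topology A) C"
  unfolding norm_topology_def closedin_metric
proof (intro conjI allI impI)
  fix x assume x: "x \<in> carrier A - C"
  then obtain e where e: "e > 0" "\<And>y. y \<in> C \<Longrightarrow> \<not> cdist A x y < e" using assms(2)[of x] by blast
  then show "\<exists>r>0. disjnt C (mball x r)"
    by (intro exI[of _ e]) (auto simp: disjnt_def)
qed (rule assms(1))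

lemma closedin_normD:
  assumes "closedin (norm_topology A) C" "x \<in> carrier A" "\<And>e. e > 0 \<Longrightarrow> \<exists>y\<in>C. cdist A x y < e"
  shows "x \<in> C"
proof (rule ccontr)
  assume "x \<notin> C"
  then obtain r where r: "r > 0" "disjnt C (mball x r)" and C: "C \<subseteq> carrier A"
    using assms(1,2) unfolding norm_topology_def closedin_metric by blast
  from assms(3)[OF r(1)] obtain y where y: "y \<in> C" "cdist A x y < r" by blast
  then have "y \<in> mball x r" using C assms(2) in_mball by blast
  then show False using y(1) r(2) by (auto simp: disjnt_def)
qed

lemma ideal_character_kernel:
  assumes \<theta>: "\<theta> \<in> star_hom A complex_cstar"
  shows "ideal (character_kernel \<theta>) A"
proof (rule idealI[OF is_ring])
  have inv: "\<ominus> x = (-1) \<odot> x" if "x \<in> carrier A" for x using scale_minus_one[OF that] by simp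
  show "subgroup (character_kernel \<theta>) (add_monoid A)"
  proof
    show "character_kernel \<theta> \<subseteq> carrier (add_monoid A)" by (auto simp: character_kernel_def)
    show "\<one>\<^bsub>add_monoid A\<^esub> \<in> character_kernel \<theta>" by (simp add: character_kernel_def star_hom_zero[OF \<theta>])
    show "x \<otimes>\<^bsub>add_monoid A\<^esub> y \<in> character_kernel \<theta>"
      if "x \<in> character_kernel \<theta>" "y \<in> character_kernel \<theta>" for x y
      using that by (simp add: character_kernel_def star_hom_add[OF \<theta>])
    show "inv\<^bsub>add_monoid A\<^esub> x \<in> character_kernel \<theta>" if "x \<in> character_kernel \<theta>" for x
      unfolding a_inv_def[symmetric]
      using that by (simp add: character_kernel_def inv star_hom_smult[OF \<theta>])
  qed
qed (simp_all add: character_kernel_def star_hom_mult[OF \<theta>])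

lemma closedin_character_kernel:
  assumes \<theta>: "\<theta> \<in> star_hom A complex_cstar"
  shows "closedin (norm_topology A) (character_kernel \<theta>)"
proof (rule closedin_normI)
  fix x assume x: "x \<in> carrier A" and near: "\<And>e. e > 0 \<Longrightarrow> \<exists>y\<in>character_kernel \<theta>. cdist A x y < e"
  have "\<theta> x = 0"
  proof (rule ccontr)
    assume "\<theta> x \<noteq> 0"
    then obtain y where y: "y \<in> character_kernel \<theta>" "cdist A x y < cmod (\<theta> x)"
      using near[of "cmod (\<theta> x)"] by auto
    then show False using character_diff_le[OF \<theta> x, of y] by (simp add: character_kernel_def)
  qed
  then show "x \<in> character_kernel \<theta>" using x by (simp add: character_kernel_def)
qed (auto simp: character_kernel_def)

section \<open>The closed ideal generated by commutators and its quotient\<close>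

definition closed_commutator_ideals :: "'a set set" where
  "closed_commutator_ideals = {I. ideal I A \<and> closedin (norm_topology A) I \<and>
     (\<forall>x\<in>carrier A. \<forall>y\<in>carrier A. (x \<otimes> y) \<ominus> (y \<otimes> x) \<in> I)}"

lemma commutator_ideal_eq: "commutator_ideal A = \<Inter>closed_commutator_ideals"
  by (simp add: commutator_ideal_def closed_commutator_ideals_def)

text \<open>The kernel of a character is a closed ideal containing all commutators, hence one of the
  ideals being intersected.\<close>

lemma commutator_ideal_subset_kernel:
  assumes \<theta>: "\<theta> \<in> star_hom A complex_cstar"
  shows "commutator_ideal A \<subseteq> character_kernel \<theta>"
proof -
  have "(x \<otimes> y) \<ominus> (y \<otimes> x) \<in> character_kernel \<theta>" if "x \<in> carrier A" "y \<in> carrier A" for x y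
    using that by (simp add: character_kernel_def star_hom_diff[OF \<theta>] star_hom_mult[OF \<theta>])
  then show ?thesis
    using ideal_character_kernel[OF \<theta>] closedin_character_kernel[OF \<theta>]
    unfolding commutator_ideal_eq closed_commutator_ideals_def by blast
qed

text \<open>Ensures that the family being intersected is nonempty.\<close>

lemma carrier_closed_commutator_ideal: "carrier A \<in> closed_commutator_ideals"
proof -
  have "closedin (norm_topology A) (carrier A)" by (rule closedin_normI) auto
  then show ?thesis
    using ring.oneideal[OF is_ring] by (auto simp: closed_commutator_ideals_def)
qed

lemma ideal_commutator_ideal: "ideal (commutator_ideal A) A"
  unfolding commutator_ideal_eq
  by (rule ring.i_Intersect[OF is_ring])
     (use carrier_closed_commutator_ideal in \<open>auto simp: closed_commutator_ideals_def\<close>)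

text \<open>The adjoint is isometric, exchanges left and right multiplication and sends commutators
  to commutators. The family is therefore stable under it, which makes the intersection closed under
  adjoints.\<close>

lemma adj_preimage_ideal:
  assumes I: "I \<in> closed_commutator_ideals"
  shows "{x \<in> carrier A. adj A x \<in> I} \<in> closed_commutator_ideals"
proof -
  let ?J = "{x \<in> carrier A. adj A x \<in> I}"
  interpret I: ideal I A using I by (simp add: closed_commutator_ideals_def)
  have adj_minus: "adj A (\<ominus> x) = \<ominus> adj A x" if "x \<in> carrier A" for x
    using that by (simp add: scale_minus_one[symmetric] adj_smult adj_closed)
  have adj_diff: "adj A (x \<ominus> y) = adj A x \<ominus> adj A y" if "x \<in> carrier A" "y \<in> carrier A" for x y
    using that by (simp add: a_minus_def adj_add adj_minus)
  have adj_zero: "adj A \<zero> = \<zero>" using adj_smult[of \<zero> 0] adj_closed by simp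
  have "ideal ?J A"
  proof (rule idealI[OF is_ring])
    show "subgroup ?J (add_monoid A)"
    proof
      show "inv\<^bsub>add_monoid A\<^esub> x \<in> ?J" if "x \<in> ?J" for x
        unfolding a_inv_def[symmetric] using that by (simp add: adj_minus)
    qed (auto simp: adj_zero adj_add)
  qed (auto simp: adj_mult adj_closed I.I_l_closed I.I_r_closed)
  moreover have "closedin (norm_topology A) ?J"
  proof (rule closedin_normI)
    fix x assume x: "x \<in> carrier A" and near: "\<And>e. e > 0 \<Longrightarrow> \<exists>y\<in>?J. cdist A x y < e"
    have "adj A x \<in> I"
    proof (rule closedin_normD)
      show "closedin (norm_topology A) I" using I by (simp add: closed_commutator_ideals_def)
      show "adj A x \<in> carrier A" by (rule adj_closed[OF x])
      fix e :: real assume "e > 0"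
      then obtain y where y: "y \<in> ?J" "cdist A x y < e" using near by blast
      have "cdist A (adj A x) (adj A y) = cdist A x y"
        using x y(1) by (simp add: cdist_def adj_closed adj_diff[symmetric] nrm_adj)
      then show "\<exists>y\<in>I. cdist A (adj A x) y < e" using y by (intro bexI[of _ "adj A y"]) auto
    qed
    then show "x \<in> ?J" using x by simp
  qed auto
  moreover have "(x \<otimes> y) \<ominus> (y \<otimes> x) \<in> ?J" if "x \<in> carrier A" "y \<in> carrier A" for x y
  proof -
    have "adj A ((x \<otimes> y) \<ominus> (y \<otimes> x)) = (adj A y \<otimes> adj A x) \<ominus> (adj A x \<otimes> adj A y)"
      using that by (simp add: adj_diff adj_mult)
    then show ?thesis using I that by (simp add: closed_commutator_ideals_def adj_closed)
  qed
  ultimately show ?thesis by (simp add: closed_commutator_ideals_def)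
qed

lemma commutator_ideal_adj:
  assumes "x \<in> commutator_ideal A" shows "adj A x \<in> commutator_ideal A"
  using assms adj_preimage_ideal unfolding commutator_ideal_eq by blast

sublocale K: ideal "commutator_ideal A" A by (rule ideal_commutator_ideal)

text \<open>A ring ideal absorbs ring elements, and a scalar acts as multiplication by its multiple
  of the unit.\<close>

lemma commutator_ideal_scale:
  assumes "x \<in> commutator_ideal A" shows "c \<odot> x \<in> commutator_ideal A"
proof -
  have x: "x \<in> carrier A" using assms K.a_subset by blast
  have "c \<odot> x = (c \<odot> \<one>) \<otimes> x" using x smult_mult_left[OF unit_closed x, of c] by simp
  then show ?thesis using K.I_l_closed[OF assms scale_closed[OF unit_closed], of c] by simp
qed

lemma ab_class_self: "a \<in> carrier A \<Longrightarrow> a \<in> ab_class A a"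
  unfolding ab_class_def by (rule K.a_rcos_self)

lemma ab_class_mem_iff:
  assumes "a \<in> carrier A"
  shows "x \<in> ab_class A a \<longleftrightarrow> x \<in> carrier A \<and> x \<ominus> a \<in> commutator_ideal A"
proof
  assume x: "x \<in> ab_class A a"
  then have xc: "x \<in> carrier A"
    using K.a_subset assms by (auto simp: ab_class_def a_r_coset_def')
  then show "x \<in> carrier A \<and> x \<ominus> a \<in> commutator_ideal A"
    using x K.a_rcos_module_minus[OF is_ring assms xc] by (simp add: ab_class_def)
next
  assume "x \<in> carrier A \<and> x \<ominus> a \<in> commutator_ideal A"
  then show "x \<in> ab_class A a"
    using K.a_rcos_module_minus[OF is_ring assms] by (simp add: ab_class_def)
qed

lemma ab_class_eqI:
  assumes "a \<in> carrier A" "x \<in> ab_class A a" shows "ab_class A x = ab_class A a"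
  using K.a_repr_independence'[of x a] assms by (simp add: ab_class_def)

lemma carrier_abelianization: "carrier (abelianization A) = ab_class A ` carrier A"
  by (auto simp: abelianization_def ring.extend_def FactRing_def A_RCOSETS_defs ab_class_def a_r_coset_def)

text \<open>In \<open>abelianization\<close> these operations are unions over all representatives of
  a coset; the point is that the united family is constant.\<close>

lemma
  assumes a: "a \<in> carrier A"
  shows ab_class_smult: "c \<odot>\<^bsub>abelianization A\<^esub> ab_class A a = ab_class A (c \<odot> a)"
    and ab_class_adj: "adj (abelianization A) (ab_class A a) = ab_class A (adj A a)"
proof -
  have "ab_class A (c \<odot> x) = ab_class A (c \<odot> a)" if "x \<in> ab_class A a" for x
  proof (rule ab_class_eqI)
    have x: "x \<in> carrier A" "x \<ominus> a \<in> commutator_ideal A" using that ab_class_mem_iff[OF a] by auto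
    have "c \<odot> x \<ominus> c \<odot> a = c \<odot> (x \<ominus> a)"
      using x a by (simp add: diff_eq_scale scale_right_distrib scale_scale mult.commute)
    then show "c \<odot> x \<in> ab_class A (c \<odot> a)"
      using x a commutator_ideal_scale by (simp add: ab_class_mem_iff)
  qed (simp add: a)
  then have "(\<Union>x\<in>ab_class A a. ab_class A (c \<odot> x)) = (\<Union>x\<in>ab_class A a. ab_class A (c \<odot> a))"
    by (rule SUP_cong[OF refl])
  also have "\<dots> = ab_class A (c \<odot> a)" using ab_class_self[OF a] by blast
  finally show "c \<odot>\<^bsub>abelianization A\<^esub> ab_class A a = ab_class A (c \<odot> a)"
    by (simp add: abelianization_def ring.extend_def)
  have "ab_class A (adj A x) = ab_class A (adj A a)" if "x \<in> ab_class A a" for x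
  proof (rule ab_class_eqI)
    have x: "x \<in> carrier A" "x \<ominus> a \<in> commutator_ideal A" using that ab_class_mem_iff[OF a] by auto
    have "adj A x \<ominus> adj A a = adj A (x \<ominus> a)"
      using x a by (simp add: diff_eq_scale adj_add adj_smult adj_closed)
    then show "adj A x \<in> ab_class A (adj A a)"
      using x a commutator_ideal_adj by (simp add: ab_class_mem_iff adj_closed)
  qed (simp add: a adj_closed)
  then have "(\<Union>x\<in>ab_class A a. ab_class A (adj A x)) = (\<Union>x\<in>ab_class A a. ab_class A (adj A a))"
    by (rule SUP_cong[OF refl])
  also have "\<dots> = ab_class A (adj A a)" using ab_class_self[OF a] by blast
  finally show "adj (abelianization A) (ab_class A a) = ab_class A (adj A a)"
    by (simp add: abelianization_def ring.extend_def)
qed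

lemma
  assumes a: "a \<in> carrier A" and b: "b \<in> carrier A"
  shows ab_class_add: "ab_class A a \<oplus>\<^bsub>abelianization A\<^esub> ab_class A b = ab_class A (a \<oplus> b)"
    and ab_class_mult: "ab_class A a \<otimes>\<^bsub>abelianization A\<^esub> ab_class A b = ab_class A (a \<otimes> b)"
  using ring_hom_add[OF K.rcos_ring_hom a b] ring_hom_mult[OF K.rcos_ring_hom a b]
  by (simp_all add: abelianization_def ring.extend_def ab_class_def FactRing_def)

lemma ab_class_one: "\<one>\<^bsub>abelianization A\<^esub> = ab_class A \<one>"
  by (simp add: abelianization_def ring.extend_def ab_class_def FactRing_def)

lemma ab_class_closed: "a \<in> carrier A \<Longrightarrow> ab_class A a \<in> carrier (abelianization A)"
  by (simp add: carrier_abelianization)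

lemma topspace_char_space:
  "topspace (char_space A) =
    {\<omega> \<in> extensional (carrier (abelianization A)). \<omega> \<in> star_hom (abelianization A) complex_cstar}"
  by (auto simp: char_space_def spectrum_def PiE_def)

lemma character_pullback:
  assumes "\<omega> \<in> topspace (char_space A)"
  shows "(\<lambda>a. \<omega> (ab_class A a)) \<in> star_hom A complex_cstar"
proof -
  have "\<omega> \<in> star_hom (abelianization A) complex_cstar"
    using assms by (simp add: topspace_char_space)
  note h = star_hom_add[OF this] star_hom_mult[OF this] star_hom_smult[OF this] star_hom_adj[OF this]
    star_hom_one[OF this]
  show ?thesis unfolding star_hom_complex_iff
    using h by (simp add: ab_class_closed ab_class_add[symmetric] ab_class_mult[symmetric]
        ab_class_smult[symmetric] ab_class_adj[symmetric] ab_class_one[symmetric] adj_closed)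
qed

lemma char_space_eqI:
  assumes "\<omega> \<in> topspace (char_space A)" "\<omega>' \<in> topspace (char_space A)"
    and "\<And>a. a \<in> carrier A \<Longrightarrow> \<omega> (ab_class A a) = \<omega>' (ab_class A a)"
  shows "\<omega> = \<omega>'"
proof (rule extensionalityI[of _ "carrier (abelianization A)"])
  show "\<omega> S = \<omega>' S" if "S \<in> carrier (abelianization A)" for S
    using that assms(3) by (auto simp: carrier_abelianization)
qed (use assms in \<open>auto simp: topspace_char_space\<close>)

text \<open>A character kills the commutator ideal, so its value at a coset can be read off any
  chosen representative. This is the converse of \<open>character_pullback\<close>.\<close>

lemma character_descends:
  assumes \<theta>: "\<theta> \<in> star_hom A complex_cstar"
  shows "\<exists>\<omega>\<in>topspace (char_space A). \<forall>a\<in>carrier A. \<omega> (ab_class A a) = \<theta> a"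
proof -
  define \<omega> where "\<omega> = (\<lambda>S\<in>carrier (abelianization A). \<theta> (SOME x. x \<in> S))"
  have \<omega>: "\<omega> (ab_class A a) = \<theta> a" if a: "a \<in> carrier A" for a
  proof -
    define x where "x = (SOME x. x \<in> ab_class A a)"
    have "x \<in> ab_class A a" unfolding x_def by (rule someI[of _ a]) (rule ab_class_self[OF a])
    then have x: "x \<in> carrier A" "x \<ominus> a \<in> commutator_ideal A" using ab_class_mem_iff[OF a] by auto
    then have "\<theta> (x \<ominus> a) = 0"
      using commutator_ideal_subset_kernel[OF \<theta>] by (auto simp: character_kernel_def)
    then have "\<theta> x = \<theta> a" using star_hom_diff[OF \<theta> x(1) a] by simp
    then show ?thesis using ab_class_closed[OF a] by (simp add: \<omega>_def x_def)
  qed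
  have "\<omega> \<in> star_hom (abelianization A) complex_cstar"
    unfolding star_hom_complex_iff carrier_abelianization
    using star_homD[OF \<theta>]
    by (auto simp: ab_class_add ab_class_mult ab_class_smult ab_class_adj ab_class_one \<omega> adj_closed)
  moreover have "\<omega> \<in> extensional (carrier (abelianization A))" by (simp add: \<omega>_def)
  ultimately have "\<omega> \<in> topspace (char_space A)" by (simp add: topspace_char_space)
  with \<omega> show ?thesis by blast
qed

lemma continuous_map_char_space_eval:
  assumes "a \<in> carrier A"
  shows "continuous_map (char_space A) euclidean (\<lambda>\<omega>. \<omega> (ab_class A a))"
  unfolding char_space_def spectrum_def
  by (intro continuous_map_from_subtopology continuous_map_product_projection ab_class_closed assms)

lemma ab_map_closed:
  assumes "a \<in> carrier A" shows "ab_map A a \<in> carrier (cont_algebra (char_space A))"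
proof -
  have "continuous_map (char_space A) euclidean (ab_map A a)"
    by (rule continuous_map_eq[OF continuous_map_char_space_eval[OF assms]]) (simp add: ab_map_def)
  then show ?thesis by (simp add: cont_algebra_def ab_map_def)
qed

end

text \<open>Testing the duality on the functions \<open>ab_map A a\<close>, which evaluate
  characters at \<open>a\<close>, turns \<open>bhat\<close> into precomposition with
  \<open>h\<close>.\<close>

lemma gelfand_dual_ab_map:
  assumes dual: "gelfand_dual (char_space A) (char_space B) b bhat"
    and b: "\<forall>a\<in>carrier A. b (ab_map A a) = ab_map B (h a)"
    and A: "cstar_algebra A" and \<omega>: "\<omega> \<in> topspace (char_space B)" and a: "a \<in> carrier A"
  shows "bhat \<omega> \<in> topspace (char_space A)" and "bhat \<omega> (ab_class A a) = \<omega> (ab_class B (h a))"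
proof -
  interpret A: cstar_algebra A by (rule A)
  show mem: "bhat \<omega> \<in> topspace (char_space A)"
    using dual \<omega> unfolding gelfand_dual_def continuous_map_def by blast
  have "b (ab_map A a) \<omega> = ab_map A a (bhat \<omega>)"
    using dual \<omega> A.ab_map_closed[OF a] unfolding gelfand_dual_def by blast
  then show "bhat \<omega> (ab_class A a) = \<omega> (ab_class B (h a))"
    using b a mem \<omega> by (simp add: ab_map_def)
qed

section \<open>Characters of the Hopf algebra of matrix coefficients\<close>

context cstar_algebra
begin

lemma submodule_carrier: "submodule (carrier A) (ring_of_type_algebra :: complex ring) A"
  using is_ring by (intro submoduleI) (auto intro: ring.ring_simprules)

lemma submodule_smult:
  assumes "submodule V (ring_of_type_algebra :: complex ring) A" "x \<in> V" shows "c \<odot> x \<in> V"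
  using submodule.smult_closed[OF assms(1), of c x] assms(2) by simp

lemma
  assumes S: "S \<subseteq> carrier A"
  shows lin_span_subset_carrier: "lin_span A S \<subseteq> carrier A"
    and lin_span_superset: "S \<subseteq> lin_span A S"
    and lin_span_zero: "\<zero> \<in> lin_span A S"
    and lin_span_add: "\<lbrakk>x \<in> lin_span A S; y \<in> lin_span A S\<rbrakk> \<Longrightarrow> x \<oplus> y \<in> lin_span A S"
    and lin_span_smult: "x \<in> lin_span A S \<Longrightarrow> c \<odot> x \<in> lin_span A S"
proof -
  show "lin_span A S \<subseteq> carrier A" unfolding lin_span_def using submodule_carrier S by blast
  show "S \<subseteq> lin_span A S" unfolding lin_span_def by blast
  show "\<zero> \<in> lin_span A S"
    unfolding lin_span_def
  proof (rule InterI)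
    fix V assume "V \<in> {V. submodule V (ring_of_type_algebra :: complex ring) A \<and> S \<subseteq> V}"
    then have V: "submodule V (ring_of_type_algebra :: complex ring) A" by simp
    then show "\<zero> \<in> V" using subgroup.one_closed[OF submodule.axioms(1)[OF V]] by simp
  qed
  show "x \<oplus> y \<in> lin_span A S" if "x \<in> lin_span A S" "y \<in> lin_span A S"
    using that submoduleE(5) unfolding lin_span_def by blast
  show "c \<odot> x \<in> lin_span A S" if "x \<in> lin_span A S"
    using that submodule_smult unfolding lin_span_def by blast
qed

lemma lin_span_induct [consumes 2, case_names zero base add smult]:
  assumes S: "S \<subseteq> carrier A" and x: "x \<in> lin_span A S"
    and P: "P \<zero>" "\<And>s. s \<in> S \<Longrightarrow> P s"
      "\<And>x y. \<lbrakk>x \<in> lin_span A S; y \<in> lin_span A S; P x; P y\<rbrakk> \<Longrightarrow> P (x \<oplus> y)"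
      "\<And>c x. \<lbrakk>x \<in> lin_span A S; P x\<rbrakk> \<Longrightarrow> P (c \<odot> x)"
  shows "P x"
proof -
  let ?V = "{x \<in> lin_span A S. P x}"
  have "submodule ?V (ring_of_type_algebra :: complex ring) A"
  proof (rule submoduleI)
    show "?V \<subseteq> carrier A" using lin_span_subset_carrier[OF S] by blast
    show "\<ominus> a \<in> ?V" if "a \<in> ?V" for a
      using that lin_span_subset_carrier[OF S] lin_span_smult[OF S, of a "-1"] P(4)[of a "-1"]
      by (simp add: scale_minus_one[symmetric] subset_iff)
  qed (use lin_span_zero[OF S] lin_span_add[OF S] lin_span_smult[OF S] P in auto)
  moreover have "S \<subseteq> ?V" using lin_span_superset[OF S] P(2) by blast
  ultimately have "lin_span A S \<subseteq> ?V" unfolding lin_span_def by blast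
  with x show ?thesis by blast
qed

end

context cstar_pair
begin

lemma tensor_of_mult:
  assumes x: "x \<in> formal" and y: "y \<in> formal"
    and c: "tensor_of A B x \<otimes>\<^bsub>min_tensor A B\<^esub> tensor_of A B y \<in> carrier (min_tensor A B)"
  shows "tensor_of A B x \<otimes>\<^bsub>min_tensor A B\<^esub> tensor_of A B y = tensor_of A B (fmult x y)"
proof (rule tensor_of_eqI[OF c])
  show "(\<lambda>n. fmult x y) \<in> tensor_of A B x \<otimes>\<^bsub>min_tensor A B\<^esub> tensor_of A B y"
    unfolding min_tensor_simps
    using const_in_tensor_of[OF x] const_in_tensor_of[OF y]
      class_self[OF const_cauchy[OF fmult_closed[OF x y]]] by blast
qed

lemma tensor_of_adj:
  assumes x: "x \<in> formal"
    and c: "adj (min_tensor A B) (tensor_of A B x) \<in> carrier (min_tensor A B)"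
  shows "adj (min_tensor A B) (tensor_of A B x) = tensor_of A B (fadj x)"
proof (rule tensor_of_eqI[OF c])
  show "(\<lambda>n. fadj x) \<in> adj (min_tensor A B) (tensor_of A B x)"
    unfolding min_tensor_simps
    using const_in_tensor_of[OF x] class_self[OF const_cauchy[OF fadj_closed[OF x]]] by blast
qed

end

lemma pol_simps [simp]:
  "carrier (pol G) = coeffs G" "\<one>\<^bsub>pol G\<^esub> = \<one>\<^bsub>G\<^esub>" "\<zero>\<^bsub>pol G\<^esub> = \<zero>\<^bsub>G\<^esub>"
  "x \<oplus>\<^bsub>pol G\<^esub> y = x \<oplus>\<^bsub>G\<^esub> y" "x \<otimes>\<^bsub>pol G\<^esub> y = x \<otimes>\<^bsub>G\<^esub> y" "c \<odot>\<^bsub>pol G\<^esub> x = c \<odot>\<^bsub>G\<^esub> x"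
  "adj (pol G) x = adj G x"
  by (simp_all add: pol_def)

definition matrix_coeffs :: "('a, 'm) cbialg_scheme \<Rightarrow> 'a set" where
  "matrix_coeffs A = {u i j | u i j n. unitary_rep A n u \<and> i < n \<and> j < n}"

lemma coeffs_eq: "coeffs A = lin_span A (matrix_coeffs A)"
  by (simp add: coeffs_def matrix_coeffs_def)

text \<open>The entry at \<open>i\<close>, \<open>l\<close> of the triple product of
  \<open>N\<close>, \<open>M\<close> and \<open>R\<close> is computed in both bracketings. This
  takes row \<open>i\<close> of the left inverse identity and column \<open>l\<close> of the right
  one.\<close>

lemma matrix_inverse_unique:
  fixes M :: "'i \<Rightarrow> 'i \<Rightarrow> 'c :: comm_ring_1"
  assumes S: "finite S" and i: "i \<in> S" and l: "l \<in> S"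
    and left: "\<And>j. j \<in> S \<Longrightarrow> (\<Sum>k\<in>S. N i k * M k j) = (if i = j then 1 else 0)"
    and right: "\<And>k. k \<in> S \<Longrightarrow> (\<Sum>j\<in>S. M k j * R j l) = (if k = l then 1 else 0)"
  shows "N i l = R i l"
proof -
  have "(\<Sum>k\<in>S. \<Sum>j\<in>S. N i k * (M k j * R j l)) = (\<Sum>k\<in>S. if k = l then N i k else 0)"
    by (intro sum.cong refl) (simp add: sum_distrib_left[symmetric] right)
  then have 1: "(\<Sum>k\<in>S. \<Sum>j\<in>S. N i k * (M k j * R j l)) = N i l" using S l by simp
  have "(\<Sum>j\<in>S. \<Sum>k\<in>S. N i k * M k j * R j l) = (\<Sum>j\<in>S. if i = j then R j l else 0)"
    by (intro sum.cong refl) (simp add: sum_distrib_right[symmetric] left)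
  then have 2: "(\<Sum>j\<in>S. \<Sum>k\<in>S. N i k * M k j * R j l) = R i l" using S i by simp
  show ?thesis using 1 2 sum.swap[of "\<lambda>k j. N i k * M k j * R j l" S S] by (simp add: mult.assoc)
qed

section \<open>Characters on matrix coefficients, and composition with the antipode\<close>

context compact_quantum_group
begin

sublocale GG: cstar_pair G G
  by (intro cstar_pair.intro cstar_algebra_axioms)

lemma matrix_coeffs_subset: "matrix_coeffs G \<subseteq> carrier G"
  by (auto simp: matrix_coeffs_def unitary_rep_def)

lemma coeffs_carrier: "a \<in> coeffs G \<Longrightarrow> a \<in> carrier G"
  using lin_span_subset_carrier[OF matrix_coeffs_subset] by (auto simp: coeffs_eq)

lemma coeffs_zero: "\<zero> \<in> coeffs G"
  and coeffs_add: "\<lbrakk>a \<in> coeffs G; b \<in> coeffs G\<rbrakk> \<Longrightarrow> a \<oplus> b \<in> coeffs G"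
  and coeffs_smult: "a \<in> coeffs G \<Longrightarrow> c \<odot> a \<in> coeffs G"
  using lin_span_zero[OF matrix_coeffs_subset] lin_span_add[OF matrix_coeffs_subset]
    lin_span_smult[OF matrix_coeffs_subset] by (auto simp: coeffs_eq)

lemma coeffs_induct [consumes 1, case_names zero coeff add smult]:
  assumes a: "a \<in> coeffs G"
    and P: "P \<zero>" "\<And>n u i j. \<lbrakk>unitary_rep G n u; i < n; j < n\<rbrakk> \<Longrightarrow> P (u i j)"
      "\<And>a b. \<lbrakk>a \<in> coeffs G; b \<in> coeffs G; P a; P b\<rbrakk> \<Longrightarrow> P (a \<oplus> b)"
      "\<And>c a. \<lbrakk>a \<in> coeffs G; P a\<rbrakk> \<Longrightarrow> P (c \<odot> a)"
  shows "P a"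
proof (rule lin_span_induct[OF matrix_coeffs_subset a[unfolded coeffs_eq]])
  show "P s" if "s \<in> matrix_coeffs G" for s
    using that P(2) unfolding matrix_coeffs_def by blast
qed (use P in \<open>simp_all add: coeffs_eq[symmetric]\<close>)

lemma unitary_rep_coeffs:
  assumes "unitary_rep G n u" "i < n" "j < n" shows "u i j \<in> coeffs G"
proof -
  have "u i j \<in> matrix_coeffs G" using assms unfolding matrix_coeffs_def by blast
  then show ?thesis using lin_span_superset[OF matrix_coeffs_subset] by (auto simp: coeffs_eq)
qed

definition linear_functional :: "('a \<Rightarrow> complex) \<Rightarrow> bool" where
  "linear_functional f \<longleftrightarrow> (\<forall>a\<in>coeffs G. \<forall>b\<in>coeffs G. f (a \<oplus> b) = f a + f b) \<and>
     (\<forall>c. \<forall>a\<in>coeffs G. f (c \<odot> a) = c * f a)"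

lemma linear_functionalD:
  assumes "linear_functional f"
  shows linear_functional_add: "\<lbrakk>a \<in> coeffs G; b \<in> coeffs G\<rbrakk> \<Longrightarrow> f (a \<oplus> b) = f a + f b"
    and linear_functional_smult: "a \<in> coeffs G \<Longrightarrow> f (c \<odot> a) = c * f a"
  using assms by (auto simp: linear_functional_def)

lemma linear_functional_zero:
  assumes f: "linear_functional f" shows "f \<zero> = 0"
  using linear_functional_smult[OF f coeffs_zero, of 0] coeffs_carrier[OF coeffs_zero] by simp

lemma star_hom_linear_functional:
  "f \<in> star_hom (pol G) complex_cstar \<Longrightarrow> linear_functional f"
  unfolding star_hom_complex_iff linear_functional_def by simp

lemma linear_functional_list_sum:
  assumes f: "linear_functional f" and "\<And>x. x \<in> set xs \<Longrightarrow> g x \<in> coeffs G"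
  shows "list_sum G g xs \<in> coeffs G \<and> f (list_sum G g xs) = (\<Sum>x\<leftarrow>xs. f (g x))"
  using assms(2)
  by (induction xs)
     (auto simp: list_sum_def coeffs_zero coeffs_add linear_functional_zero[OF f]
        linear_functional_add[OF f])

lemma linear_functional_finsum:
  assumes f: "linear_functional f" and S: "finite S" and g: "\<And>x. x \<in> S \<Longrightarrow> g x \<in> coeffs G"
  shows "finsum G g S \<in> coeffs G \<and> f (finsum G g S) = (\<Sum>x\<in>S. f (g x))"
  using S g
proof (induction S rule: finite_induct)
  case empty
  then show ?case by (simp add: coeffs_zero linear_functional_zero[OF f])
next
  case (insert x S)
  have "finsum G g (insert x S) = g x \<oplus> finsum G g S"
    using insert coeffs_carrier by (intro abelian_monoid.finsum_insert[OF is_abelian_monoid]) auto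
  then show ?case using insert by (simp add: coeffs_add linear_functional_add[OF f])
qed

lemma unitary_matrix:
  assumes f: "f \<in> star_hom (pol G) complex_cstar" and u: "unitary_rep G n u"
    and i: "i < n" and j: "j < n"
  shows "(\<Sum>k<n. cnj (f (u k i)) * f (u k j)) = (if i = j then 1 else 0)"
    and "(\<Sum>k<n. f (u i k) * cnj (f (u j k))) = (if i = j then 1 else 0)"
proof -
  note lin = star_hom_linear_functional[OF f]
  have c: "u k l \<in> coeffs G" if "k < n" "l < n" for k l using unitary_rep_coeffs[OF u that] .
  note h = star_hom_mult[OF f, simplified] star_hom_adj[OF f, simplified] star_hom_one[OF f, simplified]
  have d: "f (if i = j then \<one> else \<zero>) = (if i = j then 1 else 0)"
    using h(3) linear_functional_zero[OF lin] by simp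
  have "(\<Oplus>k\<in>{..<n}. adj G (u k i) \<otimes> u k j) = (if i = j then \<one> else \<zero>)"
    "(\<Oplus>k\<in>{..<n}. u i k \<otimes> adj G (u j k)) = (if i = j then \<one> else \<zero>)"
    using u i j by (auto simp: unitary_rep_def)
  moreover have "f (\<Oplus>k\<in>{..<n}. adj G (u k i) \<otimes> u k j) = (\<Sum>k<n. cnj (f (u k i)) * f (u k j))"
    using linear_functional_finsum[OF lin, of "{..<n}" "\<lambda>k. adj G (u k i) \<otimes> u k j"] c i j
    by (simp add: pol_mult pol_adj h)
  moreover have "f (\<Oplus>k\<in>{..<n}. u i k \<otimes> adj G (u j k)) = (\<Sum>k<n. f (u i k) * cnj (f (u j k)))"
    using linear_functional_finsum[OF lin, of "{..<n}" "\<lambda>k. u i k \<otimes> adj G (u j k)"] c i j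
    by (simp add: pol_mult pol_adj h)
  ultimately show "(\<Sum>k<n. cnj (f (u k i)) * f (u k j)) = (if i = j then 1 else 0)"
    "(\<Sum>k<n. f (u i k) * cnj (f (u j k))) = (if i = j then 1 else 0)" using d by simp_all
qed

text \<open>An idempotent unitary matrix is the identity.\<close>

lemma idempotent_coeff:
  assumes f: "f \<in> star_hom (pol G) complex_cstar" and u: "unitary_rep G n u"
    and idem: "\<And>i j. \<lbrakk>i < n; j < n\<rbrakk> \<Longrightarrow> (\<Sum>k<n. f (u i k) * f (u k j)) = f (u i j)"
    and i: "i < n" and j: "j < n"
  shows "f (u i j) = (if i = j then 1 else 0)"
proof -
  let ?F = "\<lambda>i j. f (u i j)"
  \<comment> \<open>The equation F F = F is multiplied on the right by the adjoint of F, which is an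
    inverse by unitarity.\<close>
  have "(\<Sum>l<n. (\<Sum>k<n. ?F i k * ?F k l) * cnj (?F j l)) = (\<Sum>l<n. ?F i l * cnj (?F j l))"
    using idem i by (intro sum.cong) auto
  also have "\<dots> = (if i = j then 1 else 0)" by (rule unitary_matrix(2)[OF f u i j])
  also have "(\<Sum>l<n. (\<Sum>k<n. ?F i k * ?F k l) * cnj (?F j l)) =
      (\<Sum>k<n. ?F i k * (\<Sum>l<n. ?F k l * cnj (?F j l)))"
    unfolding sum_distrib_right sum_distrib_left by (subst sum.swap) (simp add: mult.assoc)
  also have "\<dots> = (\<Sum>k<n. if k = j then ?F i k else 0)"
    by (intro sum.cong refl) (simp add: unitary_matrix(2)[OF f u _ j])
  also have "\<dots> = ?F i j" using j by simp
  finally show ?thesis .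
qed

lemma comult_rep:
  assumes "unitary_rep G n u" "i < n" "j < n"
  shows "comult G (u i j) = tensor_of G G (map (\<lambda>k. (u i k, u k j)) [0..<n])"
    and "map (\<lambda>k. (u i k, u k j)) [0..<n] \<in> lists (coeffs G \<times> coeffs G)"
  using assms unitary_rep_coeffs[OF assms(1)] by (auto simp: unitary_rep_def)

text \<open>Applying the counit to the left counit law shows that its matrix on \<open>u\<close> is
  idempotent, and a unitary idempotent is the identity.\<close>

lemma counit_coeff:
  assumes u: "unitary_rep G n u" and i: "i < n" and j: "j < n"
  shows "counit G (u i j) = (if i = j then 1 else 0)"
proof (rule idempotent_coeff[OF counit_hom u _ i j])
  fix i j assume i: "i < n" and j: "j < n"
  note lin = star_hom_linear_functional[OF counit_hom]
  have c: "u k l \<in> coeffs G" if "k < n" "l < n" for k l using unitary_rep_coeffs[OF u that] .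
  let ?x = "map (\<lambda>k. (u i k, u k j)) [0..<n]"
  have "counit G (list_sum G (\<lambda>(b, c). counit G b \<odot> c) ?x) =
      (\<Sum>p\<leftarrow>?x. counit G ((\<lambda>(b, c). counit G b \<odot> c) p))"
    by (rule linear_functional_list_sum[OF lin, THEN conjunct2]) (use c i j in \<open>auto intro!: coeffs_smult\<close>)
  also have "\<dots> = (\<Sum>k\<leftarrow>[0..<n]. counit G (u i k) * counit G (u k j))"
    unfolding map_map
    by (intro arg_cong[of _ _ sum_list] map_cong) (use c i j linear_functional_smult[OF lin] in auto)
  finally show "(\<Sum>k<n. counit G (u i k) * counit G (u k j)) = counit G (u i j)"
    using counit_left[OF c[OF i j] comult_rep(2)[OF u i j] comult_rep(1)[OF u i j]]
    by (simp add: interv_sum_list_conv_sum_set_nat atLeast0LessThan)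
qed

lemma coeffs_formal: "x \<in> lists (coeffs G \<times> coeffs G) \<Longrightarrow> x \<in> lists (carrier G \<times> carrier G)"
  by (auto dest: coeffs_carrier)

lemma comult_mult:
  assumes a: "a \<in> coeffs G" and x: "x \<in> lists (coeffs G \<times> coeffs G)" "comult G a = tensor_of G G x"
    and b: "b \<in> coeffs G" and y: "y \<in> lists (coeffs G \<times> coeffs G)" "comult G b = tensor_of G G y"
  shows "comult G (a \<otimes> b) = tensor_of G G (formal_mult G G x y)"
proof -
  note ab = coeffs_carrier[OF a] coeffs_carrier[OF b]
  have eq: "comult G (a \<otimes> b) = comult G a \<otimes>\<^bsub>min_tensor G G\<^esub> comult G b"
    by (rule star_hom_mult[OF comult_hom ab])
  moreover have "comult G (a \<otimes> b) \<in> carrier (min_tensor G G)"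
    by (rule star_hom_closed[OF comult_hom]) (use ab in simp)
  ultimately show ?thesis
    using GG.tensor_of_mult[OF coeffs_formal[OF x(1)] coeffs_formal[OF y(1)]] x(2) y(2) by simp
qed

lemma comult_adj:
  assumes a: "a \<in> coeffs G" and x: "x \<in> lists (coeffs G \<times> coeffs G)" "comult G a = tensor_of G G x"
  shows "comult G (adj G a) = tensor_of G G (formal_adj G G x)"
proof -
  note ac = coeffs_carrier[OF a]
  have "comult G (adj G a) = adj (min_tensor G G) (comult G a)"
    by (rule star_hom_adj[OF comult_hom ac])
  moreover have "comult G (adj G a) \<in> carrier (min_tensor G G)"
    by (rule star_hom_closed[OF comult_hom adj_closed[OF ac]])
  ultimately show ?thesis
    using GG.tensor_of_adj[OF coeffs_formal[OF x(1)]] x(2) by simp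
qed

text \<open>Composing a character with the antipode inverts its matrices. Applied to the coefficients of
  \<open>u\<close>, of \<open>u \<otimes> v\<close> and of the conjugate of \<open>u\<close>, this shows that the composite is a
  $*$-homomorphism, without any appeal to antimultiplicativity of the antipode.\<close>

lemma antipode_character:
  assumes f: "f \<in> star_hom (pol G) complex_cstar" and L: "distinct L"
    and w: "\<And>i j. \<lbrakk>i \<in> set L; j \<in> set L\<rbrakk> \<Longrightarrow> w i j \<in> coeffs G \<and>
        comult G (w i j) = tensor_of G G (map (\<lambda>k. (w i k, w k j)) L) \<and>
        counit G (w i j) = (if i = j then 1 else 0)"
    and right: "\<And>i j. \<lbrakk>i \<in> set L; j \<in> set L\<rbrakk> \<Longrightarrow>
        (\<Sum>k\<in>set L. f (w i k) * R k j) = (if i = j then 1 else 0)"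
    and i: "i \<in> set L" and j: "j \<in> set L"
  shows "f (antipode G (w i j)) = R i j"
\<comment> \<open>\<open>R\<close> is a right inverse of the matrix of \<open>f\<close> by
  assumption; the antipode law supplies a left inverse.\<close>
proof (rule matrix_inverse_unique[where S="set L" and N="\<lambda>i j. f (antipode G (w i j))" and M="\<lambda>i j. f (w i j)"])
  show "(\<Sum>k\<in>set L. f (w k' k) * R k j) = (if k' = j then 1 else 0)" if "k' \<in> set L" for k'
    by (rule right[OF that j])
  fix j assume j: "j \<in> set L"
  note lin = star_hom_linear_functional[OF f]
  let ?x = "map (\<lambda>k. (w i k, w k j)) L"
  have x: "?x \<in> lists (coeffs G \<times> coeffs G)" using w i j by auto
  have "f (list_sum G (\<lambda>(b, c). antipode G b \<otimes> c) ?x) =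
      (\<Sum>p\<leftarrow>?x. f ((\<lambda>(b, c). antipode G b \<otimes> c) p))"
    by (rule linear_functional_list_sum[OF lin, THEN conjunct2])
       (use w i j in \<open>auto intro!: pol_mult antipode_closed\<close>)
  also have "\<dots> = (\<Sum>k\<leftarrow>L. f (antipode G (w i k)) * f (w k j))"
    unfolding map_map
    by (intro arg_cong[of _ _ sum_list] map_cong)
       (use w i j antipode_closed star_hom_mult[OF f, simplified] in auto)
  finally have "f (list_sum G (\<lambda>(b, c). antipode G b \<otimes> c) ?x) =
      (\<Sum>k\<leftarrow>L. f (antipode G (w i k)) * f (w k j))" .
  moreover have "f (list_sum G (\<lambda>(b, c). antipode G b \<otimes> c) ?x) = counit G (w i j)"
    unfolding antipode_left[OF w[OF i j, THEN conjunct1] x w[OF i j, THEN conjunct2, THEN conjunct1]]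
    using linear_functional_smult[OF lin pol_one] star_hom_one[OF f] by simp
  ultimately show "(\<Sum>k\<in>set L. f (antipode G (w i k)) * f (w k j)) = (if i = j then 1 else 0)"
    using w[OF i j] L by (simp add: sum_list_distinct_conv_sum_set)
qed (use i j in auto)

text \<open>Here the inverse matrix is the adjoint, by unitarity of the matrix of
  \<open>f\<close>.\<close>

lemma antipode_coeff:
  assumes f: "f \<in> star_hom (pol G) complex_cstar" and u: "unitary_rep G n u"
    and i: "i < n" and j: "j < n"
  shows "f (antipode G (u i j)) = cnj (f (u j i))"
  by (rule antipode_character[OF f, where L="[0..<n]"])
     (use u i j unitary_rep_coeffs[OF u] comult_rep[OF u] counit_coeff[OF u] unitary_matrix(2)[OF f u]
       in \<open>auto simp: atLeast0LessThan\<close>)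

text \<open>The entrywise adjoint of \<open>u\<close> need not be unitary over \<open>G\<close>, but
  its image under \<open>f\<close> is the complex conjugate of a unitary scalar matrix, with the
  transpose of that matrix as inverse.\<close>

lemma antipode_coeff_adj:
  assumes f: "f \<in> star_hom (pol G) complex_cstar" and u: "unitary_rep G n u"
    and i: "i < n" and j: "j < n"
  shows "f (antipode G (adj G (u i j))) = f (u j i)"
proof (rule antipode_character[OF f, where L="[0..<n]" and w="\<lambda>i j. adj G (u i j)"])
  fix i j assume "i \<in> set [0..<n]" "j \<in> set [0..<n]"
  then have ij: "i < n" "j < n" by auto
  have c: "u i j \<in> coeffs G" by (rule unitary_rep_coeffs[OF u ij])
  show "adj G (u i j) \<in> coeffs G \<and>
      comult G (adj G (u i j)) = tensor_of G G (map (\<lambda>k. (adj G (u i k), adj G (u k j))) [0..<n]) \<and>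
      counit G (adj G (u i j)) = (if i = j then 1 else 0)"
    using comult_adj[OF c comult_rep(2,1)[OF u ij]] pol_adj[OF c] counit_coeff[OF u ij]
      star_hom_adj[OF counit_hom, simplified, OF c] by (simp add: formal_adj_def comp_def)
  have "(\<Sum>k<n. cnj (f (u i k) * cnj (f (u j k)))) = cnj (if i = j then 1 else 0)"
    using unitary_matrix(2)[OF f u ij] by (simp only: cnj_sum[symmetric])
  moreover have "f (adj G (u i k)) = cnj (f (u i k))" if "k < n" for k
    using star_hom_adj[OF f, simplified] unitary_rep_coeffs[OF u ij(1) that] by simp
  ultimately show "(\<Sum>k\<in>set [0..<n]. f (adj G (u i k)) * f (u j k)) = (if i = j then 1 else 0)"
    by (simp add: atLeast0LessThan)
qed (use i j in auto)

text \<open>Treats the products of coefficients as the matrix of the tensor product of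
  \<open>u\<close> and \<open>v\<close>, indexed by pairs; its inverse is the product of the two
  adjoints.\<close>

lemma antipode_coeff_mult:
  assumes f: "f \<in> star_hom (pol G) complex_cstar"
    and u: "unitary_rep G n u" and i: "i < n" and j: "j < n"
    and v: "unitary_rep G m v" and k: "k < m" and l: "l < m"
  shows "f (antipode G (u i j \<otimes> v k l)) = cnj (f (u j i)) * cnj (f (v l k))"
proof -
  let ?L = "List.product [0..<n] [0..<m]"
  let ?w = "\<lambda>(i, k) (j, l). u i j \<otimes> v k l"
  let ?R = "\<lambda>(i, k) (j, l). cnj (f (u j i)) * cnj (f (v l k))"
  have "f (antipode G (?w (i, k) (j, l))) = ?R (i, k) (j, l)"
  proof (rule antipode_character[OF f, where L="?L"])
    show "distinct ?L" by (rule distinct_product) auto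
    fix p q assume "p \<in> set ?L" "q \<in> set ?L"
    then obtain i k j l where p: "p = (i, k)" "i < n" "k < m" and q: "q = (j, l)" "j < n" "l < m" by auto
    have c: "u i j \<in> coeffs G" "v k l \<in> coeffs G"
      using unitary_rep_coeffs[OF u] unitary_rep_coeffs[OF v] p q by auto
    \<comment> \<open>\<open>List.product\<close> enumerates pairs in the order in which
      \<open>formal_mult\<close> multiplies out two lists, so the two descriptions of the coproduct
      agree as lists.\<close>
    have list: "formal_mult G G (map (\<lambda>s. (u i s, u s j)) xs) (map (\<lambda>t. (v k t, v t l)) [0..<m]) =
        map (\<lambda>r. (?w p r, ?w r q)) (List.product xs [0..<m])" for xs
      by (induction xs) (simp_all add: formal_mult_Cons p q comp_def)
    show "?w p q \<in> coeffs G \<and> comult G (?w p q) = tensor_of G G (map (\<lambda>r. (?w p r, ?w r q)) ?L) \<and>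
        counit G (?w p q) = (if p = q then 1 else 0)"
      using comult_mult[OF c(1) comult_rep(2,1)[OF u p(2) q(2)] c(2) comult_rep(2,1)[OF v p(3) q(3)]]
        list[of "[0..<n]"] pol_mult[OF c] star_hom_mult[OF counit_hom, simplified, OF c]
        counit_coeff[OF u p(2) q(2)] counit_coeff[OF v p(3) q(3)]
      by (simp add: p q)
    have "(\<Sum>r\<in>set ?L. f (?w p r) * ?R r q) =
        (\<Sum>(s, t)\<in>{..<n} \<times> {..<m}. (f (u i s) * cnj (f (u j s))) * (f (v k t) * cnj (f (v l t))))"
    proof (rule sum.cong)
      show "set ?L = {..<n} \<times> {..<m}" by auto
      fix r assume "r \<in> {..<n} \<times> {..<m}"
      then obtain s t where r: "r = (s, t)" "s < n" "t < m" by auto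
      have "f (u i s \<otimes> v k t) = f (u i s) * f (v k t)"
        using star_hom_mult[OF f, simplified] unitary_rep_coeffs[OF u p(2) r(2)]
          unitary_rep_coeffs[OF v p(3) r(3)] by simp
      then show "f (?w p r) * ?R r q =
          (case r of (s, t) \<Rightarrow> (f (u i s) * cnj (f (u j s))) * (f (v k t) * cnj (f (v l t))))"
        by (simp add: p q r)
    qed
    also have "\<dots> = (\<Sum>s<n. f (u i s) * cnj (f (u j s))) * (\<Sum>t<m. f (v k t) * cnj (f (v l t)))"
      by (simp add: sum_product sum.cartesian_product)
    also have "\<dots> = (if p = q then 1 else 0)"
      using unitary_matrix(2)[OF f u p(2) q(2)] unitary_matrix(2)[OF f v p(3) q(3)] by (simp add: p q)
    finally show "(\<Sum>r\<in>set ?L. f (?w p r) * ?R r q) = (if p = q then 1 else 0)" .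
  qed (use i j k l in auto)
  then show ?thesis by simp
qed

lemma antipode_star_hom:
  assumes f: "f \<in> star_hom (pol G) complex_cstar"
  shows "(\<lambda>a. f (antipode G a)) \<in> star_hom (pol G) complex_cstar"
proof -
  let ?h = "\<lambda>a. f (antipode G a)"
  note f_add = star_hom_add[OF f, simplified] and f_smult = star_hom_smult[OF f, simplified]
  have add: "?h (a \<oplus> b) = ?h a + ?h b" if "a \<in> coeffs G" "b \<in> coeffs G" for a b
    using that by (simp add: antipode_add f_add antipode_closed)
  have smult: "?h (c \<odot> a) = c * ?h a" if "a \<in> coeffs G" for a c
    using that by (simp add: antipode_smult f_smult antipode_closed)
  have lin: "linear_functional ?h" using add smult by (simp add: linear_functional_def)
  note h0 = linear_functional_zero[OF lin]
  \<comment> \<open>Multiplicativity is extended by linearity in the second factor here, and in the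
    first factor below.\<close>
  have gen: "?h (u i j \<otimes> b) = ?h (u i j) * ?h b"
    if u: "unitary_rep G n u" and i: "i < n" and j: "j < n" and b: "b \<in> coeffs G" for n u i j b
    using b
  proof (induction b rule: coeffs_induct)
    case zero
    then show ?case using unitary_rep_coeffs[OF u i j] coeffs_carrier by (simp add: h0)
  next
    case (coeff m v k l)
    then show ?case
      using antipode_coeff_mult[OF f u i j] antipode_coeff[OF f u i j] antipode_coeff[OF f coeff(1)] by simp
  next
    case (add a b)
    then show ?case using unitary_rep_coeffs[OF u i j] linear_functional_add[OF lin]
      by (simp add: mult_add_right coeffs_carrier pol_mult distrib_left)
  next
    case (smult c a)
    then show ?case using unitary_rep_coeffs[OF u i j] linear_functional_smult[OF lin]
      by (simp add: smult_mult_right coeffs_carrier pol_mult)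
  qed
  have mult: "?h (a \<otimes> b) = ?h a * ?h b" if a: "a \<in> coeffs G" and b: "b \<in> coeffs G" for a b
    using a
  proof (induction a rule: coeffs_induct)
    case zero
    then show ?case using b coeffs_carrier by (simp add: h0)
  next
    case (coeff n u i j)
    then show ?case by (rule gen) (rule b)
  next
    case (add a a')
    then show ?case using b linear_functional_add[OF lin]
      by (simp add: mult_add_left coeffs_carrier pol_mult distrib_right)
  next
    case (smult c a)
    then show ?case using b linear_functional_smult[OF lin]
      by (simp add: smult_mult_left coeffs_carrier pol_mult)
  qed
  have adj: "?h (adj G a) = cnj (?h a)" if a: "a \<in> coeffs G" for a
    using a
  proof (induction a rule: coeffs_induct)
    case zero
    have "adj G \<zero> = \<zero>" using adj_smult[of \<zero> 0] coeffs_carrier[OF coeffs_zero] adj_closed by simp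
    then show ?case by (simp add: h0)
  next
    case (coeff n u i j)
    then show ?case using antipode_coeff_adj[OF f coeff] antipode_coeff[OF f coeff] by simp
  next
    case (add a b)
    then show ?case using linear_functional_add[OF lin] by (simp add: adj_add coeffs_carrier pol_adj)
  next
    case (smult c a)
    then show ?case using linear_functional_smult[OF lin] by (simp add: adj_smult coeffs_carrier pol_adj)
  qed
  \<comment> \<open>The unit is the coefficient of the trivial representation, a matrix with one
    index.\<close>
  have "f (antipode G \<one>) = 1"
  proof (rule antipode_character[OF f, where L="[()]" and w="\<lambda>_ _. \<one>" and R="\<lambda>_ _. 1", simplified])
    show "\<one> \<in> coeffs G \<and> comult G \<one> = tensor_of G G [(\<one>, \<one>)] \<and> counit G \<one> = 1"
      using pol_one star_hom_one[OF comult_hom] star_hom_one[OF counit_hom]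
      by (simp add: min_tensor_simps)
    show "f \<one> = 1" using star_hom_one[OF f] by simp
  qed
  then show ?thesis
    unfolding star_hom_complex_iff using add smult mult adj by simp
qed

end

section \<open>The group of characters\<close>

locale cqg_completion = compact_quantum_group G
  for G :: "('g, 'm) cqg_scheme" (structure) +
  fixes U :: "('a, 'n) cbialg_scheme" and \<iota> :: "'g \<Rightarrow> 'a"
  assumes completion: "universal_completion G U \<iota>"
begin

sublocale U: cstar_algebra U using completion by (simp add: universal_completion_def)

sublocale UU: cstar_pair U U by (intro cstar_pair.intro U.cstar_algebra_axioms)

lemma \<iota>_hom: "\<iota> \<in> star_hom (pol G) U"
  and dense: "norm_topology U closure_of (\<iota> ` coeffs G) = carrier U"
  and seminorm_le: "\<lbrakk>cstar_seminorm (pol G) s; a \<in> coeffs G\<rbrakk> \<Longrightarrow> s a \<le> nrm U (\<iota> a)"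
  and comult_U_hom: "comult U \<in> star_hom U (min_tensor U U)"
  and comult_\<iota>: "\<lbrakk>a \<in> coeffs G; x \<in> lists (coeffs G \<times> coeffs G); comult G a = tensor_of G G x\<rbrakk>
      \<Longrightarrow> comult U (\<iota> a) = tensor_of U U (map (map_prod \<iota> \<iota>) x)"
  using completion by (auto simp: universal_completion_def)

lemmas \<iota>_laws = star_hom_closed[OF \<iota>_hom, simplified] star_hom_add[OF \<iota>_hom, simplified]
  star_hom_mult[OF \<iota>_hom, simplified] star_hom_smult[OF \<iota>_hom, simplified]
  star_hom_adj[OF \<iota>_hom, simplified] star_hom_one[OF \<iota>_hom, simplified]

lemma \<iota>_closed: "a \<in> coeffs G \<Longrightarrow> \<iota> a \<in> carrier U"
  by (rule \<iota>_laws(1))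

lemma character_eqI_matrix_coeffs:
  assumes \<theta>: "\<theta> \<in> star_hom U complex_cstar" "\<theta>' \<in> star_hom U complex_cstar"
    and eq: "\<And>n u i j. \<lbrakk>unitary_rep G n u; i < n; j < n\<rbrakk> \<Longrightarrow> \<theta> (\<iota> (u i j)) = \<theta>' (\<iota> (u i j))"
    and x: "x \<in> carrier U"
  shows "\<theta> x = \<theta>' x"
proof (rule U.character_eqI[OF dense _ \<theta> _ x])
  show "\<iota> ` coeffs G \<subseteq> carrier U" using \<iota>_closed by blast
  note lin = star_hom_comp[OF \<iota>_hom \<theta>(1), THEN star_hom_linear_functional]
    star_hom_comp[OF \<iota>_hom \<theta>(2), THEN star_hom_linear_functional]
  fix y assume "y \<in> \<iota> ` coeffs G"
  then obtain a where a: "a \<in> coeffs G" "y = \<iota> a" by blast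
  have "\<theta> (\<iota> a) = \<theta>' (\<iota> a)"
    using a(1)
  proof (induction a rule: coeffs_induct)
    case zero show ?case using linear_functional_zero[OF lin(1)] linear_functional_zero[OF lin(2)] by simp
  next
    case (coeff n u i j) then show ?case by (rule eq)
  next
    case (add a b) then show ?case
      using linear_functional_add[OF lin(1)] linear_functional_add[OF lin(2)] by simp
  next
    case (smult c a) then show ?case
      using linear_functional_smult[OF lin(1)] linear_functional_smult[OF lin(2)] by simp
  qed
  then show "\<theta> y = \<theta>' y" using a by simp
qed

text \<open>The modulus of \<open>h\<close> is a C*-seminorm on \<open>pol G\<close>, so maximality
  of the universal norm bounds it.\<close>

lemma character_diff_le_pol:
  assumes h: "h \<in> star_hom (pol G) complex_cstar" and a: "a \<in> coeffs G" and b: "b \<in> coeffs G"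
  shows "cmod (h a - h b) \<le> cdist U (\<iota> a) (\<iota> b)"
proof -
  note hl = star_hom_add[OF h, simplified] star_hom_mult[OF h, simplified]
    star_hom_smult[OF h, simplified] star_hom_adj[OF h, simplified]
  have "cstar_seminorm (pol G) (\<lambda>a. cmod (h a))"
    unfolding cstar_seminorm_def using pol_adj
    by (simp add: hl norm_mult norm_triangle_ineq power2_eq_square)
  then have le: "cmod (h (a \<oplus> (-1) \<odot> b)) \<le> nrm U (\<iota> (a \<oplus> (-1) \<odot> b))"
    by (rule seminorm_le) (intro coeffs_add coeffs_smult a b)
  have "h (a \<oplus> (-1) \<odot> b) = h a - h b" using a b by (simp add: hl coeffs_smult)
  moreover have "\<iota> (a \<oplus> (-1) \<odot> b) = \<iota> a \<ominus>\<^bsub>U\<^esub> \<iota> b"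
    using a b by (simp add: \<iota>_laws coeffs_smult U.diff_eq_scale)
  ultimately show ?thesis using le a b by (simp add: cdist_def \<iota>_closed)
qed

text \<open>Extension by continuity, along sequences in \<open>coeffs G\<close> whose images under
  \<open>\<iota>\<close> converge. That \<open>h a\<close> depends only on \<open>\<iota> a\<close>
  is contained in \<open>character_diff_le_pol\<close>.\<close>

lemma character_extension:
  assumes h: "h \<in> star_hom (pol G) complex_cstar"
  shows "\<exists>\<theta>\<in>star_hom U complex_cstar. \<forall>a\<in>coeffs G. \<theta> (\<iota> a) = h a"
proof -
  define approx where "approx x s \<longleftrightarrow> (\<forall>n. s n \<in> coeffs G) \<and> (\<lambda>n. cdist U x (\<iota> (s n))) \<longlonglongrightarrow> 0"
    for x and s :: "nat \<Rightarrow> 'g"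
  have ex: "\<exists>s. approx x s" if x: "x \<in> carrier U" for x
  proof -
    have "\<exists>a\<in>coeffs G. cdist U x (\<iota> a) < 1 / real (Suc n)" for n
      using U.dense_approx[OF dense _ x, of "1 / real (Suc n)"] \<iota>_closed by auto
    then obtain s where s: "\<And>n. s n \<in> coeffs G" "\<And>n. cdist U x (\<iota> (s n)) < 1 / real (Suc n)" by metis
    have "(\<lambda>n. cdist U x (\<iota> (s n))) \<longlonglongrightarrow> 0"
    proof (rule real_tendsto_sandwich[OF _ _ tendsto_const LIMSEQ_Suc[OF lim_1_over_n]])
      show "\<forall>\<^sub>F n in sequentially. cdist U x (\<iota> (s n)) \<le> 1 / real (Suc n)"
        using s(2) by (intro always_eventually allI less_imp_le)
    qed simp
    then show ?thesis using s(1) by (auto simp: approx_def)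
  qed
  \<comment> \<open>One estimate serves twice: along a single sequence it gives the Cauchy property,
    and for two sequences it shows that the limit does not depend on the choice.\<close>
  have close: "cmod (h a - h b) \<le> cdist U x (\<iota> a) + cdist U x (\<iota> b)"
    if "x \<in> carrier U" "a \<in> coeffs G" "b \<in> coeffs G" for x a b
    using character_diff_le_pol[OF h that(2,3)] U.triangle[of "\<iota> a" x "\<iota> b"] U.commute[of "\<iota> a" x]
      that \<iota>_closed by simp
  have conv: "\<exists>c. \<forall>s. approx x s \<longrightarrow> (\<lambda>n. h (s n)) \<longlonglongrightarrow> c" if x: "x \<in> carrier U" for x
  proof -
    obtain s where s: "approx x s" using ex[OF x] by blast
    have "Cauchy (\<lambda>n. h (s n))"
      unfolding Cauchy_def dist_norm
    proof (intro allI impI)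
      fix e :: real assume "e > 0"
      then have "\<forall>\<^sub>F n in sequentially. cdist U x (\<iota> (s n)) < e / 2"
        using s order_tendstoD(2)[of "\<lambda>n. cdist U x (\<iota> (s n))" 0 sequentially "e / 2"]
        by (simp add: approx_def)
      then obtain N where N: "\<And>n. n \<ge> N \<Longrightarrow> cdist U x (\<iota> (s n)) < e / 2"
        unfolding eventually_sequentially by blast
      show "\<exists>M. \<forall>m\<ge>M. \<forall>n\<ge>M. cmod (h (s m) - h (s n)) < e"
      proof (intro exI[of _ N] allI impI)
        fix m n assume "m \<ge> N" "n \<ge> N"
        then show "cmod (h (s m) - h (s n)) < e"
          using close[OF x, of "s m" "s n"] N[of m] N[of n] s by (simp add: approx_def)
      qed
    qed
    then obtain c where c: "(\<lambda>n. h (s n)) \<longlonglongrightarrow> c"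
      using Cauchy_convergent convergent_def by blast
    have "(\<lambda>n. h (t n)) \<longlonglongrightarrow> c" if t: "approx x t" for t
    proof -
      have "(\<lambda>n. cdist U x (\<iota> (s n)) + cdist U x (\<iota> (t n))) \<longlonglongrightarrow> 0"
        using s t tendsto_add[of "\<lambda>n. cdist U x (\<iota> (s n))" 0 _ "\<lambda>n. cdist U x (\<iota> (t n))" 0]
        by (simp add: approx_def)
      then have "(\<lambda>n. h (s n) - h (t n)) \<longlonglongrightarrow> 0"
        by (rule Lim_null_comparison[rotated])
           (use close[OF x] s t in \<open>auto simp: approx_def\<close>)
      from tendsto_diff[OF c this] show ?thesis by simp
    qed
    then show ?thesis by blast
  qed
  define \<theta> where "\<theta> x = (SOME c. \<forall>s. approx x s \<longrightarrow> (\<lambda>n. h (s n)) \<longlonglongrightarrow> c)" for x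
  have lim: "(\<lambda>n. h (s n)) \<longlonglongrightarrow> \<theta> x" if "x \<in> carrier U" "approx x s" for x s
    using someI_ex[OF conv[OF that(1)]] that(2) unfolding \<theta>_def by blast
  have eqI: "\<theta> x = c" if "x \<in> carrier U" "approx x s" "(\<lambda>n. h (s n)) \<longlonglongrightarrow> c" for x s c
    using lim[OF that(1,2)] that(3) LIMSEQ_unique by blast
  have approxI: "approx x s" if "\<And>n. s n \<in> coeffs G" "\<And>n. cdist U x (\<iota> (s n)) \<le> g n" "g \<longlonglongrightarrow> 0" for x s g
    unfolding approx_def
    using that(1,2) by (auto intro!: real_tendsto_sandwich[OF _ _ tendsto_const that(3)])
  have sc: "s n \<in> coeffs G" "\<iota> (s n) \<in> carrier U" "(\<lambda>n. cdist U x (\<iota> (s n))) \<longlonglongrightarrow> 0"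
    if "approx x s" for x s n using that \<iota>_closed by (auto simp: approx_def)
  note hl = star_hom_add[OF h, simplified] star_hom_mult[OF h, simplified]
    star_hom_smult[OF h, simplified] star_hom_adj[OF h, simplified] star_hom_one[OF h, simplified]
  have base: "\<theta> (\<iota> a) = h a" if "a \<in> coeffs G" for a
    by (rule eqI[of _ "\<lambda>n. a"]) (use that \<iota>_closed in \<open>auto simp: approx_def\<close>)
  have "\<theta> (x \<oplus>\<^bsub>U\<^esub> y) = \<theta> x + \<theta> y" if x: "x \<in> carrier U" and y: "y \<in> carrier U" for x y
  proof -
    obtain s t where st: "approx x s" "approx y t" using ex x y by blast
    note s = sc[OF st(1)] and t = sc[OF st(2)]
    have le: "cdist U (x \<oplus>\<^bsub>U\<^esub> y) (\<iota> (s n \<oplus> t n)) \<le> cdist U x (\<iota> (s n)) + cdist U y (\<iota> (t n))" for n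
    proof -
      have "(x \<oplus>\<^bsub>U\<^esub> y) \<ominus>\<^bsub>U\<^esub> (\<iota> (s n) \<oplus>\<^bsub>U\<^esub> \<iota> (t n)) = (x \<ominus>\<^bsub>U\<^esub> \<iota> (s n)) \<oplus>\<^bsub>U\<^esub> (y \<ominus>\<^bsub>U\<^esub> \<iota> (t n))"
        using x y s(2) t(2) by (rule U.add_diff_add)
      then show ?thesis
        using U.nrm_triangle[of "x \<ominus>\<^bsub>U\<^esub> \<iota> (s n)" "y \<ominus>\<^bsub>U\<^esub> \<iota> (t n)"] x y s(1,2) t(1,2)
        by (simp add: cdist_def \<iota>_laws(2))
    qed
    have "approx (x \<oplus>\<^bsub>U\<^esub> y) (\<lambda>n. s n \<oplus> t n)"
      by (rule approxI[OF _ le]) (use s t coeffs_add tendsto_add[OF s(3) t(3)] in auto)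
    moreover have "(\<lambda>n. h (s n \<oplus> t n)) \<longlonglongrightarrow> \<theta> x + \<theta> y"
      using tendsto_add[OF lim[OF x st(1)] lim[OF y st(2)]] s t by (simp add: hl)
    ultimately show ?thesis using x y by (intro eqI) auto
  qed
  moreover have "\<theta> (x \<otimes>\<^bsub>U\<^esub> y) = \<theta> x * \<theta> y" if x: "x \<in> carrier U" and y: "y \<in> carrier U" for x y
  proof -
    obtain s t where st: "approx x s" "approx y t" using ex x y by blast
    note s = sc[OF st(1)] and t = sc[OF st(2)]
    \<comment> \<open>The norm of \<open>\<iota> (t n)\<close> is bounded by that of
      \<open>y\<close> plus the error, so that the right-hand side involves only fixed norms and
      errors tending to 0.\<close>
    have le: "cdist U (x \<otimes>\<^bsub>U\<^esub> y) (\<iota> (s n \<otimes> t n)) \<le>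
        nrm U x * cdist U y (\<iota> (t n)) + cdist U x (\<iota> (s n)) * (nrm U y + cdist U y (\<iota> (t n)))" for n
    proof -
      have "(x \<otimes>\<^bsub>U\<^esub> y) \<ominus>\<^bsub>U\<^esub> (\<iota> (s n) \<otimes>\<^bsub>U\<^esub> \<iota> (t n)) =
          x \<otimes>\<^bsub>U\<^esub> (y \<ominus>\<^bsub>U\<^esub> \<iota> (t n)) \<oplus>\<^bsub>U\<^esub> (x \<ominus>\<^bsub>U\<^esub> \<iota> (s n)) \<otimes>\<^bsub>U\<^esub> \<iota> (t n)"
        using x y s(2) t(2) by (rule U.mult_diff_mult)
      moreover have "nrm U (x \<otimes>\<^bsub>U\<^esub> (y \<ominus>\<^bsub>U\<^esub> \<iota> (t n)) \<oplus>\<^bsub>U\<^esub> (x \<ominus>\<^bsub>U\<^esub> \<iota> (s n)) \<otimes>\<^bsub>U\<^esub> \<iota> (t n)) \<le>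
          nrm U x * nrm U (y \<ominus>\<^bsub>U\<^esub> \<iota> (t n)) + nrm U (x \<ominus>\<^bsub>U\<^esub> \<iota> (s n)) * nrm U (\<iota> (t n))"
        using x y s(2) t(2)
        by (intro order_trans[OF U.nrm_triangle add_mono] U.nrm_mult) auto
      moreover have "nrm U (x \<ominus>\<^bsub>U\<^esub> \<iota> (s n)) * nrm U (\<iota> (t n)) \<le>
          nrm U (x \<ominus>\<^bsub>U\<^esub> \<iota> (s n)) * (nrm U y + nrm U (y \<ominus>\<^bsub>U\<^esub> \<iota> (t n)))"
        using x y s(2) t(2) by (intro mult_left_mono U.nrm_le_add_diff U.nrm_nonneg) auto
      ultimately show ?thesis using x y s(1,2) t(1,2) by (simp add: cdist_def \<iota>_laws(3))
    qed
    have "approx (x \<otimes>\<^bsub>U\<^esub> y) (\<lambda>n. s n \<otimes> t n)"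
    proof (rule approxI[OF _ le])
      have "(\<lambda>n. nrm U x * cdist U y (\<iota> (t n)) + cdist U x (\<iota> (s n)) * (nrm U y + cdist U y (\<iota> (t n))))
          \<longlonglongrightarrow> nrm U x * 0 + 0 * (nrm U y + 0)"
        by (intro tendsto_intros s(3) t(3))
      then show "(\<lambda>n. nrm U x * cdist U y (\<iota> (t n)) + cdist U x (\<iota> (s n)) * (nrm U y + cdist U y (\<iota> (t n))))
          \<longlonglongrightarrow> 0" by simp
    qed (use s t pol_mult in auto)
    moreover have "(\<lambda>n. h (s n \<otimes> t n)) \<longlonglongrightarrow> \<theta> x * \<theta> y"
      using tendsto_mult[OF lim[OF x st(1)] lim[OF y st(2)]] s t by (simp add: hl)
    ultimately show ?thesis using x y by (intro eqI) auto
  qed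
  moreover have "\<theta> (c \<odot>\<^bsub>U\<^esub> x) = c * \<theta> x" if x: "x \<in> carrier U" for x c
  proof -
    obtain s where st: "approx x s" using ex x by blast
    note s = sc[OF st]
    have le: "cdist U (c \<odot>\<^bsub>U\<^esub> x) (\<iota> (c \<odot> s n)) \<le> cmod c * cdist U x (\<iota> (s n))" for n
    proof -
      have "c \<odot>\<^bsub>U\<^esub> x \<ominus>\<^bsub>U\<^esub> c \<odot>\<^bsub>U\<^esub> \<iota> (s n) = c \<odot>\<^bsub>U\<^esub> (x \<ominus>\<^bsub>U\<^esub> \<iota> (s n))"
        using x s(2) by (simp add: U.diff_eq_scale U.scale_right_distrib U.scale_scale mult.commute)
      then show ?thesis using x s(1,2) by (simp add: cdist_def \<iota>_laws(4) U.nrm_smult)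
    qed
    have "approx (c \<odot>\<^bsub>U\<^esub> x) (\<lambda>n. c \<odot> s n)"
      by (rule approxI[OF _ le]) (use s coeffs_smult tendsto_mult_left[OF s(3), of "cmod c"] in auto)
    moreover have "(\<lambda>n. h (c \<odot> s n)) \<longlonglongrightarrow> c * \<theta> x"
      using tendsto_mult_left[OF lim[OF x st], of c] s by (simp add: hl)
    ultimately show ?thesis using x by (intro eqI) auto
  qed
  moreover have "\<theta> (adj U x) = cnj (\<theta> x)" if x: "x \<in> carrier U" for x
  proof -
    obtain s where st: "approx x s" using ex x by blast
    note s = sc[OF st]
    have le: "cdist U (adj U x) (\<iota> (adj G (s n))) \<le> cdist U x (\<iota> (s n))" for n
    proof -
      have "adj U x \<ominus>\<^bsub>U\<^esub> adj U (\<iota> (s n)) = adj U (x \<ominus>\<^bsub>U\<^esub> \<iota> (s n))"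
        using x s(2) by (simp add: U.diff_eq_scale U.adj_add U.adj_smult U.adj_closed)
      then show ?thesis using x s(1,2) by (simp add: cdist_def \<iota>_laws(5) U.nrm_adj U.adj_closed)
    qed
    have "approx (adj U x) (\<lambda>n. adj G (s n))"
      by (rule approxI[OF _ le]) (use s pol_adj in auto)
    moreover have "(\<lambda>n. h (adj G (s n))) \<longlonglongrightarrow> cnj (\<theta> x)"
      using tendsto_cnj[OF lim[OF x st]] s by (simp add: hl)
    ultimately show ?thesis using x U.adj_closed by (intro eqI) auto
  qed
  moreover have "\<theta> \<one>\<^bsub>U\<^esub> = 1" using base[OF pol_one] hl(5) by (simp add: \<iota>_laws(6))
  ultimately have "\<theta> \<in> star_hom U complex_cstar" unfolding star_hom_complex_iff by blast
  with base show ?thesis by blast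
qed

section \<open>Convolution of characters and the group structure\<close>

definition conv :: "('a \<Rightarrow> complex) \<Rightarrow> ('a \<Rightarrow> complex) \<Rightarrow> 'a \<Rightarrow> complex" where
  "conv \<theta> \<theta>' a = tensor_functional \<theta> \<theta>' (comult U a)"

lemma conv_star_hom:
  assumes "\<theta> \<in> star_hom U complex_cstar" "\<theta>' \<in> star_hom U complex_cstar"
  shows "conv \<theta> \<theta>' \<in> star_hom U complex_cstar"
  using UU.tensor_functional_star_hom[OF assms comult_U_hom U.cstar_algebra_axioms]
  by (simp add: conv_def[abs_def])

lemma conv_matrix:
  assumes \<theta>: "\<theta> \<in> star_hom U complex_cstar" "\<theta>' \<in> star_hom U complex_cstar"
    and u: "unitary_rep G n u" and i: "i < n" and j: "j < n"
  shows "conv \<theta> \<theta>' (\<iota> (u i j)) = (\<Sum>k<n. \<theta> (\<iota> (u i k)) * \<theta>' (\<iota> (u k j)))"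
proof -
  let ?x = "map (\<lambda>k. (u i k, u k j)) [0..<n]"
  have "map (map_prod \<iota> \<iota>) ?x \<in> lists (carrier U \<times> carrier U)"
    using i j by (auto intro!: \<iota>_closed unitary_rep_coeffs[OF u])
  then have "conv \<theta> \<theta>' (\<iota> (u i j)) = pairing \<theta> \<theta>' (map (map_prod \<iota> \<iota>) ?x)"
    unfolding conv_def comult_\<iota>[OF unitary_rep_coeffs[OF u i j] comult_rep(2,1)[OF u i j]]
    by (rule UU.tensor_functional_tensor_of[OF \<theta>])
  then show ?thesis
    by (simp add: pairing_def comp_def interv_sum_list_conv_sum_set_nat atLeast0LessThan)
qed

lemma conv_idempotent:
  assumes \<theta>: "\<theta> \<in> star_hom U complex_cstar"
    and idem: "\<And>a. a \<in> carrier U \<Longrightarrow> conv \<theta> \<theta> a = \<theta> a"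
    and u: "unitary_rep G n u" and i: "i < n" and j: "j < n"
  shows "\<theta> (\<iota> (u i j)) = (if i = j then 1 else 0)"
proof (rule idempotent_coeff[OF star_hom_comp[OF \<iota>_hom \<theta>] u _ i j])
  fix i j assume ij: "i < n" "j < n"
  show "(\<Sum>k<n. \<theta> (\<iota> (u i k)) * \<theta> (\<iota> (u k j))) = \<theta> (\<iota> (u i j))"
    using conv_matrix[OF \<theta> \<theta> u ij] idem[OF \<iota>_closed[OF unitary_rep_coeffs[OF u ij]]] by simp
qed

abbreviation "Gr \<equiv> char_group G U \<iota>"

lemma carrier_Gr: "carrier Gr = topspace (char_space U)"
  by (simp add: char_group_def)

text \<open>Points of \<open>Gr\<close> are characters of the abelianization; \<open>ev\<close>
  turns them into characters of \<open>U\<close>, where the coproduct lives.\<close>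

definition ev :: "('a set \<Rightarrow> complex) \<Rightarrow> 'a \<Rightarrow> complex" where
  "ev \<omega> a = \<omega> (ab_class U a)"

lemma ev_star_hom: "\<omega> \<in> carrier Gr \<Longrightarrow> ev \<omega> \<in> star_hom U complex_cstar"
  using U.character_pullback by (simp add: carrier_Gr ev_def[abs_def])

lemma ev_eqI:
  assumes "\<omega> \<in> carrier Gr" "\<omega>' \<in> carrier Gr"
    and "\<And>n u i j. \<lbrakk>unitary_rep G n u; i < n; j < n\<rbrakk> \<Longrightarrow> ev \<omega> (\<iota> (u i j)) = ev \<omega>' (\<iota> (u i j))"
  shows "\<omega> = \<omega>'"
proof (rule U.char_space_eqI[OF assms(1,2)[unfolded carrier_Gr]])
  fix a assume "a \<in> carrier U"
  from character_eqI_matrix_coeffs[OF assms(1,2)[THEN ev_star_hom] _ this]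
  show "\<omega> (ab_class U a) = \<omega>' (ab_class U a)" using assms(3) by (simp add: ev_def)
qed

text \<open>This justifies the definite description of the product: the convolution is a character
  of \<open>U\<close> and so descends to the abelianization, where a character is determined by its
  values on classes.\<close>

lemma
  assumes \<omega>: "\<omega> \<in> carrier Gr" and \<omega>': "\<omega>' \<in> carrier Gr"
  shows Gr_mult_closed: "\<omega> \<otimes>\<^bsub>Gr\<^esub> \<omega>' \<in> carrier Gr"
    and ev_mult: "a \<in> carrier U \<Longrightarrow> ev (\<omega> \<otimes>\<^bsub>Gr\<^esub> \<omega>') a = conv (ev \<omega>) (ev \<omega>') a"
proof -
  let ?Q = "\<lambda>\<nu>. \<nu> \<in> topspace (char_space U) \<and>
    (\<forall>a\<in>carrier U. \<nu> (ab_class U a) = conv (ev \<omega>) (ev \<omega>') a)"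
  have eq: "\<omega> \<otimes>\<^bsub>Gr\<^esub> \<omega>' = (THE \<nu>. ?Q \<nu>)"
    by (simp add: char_group_def conv_def ev_def[abs_def])
  have "\<exists>\<nu>. ?Q \<nu>"
    using U.character_descends[OF conv_star_hom[OF ev_star_hom[OF \<omega>] ev_star_hom[OF \<omega>']]]
    unfolding Bex_def .
  moreover have "\<nu> = \<nu>'" if "?Q \<nu>" "?Q \<nu>'" for \<nu> \<nu>'
    by (rule U.char_space_eqI) (use that in simp_all)
  ultimately have "\<exists>!\<nu>. ?Q \<nu>" by (rule ex_ex1I)
  then have Q: "?Q (\<omega> \<otimes>\<^bsub>Gr\<^esub> \<omega>')" unfolding eq by (rule theI')
  show "\<omega> \<otimes>\<^bsub>Gr\<^esub> \<omega>' \<in> carrier Gr"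
    "a \<in> carrier U \<Longrightarrow> ev (\<omega> \<otimes>\<^bsub>Gr\<^esub> \<omega>') a = conv (ev \<omega>) (ev \<omega>') a"
    using Q by (simp_all add: carrier_Gr ev_def[of "\<omega> \<otimes>\<^bsub>Gr\<^esub> \<omega>'"])
qed

text \<open>Existence comes from extending the counit to \<open>U\<close> and descending to the
  abelianization, uniqueness from density of the image of \<open>coeffs G\<close>.\<close>

lemma Gr_one_closed: "\<one>\<^bsub>Gr\<^esub> \<in> carrier Gr"
  and ev_one: "\<lbrakk>unitary_rep G n u; i < n; j < n\<rbrakk> \<Longrightarrow> ev \<one>\<^bsub>Gr\<^esub> (\<iota> (u i j)) = (if i = j then 1 else 0)"
proof -
  let ?Q = "\<lambda>\<nu>. \<nu> \<in> topspace (char_space U) \<and> (\<forall>a\<in>coeffs G. \<nu> (ab_class U (\<iota> a)) = counit G a)"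
  have eq: "\<one>\<^bsub>Gr\<^esub> = (THE \<nu>. ?Q \<nu>)" by (simp add: char_group_def)
  obtain \<theta> where \<theta>: "\<theta> \<in> star_hom U complex_cstar" "\<forall>a\<in>coeffs G. \<theta> (\<iota> a) = counit G a"
    using character_extension[OF counit_hom] by blast
  have "\<exists>\<nu>. ?Q \<nu>" using U.character_descends[OF \<theta>(1)] \<theta>(2) \<iota>_closed by metis
  moreover have "\<nu> = \<nu>'" if "?Q \<nu>" "?Q \<nu>'" for \<nu> \<nu>'
    by (rule ev_eqI) (use that unitary_rep_coeffs in \<open>auto simp: carrier_Gr ev_def\<close>)
  ultimately have "\<exists>!\<nu>. ?Q \<nu>" by (rule ex_ex1I)
  then have Q: "?Q \<one>\<^bsub>Gr\<^esub>" unfolding eq by (rule theI')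
  then show "\<one>\<^bsub>Gr\<^esub> \<in> carrier Gr" by (simp add: carrier_Gr)
  show "\<lbrakk>unitary_rep G n u; i < n; j < n\<rbrakk> \<Longrightarrow> ev \<one>\<^bsub>Gr\<^esub> (\<iota> (u i j)) = (if i = j then 1 else 0)"
    using Q unitary_rep_coeffs counit_coeff by (simp add: ev_def)
qed

lemma ev_mult_matrix:
  assumes "\<omega> \<in> carrier Gr" "\<omega>' \<in> carrier Gr" "unitary_rep G n u" "i < n" "j < n"
  shows "ev (\<omega> \<otimes>\<^bsub>Gr\<^esub> \<omega>') (\<iota> (u i j)) = (\<Sum>k<n. ev \<omega> (\<iota> (u i k)) * ev \<omega>' (\<iota> (u k j)))"
  using ev_mult[OF assms(1,2) \<iota>_closed[OF unitary_rep_coeffs[OF assms(3-5)]]]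
    conv_matrix[OF ev_star_hom[OF assms(1)] ev_star_hom[OF assms(2)] assms(3-5)] by simp

text \<open>Both sides evaluate to identity matrices. Transported by a multiplicative map, the
  equation makes the image of the neutral element idempotent.\<close>

lemma Gr_one_mult_one: "\<one>\<^bsub>Gr\<^esub> \<otimes>\<^bsub>Gr\<^esub> \<one>\<^bsub>Gr\<^esub> = \<one>\<^bsub>Gr\<^esub>"
proof (rule ev_eqI[OF Gr_mult_closed[OF Gr_one_closed Gr_one_closed] Gr_one_closed])
  fix n u i j assume u: "unitary_rep G n u" "i < n" "j < n"
  have "(\<Sum>k<n. ev \<one>\<^bsub>Gr\<^esub> (\<iota> (u i k)) * ev \<one>\<^bsub>Gr\<^esub> (\<iota> (u k j))) =
      (\<Sum>k<n. if k = j then (if i = k then 1 else 0) else 0)"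
    using u by (intro sum.cong refl) (simp add: ev_one)
  then show "ev (\<one>\<^bsub>Gr\<^esub> \<otimes>\<^bsub>Gr\<^esub> \<one>\<^bsub>Gr\<^esub>) (\<iota> (u i j)) = ev \<one>\<^bsub>Gr\<^esub> (\<iota> (u i j))"
    using u by (simp add: ev_mult_matrix[OF Gr_one_closed Gr_one_closed] ev_one)
qed

lemma Gr_idempotent:
  assumes \<omega>: "\<omega> \<in> carrier Gr" and "\<omega> \<otimes>\<^bsub>Gr\<^esub> \<omega> = \<omega>"
  shows "\<omega> = \<one>\<^bsub>Gr\<^esub>"
proof (rule ev_eqI[OF \<omega> Gr_one_closed])
  fix n u i j assume u: "unitary_rep G n u" "i < n" "j < n"
  show "ev \<omega> (\<iota> (u i j)) = ev \<one>\<^bsub>Gr\<^esub> (\<iota> (u i j))"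
    using conv_idempotent[OF ev_star_hom[OF \<omega>] _ u] ev_mult[OF \<omega> \<omega>] assms(2) ev_one[OF u] by simp
qed

text \<open>The matrix of \<open>\<omega>\<close> is unitary, so that of a right inverse must be its
  adjoint. Right inverses in \<open>Gr\<close> are therefore unique.\<close>

lemma Gr_right_inverse:
  assumes \<omega>: "\<omega> \<in> carrier Gr" and \<omega>': "\<omega>' \<in> carrier Gr" and eq: "\<omega> \<otimes>\<^bsub>Gr\<^esub> \<omega>' = \<one>\<^bsub>Gr\<^esub>"
    and u: "unitary_rep G n u" and i: "i < n" and j: "j < n"
  shows "ev \<omega>' (\<iota> (u i j)) = cnj (ev \<omega> (\<iota> (u j i)))"
proof -
  note f = star_hom_comp[OF \<iota>_hom ev_star_hom[OF \<omega>]]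
  have "cnj (ev \<omega> (\<iota> (u j i))) = ev \<omega>' (\<iota> (u i j))"
  proof (rule matrix_inverse_unique[where S="{..<n}" and M="\<lambda>i j. ev \<omega> (\<iota> (u i j))"
        and N="\<lambda>i j. cnj (ev \<omega> (\<iota> (u j i)))" and R="\<lambda>i j. ev \<omega>' (\<iota> (u i j))"])
    show "(\<Sum>k\<in>{..<n}. cnj (ev \<omega> (\<iota> (u k i))) * ev \<omega> (\<iota> (u k j))) = (if i = j then 1 else 0)"
      if "j \<in> {..<n}" for j using unitary_matrix(1)[OF f u i] that by simp
    show "(\<Sum>k\<in>{..<n}. ev \<omega> (\<iota> (u i k)) * ev \<omega>' (\<iota> (u k j))) = (if i = j then 1 else 0)"
      if "i \<in> {..<n}" for i
      using ev_mult_matrix[OF \<omega> \<omega>' u _ j, of i] ev_one[OF u _ j, of i] that eq by simp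
  qed (use i j in auto)
  then show ?thesis by simp
qed

text \<open>The inverse is the composite of the character with the antipode, extended to
  \<open>U\<close>; its matrices are the adjoints of those of \<open>\<omega>\<close>.\<close>

lemma Gr_inverse_exists:
  assumes \<omega>: "\<omega> \<in> carrier Gr"
  shows "\<exists>\<omega>'\<in>carrier Gr. \<omega> \<otimes>\<^bsub>Gr\<^esub> \<omega>' = \<one>\<^bsub>Gr\<^esub> \<and> \<omega>' \<otimes>\<^bsub>Gr\<^esub> \<omega> = \<one>\<^bsub>Gr\<^esub>"
proof -
  note f = star_hom_comp[OF \<iota>_hom ev_star_hom[OF \<omega>]]
  obtain \<theta> where \<theta>: "\<theta> \<in> star_hom U complex_cstar"
    "\<forall>a\<in>coeffs G. \<theta> (\<iota> a) = ev \<omega> (\<iota> (antipode G a))"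
    using character_extension[OF antipode_star_hom[OF f]] by blast
  obtain \<omega>' where \<omega>': "\<omega>' \<in> carrier Gr" "\<forall>a\<in>carrier U. ev \<omega>' a = \<theta> a"
    using U.character_descends[OF \<theta>(1)] by (auto simp: carrier_Gr ev_def)
  have m: "ev \<omega>' (\<iota> (u i j)) = cnj (ev \<omega> (\<iota> (u j i)))" if "unitary_rep G n u" "i < n" "j < n" for n u i j
    using \<omega>'(2) \<theta>(2) antipode_coeff[OF f that] unitary_rep_coeffs[OF that] \<iota>_closed by simp
  have "\<omega> \<otimes>\<^bsub>Gr\<^esub> \<omega>' = \<one>\<^bsub>Gr\<^esub>"
  proof (rule ev_eqI[OF Gr_mult_closed[OF \<omega> \<omega>'(1)] Gr_one_closed])
    fix n u i j assume u: "unitary_rep G n u" "i < n" "j < n"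
    show "ev (\<omega> \<otimes>\<^bsub>Gr\<^esub> \<omega>') (\<iota> (u i j)) = ev \<one>\<^bsub>Gr\<^esub> (\<iota> (u i j))"
      using unitary_matrix(2)[OF f u] u
      by (simp add: ev_mult_matrix[OF \<omega> \<omega>'(1)] ev_one m)
  qed
  moreover have "\<omega>' \<otimes>\<^bsub>Gr\<^esub> \<omega> = \<one>\<^bsub>Gr\<^esub>"
  proof (rule ev_eqI[OF Gr_mult_closed[OF \<omega>'(1) \<omega>] Gr_one_closed])
    fix n u i j assume u: "unitary_rep G n u" "i < n" "j < n"
    show "ev (\<omega>' \<otimes>\<^bsub>Gr\<^esub> \<omega>) (\<iota> (u i j)) = ev \<one>\<^bsub>Gr\<^esub> (\<iota> (u i j))"
      using unitary_matrix(1)[OF f u] u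
      by (simp add: ev_mult_matrix[OF \<omega>'(1) \<omega>] ev_one m)
  qed
  ultimately show ?thesis using \<omega>'(1) by blast
qed

text \<open>\<open>inv\<close> is a definite description of a two-sided inverse. One exists, and by
  uniqueness of right inverses it is \<open>\<omega>'\<close>.\<close>

lemma Gr_inv_eqI:
  assumes \<omega>: "\<omega> \<in> carrier Gr" and \<omega>': "\<omega>' \<in> carrier Gr" and eq: "\<omega> \<otimes>\<^bsub>Gr\<^esub> \<omega>' = \<one>\<^bsub>Gr\<^esub>"
  shows "inv\<^bsub>Gr\<^esub> \<omega> = \<omega>'"
proof -
  have unique: "\<nu> = \<omega>'" if "\<nu> \<in> carrier Gr" "\<omega> \<otimes>\<^bsub>Gr\<^esub> \<nu> = \<one>\<^bsub>Gr\<^esub>" for \<nu>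
    by (rule ev_eqI[OF that(1) \<omega>']) (simp add: Gr_right_inverse[OF \<omega> that] Gr_right_inverse[OF \<omega> \<omega>' eq])
  obtain \<nu> where \<nu>: "\<nu> \<in> carrier Gr" "\<omega> \<otimes>\<^bsub>Gr\<^esub> \<nu> = \<one>\<^bsub>Gr\<^esub>" "\<nu> \<otimes>\<^bsub>Gr\<^esub> \<omega> = \<one>\<^bsub>Gr\<^esub>"
    using Gr_inverse_exists[OF \<omega>] by blast
  have "\<omega>' \<otimes>\<^bsub>Gr\<^esub> \<omega> = \<one>\<^bsub>Gr\<^esub>" using \<nu>(3) unfolding unique[OF \<nu>(1,2)] .
  then show ?thesis
    unfolding m_inv_def
    by (intro the_equality conjI \<omega>' eq) (simp_all only: unique)
qed

end

section \<open>The group of characters of a quotient\<close>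

text \<open>The Gelfand dual \<open>phat\<close> enters as precomposition of characters with
  \<open>\<pi>\<close>, the form in which \<open>gelfand_dual_ab_map\<close> delivers it.\<close>

locale cqg_quotient =
  G: cqg_completion G UG \<iota>G + H: cqg_completion H UH \<iota>H
  for G :: "('g, 'm) cqg_scheme" and UG :: "('a, 'n) cbialg_scheme" and \<iota>G :: "'g \<Rightarrow> 'a"
    and H :: "('h, 'p) cqg_scheme" and UH :: "('c, 'q) cbialg_scheme" and \<iota>H :: "'h \<Rightarrow> 'c" +
  fixes \<pi> :: "'a \<Rightarrow> 'c" and phat :: "('c set \<Rightarrow> complex) \<Rightarrow> 'a set \<Rightarrow> complex"
  assumes \<pi>: "\<pi> \<in> cqg_hom UG UH" and \<pi>_surj: "\<pi> ` carrier UG = carrier UH"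
    and phat_closed: "\<omega> \<in> carrier H.Gr \<Longrightarrow> phat \<omega> \<in> carrier G.Gr"
    and ev_phat: "\<lbrakk>\<omega> \<in> carrier H.Gr; a \<in> carrier UG\<rbrakk> \<Longrightarrow> G.ev (phat \<omega>) a = H.ev \<omega> (\<pi> a)"
begin

lemma \<pi>_hom: "\<pi> \<in> star_hom UG UH"
  and comult_\<pi>: "a \<in> carrier UG \<Longrightarrow> comult UH (\<pi> a) = tensor_map UH UH \<pi> \<pi> (comult UG a)"
  using \<pi> by (auto simp: cqg_hom_def)

lemma phat_eqI:
  assumes "\<nu> \<in> carrier G.Gr" "\<omega> \<in> carrier H.Gr"
    and "\<And>a. a \<in> carrier UG \<Longrightarrow> G.ev \<nu> a = H.ev \<omega> (\<pi> a)"
  shows "\<nu> = phat \<omega>"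
proof (rule G.U.char_space_eqI)
  show "\<nu> \<in> topspace (char_space UG)" "phat \<omega> \<in> topspace (char_space UG)"
    using assms(1) phat_closed[OF assms(2)] by (simp_all add: G.carrier_Gr)
  fix a assume a: "a \<in> carrier UG"
  show "\<nu> (ab_class UG a) = phat \<omega> (ab_class UG a)"
    using assms(3)[OF a] ev_phat[OF assms(2) a] by (simp add: G.ev_def)
qed

lemma phat_mult:
  assumes \<omega>: "\<omega> \<in> carrier H.Gr" and \<omega>': "\<omega>' \<in> carrier H.Gr"
  shows "phat \<omega> \<otimes>\<^bsub>G.Gr\<^esub> phat \<omega>' = phat (\<omega> \<otimes>\<^bsub>H.Gr\<^esub> \<omega>')"
proof (rule phat_eqI)
  note pc = phat_closed[OF \<omega>] phat_closed[OF \<omega>']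
  show "phat \<omega> \<otimes>\<^bsub>G.Gr\<^esub> phat \<omega>' \<in> carrier G.Gr" by (rule G.Gr_mult_closed[OF pc])
  show "\<omega> \<otimes>\<^bsub>H.Gr\<^esub> \<omega>' \<in> carrier H.Gr" by (rule H.Gr_mult_closed[OF \<omega> \<omega>'])
  fix a assume a: "a \<in> carrier UG"
  have \<pi>a: "\<pi> a \<in> carrier UH" by (rule star_hom_closed[OF \<pi>_hom a])
  have \<Delta>: "comult UG a \<in> carrier (min_tensor UG UG)" by (rule star_hom_closed[OF G.comult_U_hom a])
  have \<Delta>H: "tensor_map UH UH \<pi> \<pi> (comult UG a) \<in> carrier (min_tensor UH UH)"
    using star_hom_closed[OF H.comult_U_hom \<pi>a] comult_\<pi>[OF a] by simp
  have "G.ev (phat \<omega> \<otimes>\<^bsub>G.Gr\<^esub> phat \<omega>') a =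
      tensor_functional (G.ev (phat \<omega>)) (G.ev (phat \<omega>')) (comult UG a)"
    by (simp add: G.ev_mult[OF pc a] G.conv_def)
  \<comment> \<open>The functionals are known to agree on \<open>carrier UG\<close> only, so they
    are compared along a sequence representing the coproduct.\<close>
  also have "\<dots> = tensor_functional (\<lambda>a. H.ev \<omega> (\<pi> a)) (\<lambda>a. H.ev \<omega>' (\<pi> a)) (comult UG a)"
  proof -
    obtain s where s: "s \<in> comult UG a" "\<And>n. s n \<in> lists (carrier UG \<times> carrier UG)"
      using G.UU.carrier_nonempty[OF \<Delta>] by metis
    have "(\<lambda>n. pairing (\<lambda>a. H.ev \<omega> (\<pi> a)) (\<lambda>a. H.ev \<omega>' (\<pi> a)) (s n)) \<longlonglongrightarrow>
        tensor_functional (\<lambda>a. H.ev \<omega> (\<pi> a)) (\<lambda>a. H.ev \<omega>' (\<pi> a)) (comult UG a)"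
      by (intro G.UU.tensor_functional_tendsto star_hom_comp[OF \<pi>_hom] H.ev_star_hom \<omega> \<omega>' \<Delta> s)
    moreover have "pairing (G.ev (phat \<omega>)) (G.ev (phat \<omega>')) (s n) =
        pairing (\<lambda>a. H.ev \<omega> (\<pi> a)) (\<lambda>a. H.ev \<omega>' (\<pi> a)) (s n)" for n
      by (rule pairing_cong[OF s(2)]) (simp_all add: ev_phat \<omega> \<omega>')
    ultimately show ?thesis
      by (intro G.UU.tensor_functional_eqI[OF G.ev_star_hom[OF pc(1)] G.ev_star_hom[OF pc(2)] \<Delta> s(1)]) simp
  qed
  also have "\<dots> = tensor_functional (H.ev \<omega>) (H.ev \<omega>') (comult UH (\<pi> a))"
    unfolding comult_\<pi>[OF a]
    by (rule tensor_functional_tensor_map[symmetric, OF G.UU.cstar_pair_axioms H.UU.cstar_pair_axioms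
          \<pi>_hom \<pi>_hom H.ev_star_hom[OF \<omega>] H.ev_star_hom[OF \<omega>'] \<Delta> \<Delta>H])
  also have "\<dots> = H.ev (\<omega> \<otimes>\<^bsub>H.Gr\<^esub> \<omega>') (\<pi> a)"
    by (simp add: H.ev_mult[OF \<omega> \<omega>' \<pi>a] H.conv_def)
  finally show "G.ev (phat \<omega> \<otimes>\<^bsub>G.Gr\<^esub> phat \<omega>') a = H.ev (\<omega> \<otimes>\<^bsub>H.Gr\<^esub> \<omega>') (\<pi> a)" .
qed

lemma phat_one: "phat \<one>\<^bsub>H.Gr\<^esub> = \<one>\<^bsub>G.Gr\<^esub>"
proof (rule G.Gr_idempotent)
  show "phat \<one>\<^bsub>H.Gr\<^esub> \<in> carrier G.Gr" by (rule phat_closed[OF H.Gr_one_closed])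
  show "phat \<one>\<^bsub>H.Gr\<^esub> \<otimes>\<^bsub>G.Gr\<^esub> phat \<one>\<^bsub>H.Gr\<^esub> = phat \<one>\<^bsub>H.Gr\<^esub>"
    unfolding phat_mult[OF H.Gr_one_closed H.Gr_one_closed] H.Gr_one_mult_one ..
qed

lemma phat_inv:
  assumes "\<omega> \<in> carrier H.Gr"
  shows "\<exists>\<omega>'\<in>carrier H.Gr. inv\<^bsub>G.Gr\<^esub> phat \<omega> = phat \<omega>'"
proof -
  obtain \<omega>' where \<omega>': "\<omega>' \<in> carrier H.Gr" "\<omega> \<otimes>\<^bsub>H.Gr\<^esub> \<omega>' = \<one>\<^bsub>H.Gr\<^esub>"
    using H.Gr_inverse_exists[OF assms] by blast
  have "phat \<omega> \<otimes>\<^bsub>G.Gr\<^esub> phat \<omega>' = \<one>\<^bsub>G.Gr\<^esub>"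
    unfolding phat_mult[OF assms \<omega>'(1)] \<omega>'(2) by (rule phat_one)
  then have "inv\<^bsub>G.Gr\<^esub> phat \<omega> = phat \<omega>'"
    by (rule G.Gr_inv_eqI[OF phat_closed[OF assms] phat_closed[OF \<omega>'(1)]])
  then show ?thesis using \<omega>'(1) by blast
qed

lemma generate_subset_phat:
  assumes S: "S \<subseteq> phat ` carrier H.Gr"
  shows "generate G.Gr S \<subseteq> phat ` carrier H.Gr"
proof
  fix x assume "x \<in> generate G.Gr S"
  then show "x \<in> phat ` carrier H.Gr"
  proof induction
    case one
    show ?case using phat_one[symmetric] H.Gr_one_closed by (rule image_eqI)
  next
    case (incl h)
    then show ?case using S by blast
  next
    case (inv h)
    then obtain \<omega> where \<omega>: "\<omega> \<in> carrier H.Gr" "h = phat \<omega>" using S by blast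
    then show ?case using phat_inv[OF \<omega>(1)] by blast
  next
    case (eng h1 h2)
    then obtain \<omega> \<omega>' where "\<omega> \<in> carrier H.Gr" "h1 = phat \<omega>" "\<omega>' \<in> carrier H.Gr" "h2 = phat \<omega>'" by blast
    then show ?case using phat_mult H.Gr_mult_closed by blast
  qed
qed

text \<open>Surjectivity of \<open>\<pi>\<close> makes this image the set of characters vanishing on the kernel of \<open>\<pi>\<close>,
  which is closed without any compactness argument.\<close>

lemma phat_image:
  "phat ` carrier H.Gr = {\<omega> \<in> carrier G.Gr. \<forall>a\<in>carrier UG. \<pi> a = \<zero>\<^bsub>UH\<^esub> \<longrightarrow> G.ev \<omega> a = 0}"
    (is "_ = ?K")
proof
  show "phat ` carrier H.Gr \<subseteq> ?K"
    using phat_closed ev_phat H.U.star_hom_zero[OF H.ev_star_hom] by auto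
  show "?K \<subseteq> phat ` carrier H.Gr"
  proof
    fix \<omega> assume "\<omega> \<in> ?K"
    then have \<omega>: "\<omega> \<in> carrier G.Gr" and van: "\<And>a. \<lbrakk>a \<in> carrier UG; \<pi> a = \<zero>\<^bsub>UH\<^esub>\<rbrakk> \<Longrightarrow> G.ev \<omega> a = 0"
      by auto
    note e = G.ev_star_hom[OF \<omega>]
    have well: "G.ev \<omega> a = G.ev \<omega> a'" if "a \<in> carrier UG" "a' \<in> carrier UG" "\<pi> a = \<pi> a'" for a a'
    proof -
      have \<pi>c: "\<pi> a' \<in> carrier UH" by (rule star_hom_closed[OF \<pi>_hom that(2)])
      have "\<pi> (a \<oplus>\<^bsub>UG\<^esub> (-1) \<odot>\<^bsub>UG\<^esub> a') = \<pi> a' \<oplus>\<^bsub>UH\<^esub> (-1) \<odot>\<^bsub>UH\<^esub> \<pi> a'"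
        using that by (simp add: star_hom_add[OF \<pi>_hom] star_hom_smult[OF \<pi>_hom])
      also have "\<dots> = \<zero>\<^bsub>UH\<^esub>"
        using \<pi>c H.U.scale_left_distrib[OF \<pi>c, of 1 "-1"] by simp
      finally have "G.ev \<omega> (a \<oplus>\<^bsub>UG\<^esub> (-1) \<odot>\<^bsub>UG\<^esub> a') = 0" using that by (intro van) auto
      then show ?thesis using that by (simp add: star_hom_add[OF e] star_hom_smult[OF e])
    qed
    \<comment> \<open>A preimage under \<open>\<pi>\<close> is chosen for each element;
      \<open>well\<close> makes the choice irrelevant.\<close>
    define \<theta> where "\<theta> w = G.ev \<omega> (SOME a. a \<in> carrier UG \<and> \<pi> a = w)" for w
    have \<theta>: "\<theta> (\<pi> a) = G.ev \<omega> a" if "a \<in> carrier UG" for a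
      unfolding \<theta>_def
      by (rule someI2[of _ a]) (use that in \<open>auto intro!: well\<close>)
    have "\<theta> \<in> star_hom UH complex_cstar"
      unfolding star_hom_complex_iff \<pi>_surj[symmetric]
      using star_homD(2-)[OF \<pi>_hom, symmetric] star_homD(2-)[OF e] G.U.adj_closed
      by (auto simp: \<theta> G.U.unit_closed)
    then obtain \<nu> where \<nu>: "\<nu> \<in> carrier H.Gr" "\<forall>w\<in>carrier UH. H.ev \<nu> w = \<theta> w"
      using H.U.character_descends by (auto simp: H.carrier_Gr H.ev_def)
    have "\<omega> = phat \<nu>"
      by (rule phat_eqI[OF \<omega> \<nu>(1)]) (use \<nu>(2) \<theta> star_hom_closed[OF \<pi>_hom] in auto)
    then show "\<omega> \<in> phat ` carrier H.Gr" using \<nu>(1) by blast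
  qed
qed

lemma closedin_phat_image: "closedin (char_space UG) (phat ` carrier H.Gr)"
proof -
  let ?Z = "\<lambda>a. {\<omega> \<in> topspace (char_space UG). \<omega> (ab_class UG a) \<in> {0}}"
  have Z: "closedin (char_space UG) (?Z a)" if "a \<in> carrier UG" for a
    by (rule closedin_continuous_map_preimage[OF G.U.continuous_map_char_space_eval[OF that]]) simp
  \<comment> \<open>The image is an intersection of zero sets of evaluations; the whole space is
    inserted so that the family is visibly nonempty.\<close>
  have "phat ` carrier H.Gr =
      \<Inter>(insert (topspace (char_space UG)) (?Z ` {a \<in> carrier UG. \<pi> a = \<zero>\<^bsub>UH\<^esub>}))"
    unfolding phat_image by (auto simp: G.carrier_Gr G.ev_def)
  also have "closedin (char_space UG) \<dots>"
    by (rule closedin_Inter) (use Z in auto)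
  finally show ?thesis .
qed

end

theorem theorem1p1:
  fixes G :: "'g cqg" and UG :: "'a cbialg" and \<iota>G :: "'g \<Rightarrow> 'a"
    and H :: "'h cqg" and UH :: "'c cbialg" and \<iota>H :: "'h \<Rightarrow> 'c"
    and B :: "'b cstar" and \<beta> :: "'a \<Rightarrow> 'b" and \<pi> :: "'a \<Rightarrow> 'c" and \<beta>t :: "'c \<Rightarrow> 'b"
    and b :: "(('a set \<Rightarrow> complex) \<Rightarrow> complex) \<Rightarrow> (('b set \<Rightarrow> complex) \<Rightarrow> complex)"
    and bhat :: "('b set \<Rightarrow> complex) \<Rightarrow> ('a set \<Rightarrow> complex)"
    and p :: "(('a set \<Rightarrow> complex) \<Rightarrow> complex) \<Rightarrow> (('c set \<Rightarrow> complex) \<Rightarrow> complex)"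
    and phat :: "('c set \<Rightarrow> complex) \<Rightarrow> ('a set \<Rightarrow> complex)"
  assumes "compact_quantum_group G" and "universal_completion G UG \<iota>G"
    and "cstar_algebra B" and "\<beta> \<in> star_hom UG B"
    and "hopf_image UG B \<beta> H UH \<iota>H \<pi> \<beta>t"
    and "b \<in> star_hom (cont_algebra (char_space UG)) (cont_algebra (char_space B))"
    and "\<forall>a\<in>carrier UG. b (ab_map UG a) = ab_map B (\<beta> a)"
    and "gelfand_dual (char_space UG) (char_space B) b bhat"
    and "p \<in> star_hom (cont_algebra (char_space UG)) (cont_algebra (char_space UH))"
    and "\<forall>a\<in>carrier UG. p (ab_map UG a) = ab_map UH (\<pi> a)"
    and "gelfand_dual (char_space UG) (char_space UH) p phat"
  shows "char_space UG closure_of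
           generate (char_group G UG \<iota>G) (bhat ` topspace (char_space B))
         \<subseteq> phat ` carrier (char_group H UH \<iota>H)"
proof -
  have fact: "factorization UG B \<beta> H UH \<iota>H \<pi> \<beta>t" using assms(5) by (simp add: hopf_image_def)
  have H: "compact_quantum_group H" "universal_completion H UH \<iota>H"
    and \<pi>: "\<pi> \<in> cqg_hom UG UH" "\<pi> ` carrier UG = carrier UH"
    and \<beta>t: "\<beta>t \<in> star_hom UH B" "\<And>a. a \<in> carrier UG \<Longrightarrow> \<beta>t (\<pi> a) = \<beta> a"
    using fact by (auto simp: factorization_def)
  interpret G: cqg_completion G UG \<iota>G
    by (intro cqg_completion.intro cqg_completion_axioms.intro assms(1,2))
  interpret H: cqg_completion H UH \<iota>H
    by (intro cqg_completion.intro cqg_completion_axioms.intro H)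
  interpret B: cstar_algebra B by (rule assms(3))
  note dual = gelfand_dual_ab_map[OF assms(11,10) G.U.cstar_algebra_axioms]
  note dualB = gelfand_dual_ab_map[OF assms(8,7) G.U.cstar_algebra_axioms]
  interpret cqg_quotient G UG \<iota>G H UH \<iota>H \<pi> phat
  proof
    show "phat \<omega> \<in> carrier G.Gr" if "\<omega> \<in> carrier H.Gr" for \<omega>
      using dual(1)[OF _ G.U.unit_closed] that by (simp add: G.carrier_Gr H.carrier_Gr)
    show "G.ev (phat \<omega>) a = H.ev \<omega> (\<pi> a)" if "\<omega> \<in> carrier H.Gr" "a \<in> carrier UG" for \<omega> a
      using dual(2)[OF _ that(2)] that(1) by (simp add: G.ev_def H.ev_def H.carrier_Gr)
  qed (fact \<pi>)+
  have "bhat ` topspace (char_space B) \<subseteq> phat ` carrier H.Gr"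
    unfolding phat_image
  proof (intro subsetI CollectI conjI ballI impI; elim imageE)
    fix \<nu> \<tau> assume \<tau>: "\<tau> \<in> topspace (char_space B)" "\<nu> = bhat \<tau>"
    then show "\<nu> \<in> carrier G.Gr" using dualB(1)[OF \<tau>(1) G.U.unit_closed] by (simp add: G.carrier_Gr)
    fix a assume a: "a \<in> carrier UG" "\<pi> a = \<zero>\<^bsub>UH\<^esub>"
    \<comment> \<open>Pulled back to \<open>UG\<close>, the point \<open>bhat \<tau>\<close> is
      \<tau> after \<beta>, hence a character of \<open>UH\<close> after \<open>\<pi>\<close>, and
      so it vanishes where \<open>\<pi>\<close> does.\<close>
    have "G.ev \<nu> a = \<tau> (ab_class B (\<beta>t (\<pi> a)))"
      using dualB(2)[OF \<tau>(1) a(1)] \<tau>(2) \<beta>t(2)[OF a(1)] by (simp add: G.ev_def)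
    also have "\<dots> = 0"
      unfolding a(2) by (rule H.U.star_hom_zero[OF star_hom_comp[OF \<beta>t(1) B.character_pullback[OF \<tau>(1)]]])
    finally show "G.ev \<nu> a = 0" .
  qed
  from closure_of_minimal[OF generate_subset_phat[OF this] closedin_phat_image] show ?thesis .
qed

end
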